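(* Let $d\in\{0,1\}$, let $\left(P_{2N+d}\right)_{N=1}^\infty\in\mathbb{P}_d(\beta,\gamma,\delta)$, and let $x_k=x_{k,N,d}$, $1\le k\le N$, be the positive zeros of $P_{2N+d}$. Let $(u_N)_{N=1}^\infty$ be a sequence of positive numbers such that $u_N\notin\{x_{1,N,d},\ldots,x_{N,N,d}\}$ and $\lim_{N\to\infty}\beta_N u_N=\infty$. Let $\Omega_{N+2,d}:=\{0,\,u_N^2,\,x_{1,N,d}^2,\ldots,x_{N,N,d}^2\}$. If $s\in\mathbb{C}$ and $\mathrm{Re}\,s>d$, then $$\lim_{N\to\infty}\left[\frac{u_N^2\prod_{k=1}^N x_{k,N,d}^2}{N}\int_0^\infty B_N^*\left(\frac{N}{\beta_N^2}t,\Omega_{N+2,d}\right)t^{(s-d)/2-1}\,dt\right]=\int_0^\infty\varTheta_d(t)\,t^{(s-d)/2-1}\,dt .$$ Moreover, for every $r>d$, the convergence is uniform on any compact subset of the line $\mathrm{Re}\,s=r$.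
   Context: Notation: $h_0(z)=\cosh z$, $h_1(z)=\sinh z$. Class $\mathbb{P}_d(\beta,\gamma,\delta)$ ($d\in\{0,1\}$): let $\beta=(\beta_N)_{N\ge1}$ and $\gamma=(\gamma_N)_{N\ge1}$ be increasing sequences of positive numbers and $\delta=(\delta_N)_{N\ge1}$ a decreasing sequence of positive numbers with $\lim\beta_N=\lim\gamma_N=\lim\delta_N^{-1}=\infty$. Let $\Pi_d=(P_{2N+d})_{N=1}^\infty$ be a sequence of even (if $d=0$) or odd (if $d=1$) polynomials with real coefficients, $P_{2N+d}(z)=z^{2N+d}+\ldots$ of degree $2N+d$, having only real zeros, all of multiplicity 1: the zeros are $\pm x_{k,N,d}$, $1\le k\le N$, with $x_{k,N,d}>0$, together with $x_0=0$ if $d=1$. Then $\Pi_d\in\mathbb{P}_d(\beta,\gamma,\delta)$ means that there is a constant $C$ depending only on $\Pi_d$ such that for all $N$ and all $z\in\mathbb{C}$ with $|z|\le\gamma_N$, $$\left|\frac{\beta_N^d P_{2N+d}(z/\beta_N)}{P_{2N+d}^{(d)}(0)}-\cos(z-d\pi/2)\right|\le C\,\delta_N\min(|z|^2,1)\,h_d(|z|).$$ $B$-spline of degree $N$ with a set $\Omega\subset\mathbb{R}$ of $N+2$ distinct knots: $B_N(t,\Omega):=(N+1)\sum_{v\in\Omega}\frac{(v-t)_+^N}{W'(v)}$, $t\in\mathbb{R}$, where $W(u)=\prod_{v\in\Omega}(u-v)$ and $x_+=\max(x,0)$. Associated $B$-spline, for $\Omega\subset[0,\infty)$: $B_N^*(t,\Omega):=t^{-N}B_N(t,\Omega)$,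 with $B_N^*(0,\Omega):=\lim_{t\to0+}B_N^*(t,\Omega)$. Theta-like functions, for $t>0$: $$\varTheta_0(t)=1-\frac4\pi\sum_{k=0}^\infty(-1)^k\frac{\exp\left(-(\pi^2/4)(2k+1)^2t^{-1}\right)}{2k+1},\qquad \varTheta_1(t)=1+2\sum_{k=1}^\infty(-1)^k\exp\left(-(\pi k)^2t^{-1}\right).$$ *)

theory Defs
  imports "HOL-Analysis.Analysis" "HOL-Computational_Algebra.Polynomial"
begin

text \<open>All sequences are indexed by \<open>N \<ge> 1\<close>; the values at \<open>N = 0\<close> are irrelevant.
  The parity parameter \<open>d\<close> is always \<open>0\<close> or \<open>1\<close>.\<close>

definition h :: "nat \<Rightarrow> real \<Rightarrow> real" where
  "h d z = (if d = 0 then cosh z else sinh z)"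

text \<open>Increasing and decreasing are meant in the weak sense.\<close>

definition admissible_scales ::
    "(nat \<Rightarrow> real) \<Rightarrow> (nat \<Rightarrow> real) \<Rightarrow> (nat \<Rightarrow> real) \<Rightarrow> bool" where
  "admissible_scales \<beta> \<gamma> \<delta> \<longleftrightarrow>
     mono_on {1..} \<beta> \<and> mono_on {1..} \<gamma> \<and> antimono_on {1..} \<delta> \<and>
     (\<forall>N\<ge>1. \<beta> N > 0 \<and> \<gamma> N > 0 \<and> \<delta> N > 0) \<and>
     filterlim \<beta> at_top sequentially \<and>
     filterlim \<gamma> at_top sequentially \<and>
     filterlim (\<lambda>N. inverse (\<delta> N)) at_top sequentially"

text \<open>\<open>P N\<close> stands for the polynomial \<open>P\<^sub>2\<^sub>N\<^sub>+\<^sub>d\<close> of degree \<open>2N + d\<close>. By parity and simplicity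
  of the zeros, exactly \<open>N\<close> of them are positive, and \<open>0\<close> is a zero iff \<open>d = 1\<close>.\<close>

definition simple_real_zeros :: "real poly \<Rightarrow> bool" where
  "simple_real_zeros p \<longleftrightarrow>
     (\<forall>z::complex. poly (map_poly complex_of_real p) z = 0 \<longrightarrow>
        z \<in> \<real> \<and> order z (map_poly complex_of_real p) = 1)"

definition class_P ::
    "nat \<Rightarrow> (nat \<Rightarrow> real) \<Rightarrow> (nat \<Rightarrow> real) \<Rightarrow> (nat \<Rightarrow> real) \<Rightarrow> (nat \<Rightarrow> real poly) set" where
  "class_P d \<beta> \<gamma> \<delta> = {P.
     admissible_scales \<beta> \<gamma> \<delta> \<and>
     (\<forall>N\<ge>1. degree (P N) = 2 * N + d \<and> lead_coeff (P N) = 1 \<and>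
             (\<forall>x. poly (P N) (- x) = (-1) ^ d * poly (P N) x) \<and>
             simple_real_zeros (P N)) \<and>
     (\<exists>C::real. \<forall>N\<ge>1. \<forall>z::complex. cmod z \<le> \<gamma> N \<longrightarrow>
        cmod (complex_of_real (\<beta> N) ^ d
                * poly (map_poly complex_of_real (P N)) (z / complex_of_real (\<beta> N))
                / complex_of_real (poly ((pderiv ^^ d) (P N)) 0)
              - cos (z - complex_of_real (real d * pi / 2)))
        \<le> C * \<delta> N * min ((cmod z)\<^sup>2) 1 * h d (cmod z))}"

text \<open>The \<open>B\<close>-spline of degree \<open>N \<ge> 1\<close>; \<open>\<Omega>\<close> is meant to have exactly \<open>N + 2\<close> elements.\<close>

definition bspline :: "nat \<Rightarrow> real \<Rightarrow> real set \<Rightarrow> real" where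
  "bspline N t \<Omega> =
     (real N + 1) * (\<Sum>v\<in>\<Omega>. (max (v - t) 0) ^ N / deriv (\<lambda>u. \<Prod>w\<in>\<Omega>. u - w) v)"

definition assoc_bspline :: "nat \<Rightarrow> real \<Rightarrow> real set \<Rightarrow> real" where
  "assoc_bspline N t \<Omega> =
     (if t = 0 then Lim (at_right 0) (\<lambda>\<tau>. bspline N \<tau> \<Omega> / \<tau> ^ N)
      else bspline N t \<Omega> / t ^ N)"

text \<open>In the case \<open>d = 1\<close> the summation index is shifted: the sum runs over \<open>Suc k \<ge> 1\<close>.\<close>

definition Theta :: "nat \<Rightarrow> real \<Rightarrow> real" where
  "Theta d t =
     (if d = 0
      then 1 - 4 / pi * (\<Sum>k. (-1) ^ k * exp (- (pi\<^sup>2 / 4) * (2 * real k + 1)\<^sup>2 / t) / (2 * real k + 1))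
      else 1 + 2 * (\<Sum>k. (-1) ^ Suc k * exp (- (pi * real (Suc k))\<^sup>2 / t)))"

definition knots :: "(nat \<Rightarrow> real) \<Rightarrow> (nat \<Rightarrow> nat \<Rightarrow> real) \<Rightarrow> nat \<Rightarrow> real set" where
  "knots u x N = {0, (u N)\<^sup>2} \<union> (\<lambda>k. (x N k)\<^sup>2) ` {1..N}"

end

theory Submission
  imports Defs
begin

text \<open>Scale the knots by \<open>\<beta>\<^sub>N\<^sup>2\<close> and let \<open>\<Phi>\<^sub>N(y)\<close> be the normalized associated B-spline at \<open>t = 1/y\<close>.
  The derivative of an associated B-spline is a negative multiple of the B-spline of one degree less
  on the nonzero knots, so \<open>\<Phi>\<^sub>N\<close> is nondecreasing, with values in \<open>[0, 2]\<close>. Lagrange interpolation gives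
  \<open>\<integral> \<Phi>\<^sub>N(y) (1 + p y / N)\<^bsup>-N-2\<^esup> dy = 1 / (p f\<^sub>N(p))\<close>, where \<open>f\<^sub>N(p) = \<Prod>\<^sub>a (1 + p/a)\<close> runs over the
  nonzero scaled knots. By the defining estimate of the class at \<open>z = i \<surd>p\<close>, \<open>f\<^sub>N(p)\<close> converges
  to \<open>cosh \<surd>p\<close> or \<open>sinh \<surd>p / \<surd>p\<close>, and by the partial fractions of these functions' reciprocals the
  Laplace transform of \<open>\<Phi>\<^sub>N\<close> converges to that of \<open>y \<mapsto> \<Theta>\<^sub>d(1/y)\<close>. For monotone functions this
  implies pointwise convergence. The same integral identity yields \<open>\<Phi>\<^sub>N(1/t) \<le> 12 / f\<^sub>N(t)\<close>, which decays
  faster than any power of \<open>t\<close> uniformly in large \<open>N\<close>, so the convergence also holds in every weighted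
  \<open>L\<^sup>1\<close> norm with weight \<open>t\<^bsup>\<sigma>-1\<^esup>\<close>, \<open>\<sigma> > 0\<close>. This norm depends on \<open>s\<close> only through \<open>Re s\<close>, whence the
  uniformity.\<close>

subsection \<open>Divided differences\<close>

text \<open>Against \<open>exp (- p * y)\<close> a truncated power has no simple integral. The
  rational kernel is the finite-N counterpart of the exponential: with it every truncated power
  integrates exactly to a multiple of \<open>1 / (p + a)\<close>, a Cauchy kernel in the knot a, and
  divided differences of Cauchy kernels are products. In this way the products over the knots, and
  with them the polynomials of the class, enter the argument. The knot 0 supplies the factor
  \<open>1 / p\<close>. The variable y = 1/t is the right one for the limit too: in it the
  theta-like functions are series of exponentials with constant term 1, whose Laplace transforms are
  partial fraction expansions. Convergence of transforms by itself controls only averages, so some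
  regularity in y has to be brought in from the spline side. The derivative argument behind that
  regularity needs degree N - 1 at least 1. Hence the quantitative estimates start at N = 2, and N =
  1 enters only through the claim of integrability.\<close>

definition divdiff :: "'a::field set \<Rightarrow> ('a \<Rightarrow> 'a) \<Rightarrow> 'a" where
  "divdiff S g = (\<Sum>v\<in>S. g v / (\<Prod>w\<in>S - {v}. v - w))"

lemma divdiff_cong: "(\<And>x. x \<in> S \<Longrightarrow> g x = g' x) \<Longrightarrow> divdiff S g = divdiff S g'"
  unfolding divdiff_def by (intro sum.cong) auto

lemma divdiff_cmult: "divdiff S (\<lambda>x. c * g x) = c * divdiff S g"
  unfolding divdiff_def by (simp add: sum_distrib_left)

lemma divdiff_diff: "divdiff S (\<lambda>x. g x - g' x) = divdiff S g - divdiff S g'"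
  unfolding divdiff_def by (simp add: diff_divide_distrib sum_subtractf)

lemma divdiff_zero [simp]: "divdiff S (\<lambda>x. 0) = 0"
  unfolding divdiff_def by simp

lemma divdiff_mult_node:
  assumes "finite S" "a \<in> S"
  shows "divdiff S (\<lambda>x. (x - a) * g x) = divdiff (S - {a}) g"
proof -
  have "divdiff S (\<lambda>x. (x - a) * g x)
      = (\<Sum>v\<in>S - {a}. (v - a) * g v / (\<Prod>w\<in>S - {v}. v - w))"
    unfolding divdiff_def using assms by (subst sum.remove[of _ a]) auto
  also have "\<dots> = divdiff (S - {a}) g"
    unfolding divdiff_def
  proof (intro sum.cong refl)
    fix v assume v: "v \<in> S - {a}"
    have "(\<Prod>w\<in>S - {v}. v - w) = (v - a) * (\<Prod>w\<in>S - {v} - {a}. v - w)"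
      using assms v by (subst prod.remove[of _ a]) auto
    moreover have "S - {v} - {a} = S - {a} - {v}" by auto
    ultimately show "(v - a) * g v / (\<Prod>w\<in>S - {v}. v - w) = g v / (\<Prod>w\<in>S - {a} - {v}. v - w)"
      using v by simp
  qed
  finally show ?thesis .
qed

text \<open>The affine factor is the combination of x - a and x - b that matches it at b and at a,
  and each of these two factors deletes its node. All later inductions on the number of nodes run on
  this recursion.\<close>

lemma divdiff_mult_affine:
  assumes "finite S" "a \<in> S" "b \<in> S" "a \<noteq> b"
  shows "divdiff S (\<lambda>x. (c + e * x) * g x)
       = ((c + e * b) * divdiff (S - {a}) g - (c + e * a) * divdiff (S - {b}) g) / (b - a)"
proof -
  have "divdiff S (\<lambda>x. (c + e * x) * g x)
      = divdiff S (\<lambda>x. (c + e * b) / (b - a) * ((x - a) * g x) - (c + e * a) / (b - a) * ((x - b) * g x))"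
  proof (intro divdiff_cong)
    fix x
    have "c + e * x = ((c + e * b) * (x - a) - (c + e * a) * (x - b)) / (b - a)"
      using assms by (simp add: field_simps)
    then show "(c + e * x) * g x
        = (c + e * b) / (b - a) * ((x - a) * g x) - (c + e * a) / (b - a) * ((x - b) * g x)"
      by (simp add: diff_divide_distrib left_diff_distrib mult.assoc)
  qed
  also have "\<dots> = (c + e * b) / (b - a) * divdiff (S - {a}) g - (c + e * a) / (b - a) * divdiff (S - {b}) g"
    using assms by (simp add: divdiff_diff divdiff_cmult divdiff_mult_node del: times_divide_eq_left)
  finally show ?thesis
    by (simp add: diff_divide_distrib)
qed

lemma two_elements_of_card:
  assumes "card S = Suc (Suc n)"
  obtains a b where "a \<in> S" "b \<in> S" "a \<noteq> b"
  using assms by (auto simp: card_Suc_eq)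

text \<open>A divided difference on n + 2 nodes kills polynomials of degree at most n. Only powers
  of affine functions occur below, and from these one factor can be split off and fed to the
  recursion.\<close>

lemma divdiff_affine_power:
  assumes "finite S" "card S = Suc (Suc n)"
  shows "divdiff S (\<lambda>x. (c + e * x) ^ n) = 0"
  using assms
proof (induction n arbitrary: S)
  case 0
  then obtain a b where ab: "S = {a, b}" "a \<noteq> b"
    by (auto simp: card_Suc_eq)
  then have "1 / (a - b) + 1 / (b - a) = 0"
    by (simp add: divide_simps)
  with ab show ?case unfolding divdiff_def
    by (simp add: insert_Diff_if)
next
  case (Suc n)
  from Suc.prems obtain a b where ab: "a \<in> S" "b \<in> S" "a \<noteq> b"
    by (elim two_elements_of_card)
  then have "divdiff (S - {a}) (\<lambda>x. (c + e * x) ^ n) = 0" "divdiff (S - {b}) (\<lambda>x. (c + e * x) ^ n) = 0"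
    using Suc.prems by (auto intro!: Suc.IH simp: card_Diff_singleton_if)
  then show ?case
    using Suc.prems ab divdiff_mult_affine[of S a b c e "\<lambda>x. (c + e * x) ^ n"] by simp
qed

text \<open>This is the partial fraction decomposition of the right-hand side. In the induction the
  affine factor of the recursion is taken to be the constant 1, which gives the classical two-term
  recursion for divided differences.\<close>

lemma divdiff_Cauchy_kernel:
  assumes "finite S" "S \<noteq> {}" "z \<notin> S"
  shows "divdiff S (\<lambda>x. 1 / (z - x)) = 1 / (\<Prod>w\<in>S. z - w)"
  using assms
proof (induction "card S" arbitrary: S rule: less_induct)
  case less
  show ?case
  proof (cases "card S = 1")
    case True
    then obtain a where "S = {a}" by (auto simp: card_Suc_eq)
    then show ?thesis by (simp add: divdiff_def)
  next
    case False
    with less.prems obtain n where n: "card S = Suc (Suc n)"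
      by (cases "card S"; cases "card S - 1") auto
    then obtain a b where ab: "a \<in> S" "b \<in> S" "a \<noteq> b" by (elim two_elements_of_card)
    have ne: "S - {a} \<noteq> {}" "S - {b} \<noteq> {}" using ab by auto
    have IH: "divdiff (S - {a}) (\<lambda>x. 1 / (z - x)) = 1 / (\<Prod>w\<in>S - {a}. z - w)"
         "divdiff (S - {b}) (\<lambda>x. 1 / (z - x)) = 1 / (\<Prod>w\<in>S - {b}. z - w)"
      using less.prems ab n ne by (auto intro!: less.hyps simp: card_Diff_singleton_if)
    have pr: "(\<Prod>w\<in>S. z - w) = (z - a) * (\<Prod>w\<in>S - {a}. z - w)"
         "(\<Prod>w\<in>S. z - w) = (z - b) * (\<Prod>w\<in>S - {b}. z - w)"
      using less.prems ab by (auto intro: prod.remove)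
    have nz: "(\<Prod>w\<in>S. z - w) \<noteq> 0" "z - a \<noteq> 0" "z - b \<noteq> 0" using less.prems ab by auto
    have i: "1 / (\<Prod>w\<in>S - {a}. z - w) = (z - a) / (\<Prod>w\<in>S. z - w)"
            "1 / (\<Prod>w\<in>S - {b}. z - w) = (z - b) / (\<Prod>w\<in>S. z - w)"
      using pr(1) nz(1,2) apply simp using pr(2) nz(1,3) by simp
    have "divdiff S (\<lambda>x. (1 + 0 * x) * (1 / (z - x)))
       = ((z - a) / (\<Prod>w\<in>S. z - w) - (z - b) / (\<Prod>w\<in>S. z - w)) / (b - a)"
      using divdiff_mult_affine[of S a b 1 0 "\<lambda>x. 1 / (z - x)"] ab less.prems
      by (simp add: IH i)
    also have "\<dots> = 1 / (\<Prod>w\<in>S. z - w)"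
      using ab nz(1) by (simp add: diff_divide_distrib[symmetric])
    finally show ?thesis by simp
  qed
qed

lemma divdiff_scale:
  assumes "c \<noteq> 0" "finite S" "card S = Suc n"
  shows "divdiff ((*) c ` S) g = divdiff S (\<lambda>x. g (c * x)) / c ^ n"
proof -
  have inj: "inj_on ((*) c) A" for A using assms by (auto simp: inj_on_def)
  have "divdiff ((*) c ` S) g = (\<Sum>v\<in>S. g (c * v) / (\<Prod>w\<in>(*) c ` S - {c * v}. c * v - w))"
    unfolding divdiff_def by (simp add: sum.reindex[OF inj])
  also have "\<dots> = (\<Sum>v\<in>S. g (c * v) / (\<Prod>w\<in>S - {v}. v - w) / c ^ n)"
  proof (intro sum.cong refl)
    fix v assume v: "v \<in> S"
    have "(*) c ` S - {c * v} = (*) c ` (S - {v})" using assms by auto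
    then have "(\<Prod>w\<in>(*) c ` S - {c * v}. c * v - w) = (\<Prod>w\<in>S - {v}. c * (v - w))"
      by (simp add: prod.reindex[OF inj] right_diff_distrib)
    also have "\<dots> = c ^ n * (\<Prod>w\<in>S - {v}. v - w)"
      using v assms by (simp add: prod.distrib card_Diff_singleton)
    finally show "g (c * v) / (\<Prod>w\<in>(*) c ` S - {c * v}. c * v - w) = g (c * v) / (\<Prod>w\<in>S - {v}. v - w) / c ^ n"
      by (simp add: field_simps)
  qed
  also have "\<dots> = divdiff S (\<lambda>x. g (c * x)) / c ^ n"
    unfolding divdiff_def by (simp add: sum_divide_distrib)
  finally show ?thesis .
qed

text \<open>Unlike \<open>max x 0 ^ n\<close>, this vanishes at \<open>x \<le> 0\<close> also for \<open>n = 0\<close>, the base of the recursion below.\<close>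

definition trunc_power :: "nat \<Rightarrow> real \<Rightarrow> real" where
  "trunc_power n x = (if x > 0 then x ^ n else 0)"

lemma trunc_power_eq: "n \<ge> 1 \<Longrightarrow> max x 0 ^ n = trunc_power n x"
  by (auto simp: trunc_power_def max_def)

text \<open>For z > 0 the expression is a positive multiple of the B-spline of degree m with knots S
  at 1/z, so this is the nonnegativity of B-splines. The induction is the Cox-de Boor recursion,
  whose weights are nonnegative when 1/z lies between the extreme knots.\<close>

lemma divdiff_trunc_power_sign:
  fixes S :: "real set"
  assumes "finite S" "card S = Suc (Suc m)" "z \<ge> 0"
  shows "(-1) ^ Suc m * divdiff S (\<lambda>x. trunc_power m (1 - x * z)) \<ge> 0"
  using assms(1,2)
proof (induction m arbitrary: S)
  case 0
  then obtain a b where "S = {a, b}" "a \<noteq> b"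
    by (auto simp: card_Suc_eq)
  then obtain a b where ab: "S = {a, b}" "a < b"
    using insert_commute[of a b] by (cases a b rule: linorder_cases) auto
  \<comment> \<open>As a function of the node, \<open>trunc_power 0 (1 - x * z)\<close> is a falling
    step, so its difference quotient is nonpositive.\<close>
  have "a * z \<le> b * z" using ab assms by (intro mult_right_mono) auto
  moreover have "1 / (a - b) \<le> 0" "1 / (b - a) \<ge> 0" "1 / (a - b) + 1 / (b - a) = 0"
    using ab by (auto simp: divide_simps)
  ultimately show ?case using ab unfolding divdiff_def
    by (auto simp: insert_Diff_if trunc_power_def)
next
  case (Suc m)
  define a b where "a = Min S" and "b = Max S"
  have S: "S \<noteq> {}" "finite S" using Suc.prems by auto
  have ab: "a \<in> S" "b \<in> S" using S by (auto simp: a_def b_def)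
  have le: "a \<le> x" "x \<le> b" if "x \<in> S" for x using S that by (auto simp: a_def b_def)
  have "a \<noteq> b"
  proof
    assume "a = b"
    then have "S \<subseteq> {a}" using le by force
    then have "card S \<le> card {a}" by (intro card_mono) auto
    then show False using Suc.prems by simp
  qed
  then have "a < b" using le ab by force
  have lz: "a * z \<le> x * z" "x * z \<le> b * z" if "x \<in> S" for x
    using le[OF that] assms by (auto intro: mult_right_mono)
  \<comment> \<open>If all nodes lie on one side of the truncation point, the function is either
    zero or a single polynomial of degree m + 1 on m + 3 nodes. Only the remaining case needs the
    recursion, and there 1 - a z and b z - 1 are both nonnegative.\<close>
  consider "1 - a * z < 0" | "1 - b * z > 0" | "1 - a * z \<ge> 0" "1 - b * z \<le> 0" by linarith
  then show ?case
  proof cases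
    case 1
    then have "divdiff S (\<lambda>x. trunc_power (Suc m) (1 - x * z)) = divdiff S (\<lambda>x. 0)"
      using lz(1) by (intro divdiff_cong) (force simp: trunc_power_def)
    then show ?thesis by simp
  next
    case 2
    have "divdiff S (\<lambda>x. trunc_power (Suc m) (1 - x * z)) = divdiff S (\<lambda>x. (1 + (- z) * x) ^ Suc m)"
    proof (intro divdiff_cong)
      fix x assume "x \<in> S"
      with 2 lz(2) have "1 - x * z > 0" by force
      then show "trunc_power (Suc m) (1 - x * z) = (1 + (- z) * x) ^ Suc m"
        by (simp add: trunc_power_def mult.commute)
    qed
    also have "\<dots> = 0" using Suc.prems by (intro divdiff_affine_power) auto
    finally show ?thesis by simp
  next
    case 3
    let ?g = "\<lambda>x. trunc_power m (1 - x * z)"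
    have "divdiff S (\<lambda>x. trunc_power (Suc m) (1 - x * z)) = divdiff S (\<lambda>x. (1 + (- z) * x) * ?g x)"
      by (intro divdiff_cong) (auto simp: trunc_power_def mult.commute)
    also have "\<dots> = ((1 + (- z) * b) * divdiff (S - {a}) ?g - (1 + (- z) * a) * divdiff (S - {b}) ?g) / (b - a)"
      using ab \<open>a \<noteq> b\<close> S by (intro divdiff_mult_affine) auto
    finally have eq: "(-1) ^ Suc (Suc m) * divdiff S (\<lambda>x. trunc_power (Suc m) (1 - x * z)) =
       ((b * z - 1) * ((-1) ^ Suc m * divdiff (S - {a}) ?g)
         + (1 - a * z) * ((-1) ^ Suc m * divdiff (S - {b}) ?g)) / (b - a)"
      by (simp add: algebra_simps)
    have "(-1) ^ Suc m * divdiff (S - {a}) ?g \<ge> 0" "(-1) ^ Suc m * divdiff (S - {b}) ?g \<ge> 0"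
      using Suc.prems ab by (intro Suc.IH; simp add: card_Diff_singleton_if)+
    then have "(b * z - 1) * ((-1) ^ Suc m * divdiff (S - {a}) ?g) \<ge> 0"
        "(1 - a * z) * ((-1) ^ Suc m * divdiff (S - {b}) ?g) \<ge> 0"
      using 3 by (auto intro!: mult_nonneg_nonneg[of "b * z - 1"] mult_nonneg_nonneg[of "1 - a * z"] simp del: power_Suc)
    then show ?thesis
      unfolding eq using \<open>a < b\<close> by (intro divide_nonneg_pos add_nonneg_nonneg) simp_all
  qed
qed

subsection \<open>The normalized associated B-spline\<close>

lemma has_real_derivative_max_power:
  assumes "n \<ge> 1"
  shows "((\<lambda>x::real. max x 0 ^ Suc n) has_real_derivative real (Suc n) * max x 0 ^ n) (at x)"
proof -
  consider "x > 0" | "x < 0" | "x = 0" by linarith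
  then show ?thesis
  proof cases
    case 1
    have "((\<lambda>x. x ^ Suc n) has_real_derivative real (Suc n) * max x 0 ^ n) (at x)"
      using DERIV_pow[of "Suc n" x] 1 by simp
    then show ?thesis
      by (rule has_field_derivative_transform_within_open[of _ _ _ "{0<..}"]) (use 1 in auto)
  next
    case 2
    have "((\<lambda>x::real. 0) has_real_derivative real (Suc n) * max x 0 ^ n) (at x)"
      using 2 assms by (auto intro!: derivative_eq_intros simp: max_def)
    then show ?thesis
      by (rule has_field_derivative_transform_within_open[of _ _ _ "{..<0}"]) (use 2 in auto)
  next
    case 3
    have "(\<lambda>h. (max h 0 ^ Suc n) / h) \<midarrow>0\<rightarrow> (0::real)"
    proof (rule Lim_null_comparison)
      show "\<forall>\<^sub>F h in at 0. norm (max h 0 ^ Suc n / h) \<le> \<bar>h\<bar> ^ n"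
        by (intro always_eventually) (auto simp: max_def)
      show "(\<lambda>h. \<bar>h\<bar> ^ n) \<midarrow>0\<rightarrow> (0::real)"
        using assms by (auto intro!: tendsto_eq_intros)
    qed
    then show ?thesis using 3 assms by (simp add: DERIV_def zero_power)
  qed
qed

lemma deriv_prod_linear:
  fixes S :: "real set"
  assumes "finite S" "v \<in> S"
  shows "deriv (\<lambda>u. \<Prod>w\<in>S. u - w) v = (\<Prod>w\<in>S - {v}. v - w)"
proof (rule DERIV_imp_deriv)
  have "((\<lambda>u. \<Prod>w\<in>S. u - w) has_real_derivative (\<Sum>x\<in>S. 1 * (\<Prod>y\<in>S - {x}. v - y))) (at v)"
    by (intro has_field_derivative_prod) (auto intro!: derivative_eq_intros)
  also have "(\<Sum>x\<in>S. 1 * (\<Prod>y\<in>S - {x}. v - y)) = (\<Sum>x\<in>{v}. \<Prod>y\<in>S - {x}. v - y)"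
    using assms by (intro sum.mono_neutral_cong_right) auto
  finally show "((\<lambda>u. \<Prod>w\<in>S. u - w) has_real_derivative (\<Prod>w\<in>S - {v}. v - w)) (at v)" by simp
qed

text \<open>Up to normalization this is \<open>y \<mapsto> B\<^sub>N\<^sup>*(N/y, S \<union> {0})\<close>; see \<open>assoc_bspline_eq\<close>.\<close>

definition nspline :: "nat \<Rightarrow> real set \<Rightarrow> real \<Rightarrow> real" where
  "nspline N S y = (real N + 1) / real N * (-1) ^ Suc N * (\<Prod>b\<in>S. b)
      * divdiff (insert 0 S) (\<lambda>x. max (1 - x * y / real N) 0 ^ N)"

text \<open>The N-th power of the positive part of w is w^N minus (-1)^N times the N-th power of the
  positive part of - w, and the divided difference on N + 2 nodes does not see w^N. Turning the
  truncation around makes the function equal to 1 at the knot 0 and, after the substitution t = N/y,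
  an approximation of \<open>exp (- v * y)\<close>.\<close>

lemma bspline_eq_divdiff:
  assumes "finite \<Omega>" "card \<Omega> = N + 2" "N \<ge> 1" "t > 0"
  shows "bspline N t \<Omega> / t ^ N
       = (real N + 1) * (-1) ^ Suc N * divdiff \<Omega> (\<lambda>v. max (1 - v / t) 0 ^ N)"
proof -
  have "bspline N t \<Omega> = (real N + 1) * divdiff \<Omega> (\<lambda>v. max (v - t) 0 ^ N)"
    unfolding bspline_def divdiff_def using assms by (simp add: deriv_prod_linear)
  also have "divdiff \<Omega> (\<lambda>v. max (v - t) 0 ^ N)
      = divdiff \<Omega> (\<lambda>v. t ^ N * ((- 1 + (1 / t) * v) ^ N - (-1) ^ N * max (1 - v / t) 0 ^ N))"
  proof (intro divdiff_cong)
    fix v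
    have "max (v - t) 0 = t * max (v / t - 1) 0"
      using assms by (simp add: max_def field_simps)
    moreover have "max (v / t - 1) 0 ^ N = (- 1 + (1 / t) * v) ^ N - (-1) ^ N * max (1 - v / t) 0 ^ N"
    proof (cases "v / t - 1 \<ge> 0")
      case True
      then show ?thesis using assms by (simp add: max_def)
    next
      case False
      have "(- 1 + (1 / t) * v) ^ N = (-1) ^ N * (1 - v / t) ^ N"
        by (subst power_mult_distrib[symmetric]) simp
      with False show ?thesis using assms by (simp add: max_def)
    qed
    ultimately show "max (v - t) 0 ^ N = t ^ N * ((- 1 + (1 / t) * v) ^ N - (-1) ^ N * max (1 - v / t) 0 ^ N)"
      by (simp add: power_mult_distrib)
  qed
  also have "\<dots> = t ^ N * (0 - (-1) ^ N * divdiff \<Omega> (\<lambda>v. max (1 - v / t) 0 ^ N))"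
    using assms by (subst divdiff_cmult, subst divdiff_diff, subst divdiff_cmult, subst divdiff_affine_power) auto
  finally show ?thesis using assms by simp
qed

text \<open>Scaling the N + 2 knots by b divides the divided difference by b^(N+1), and the product
  of the N + 1 nonzero knots gains the same power. The normalizing product is therefore exactly what
  makes the expression scale invariant.\<close>

lemma assoc_bspline_eq:
  assumes "finite S" "card S = N + 1" "0 \<notin> S" "N \<ge> 1" "b > 0" "t > 0"
  shows "(\<Prod>x\<in>S. x) / real N * assoc_bspline N (real N / b * t) (insert 0 S)
       = nspline N ((*) b ` S) (1 / t)"
proof -
  have inj: "inj_on ((*) b) S" using assms by (auto simp: inj_on_def)
  have "assoc_bspline N (real N / b * t) (insert 0 S)
     = (real N + 1) * (-1) ^ Suc N * divdiff (insert 0 S) (\<lambda>v. max (1 - v / (real N / b * t)) 0 ^ N)"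
    unfolding assoc_bspline_def using assms
    by (subst bspline_eq_divdiff[symmetric]) (auto simp: card_insert_if)
  also have "(\<lambda>v. max (1 - v / (real N / b * t)) 0 ^ N) = (\<lambda>v. max (1 - (b * v) * (1 / t) / real N) 0 ^ N)"
    using assms by (simp add: field_simps)
  also have "divdiff (insert 0 S) \<dots> = b ^ Suc N * divdiff ((*) b ` insert 0 S) (\<lambda>v. max (1 - v * (1 / t) / real N) 0 ^ N)"
    using assms by (subst divdiff_scale[of b "insert 0 S" "Suc N"]) (auto simp: card_insert_if)
  moreover have "(\<Prod>x\<in>(*) b ` S. x) = b ^ Suc N * (\<Prod>x\<in>S. x)"
    using assms by (simp add: prod.reindex[OF inj] prod.distrib)
  ultimately show ?thesis by (simp add: nspline_def)
qed

lemma continuous_on_divdiff [continuous_intros]: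
  fixes S :: "real set"
  assumes "\<And>x. continuous_on A (\<lambda>y. f y x)"
  shows "continuous_on A (\<lambda>y. divdiff S (f y))"
  unfolding divdiff_def divide_inverse
  by (intro continuous_intros assms)

lemma continuous_on_nspline: "continuous_on A (nspline N S)"
  unfolding nspline_def[abs_def] by (cases "N = 0") (auto intro!: continuous_intros)

text \<open>Once every nonzero knot is truncated away, only the knot 0 contributes. Its denominator
  is the product of the nonzero knots up to sign, which the normalization cancels.\<close>

lemma nspline_large:
  assumes "finite S" "card S = N + 1" "\<And>a. a \<in> S \<Longrightarrow> a > 0" "N \<ge> 1"
    and "\<And>a. a \<in> S \<Longrightarrow> a * y \<ge> real N"
  shows "nspline N S y = (real N + 1) / real N"
proof -
  have 0: "0 \<notin> S" using assms(3) by force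
  have "divdiff (insert 0 S) (\<lambda>x. max (1 - x * y / real N) 0 ^ N)
      = (\<Sum>v\<in>{0}. 1 / (\<Prod>w\<in>insert 0 S - {v}. v - w))"
    unfolding divdiff_def
    using assms by (intro sum.mono_neutral_cong_right) (auto simp: max_def field_simps)
  also have "\<dots> = 1 / (\<Prod>w\<in>S. (-1) * w)"
    using 0 by simp
  also have "(\<Prod>w\<in>S. (-1) * w) = (-1) ^ Suc N * (\<Prod>w\<in>S. w)"
    using assms by (subst prod.distrib) simp
  finally have "divdiff (insert 0 S) (\<lambda>x. max (1 - x * y / real N) 0 ^ N) = 1 / ((-1) ^ Suc N * (\<Prod>w\<in>S. w))" .
  moreover have "(\<Prod>w\<in>S. w) \<noteq> 0" using assms(1) 0 by simp
  ultimately show ?thesis unfolding nspline_def by simp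
qed

text \<open>Before any truncation takes effect, a polynomial of degree N is evaluated on N + 2
  nodes. In the variable t = 1/y this says that the spline has bounded support.\<close>

lemma nspline_small:
  assumes "finite S" "card S = N + 1" "\<And>a. a \<in> S \<Longrightarrow> a > 0" "N \<ge> 1"
    and "\<And>a. a \<in> S \<Longrightarrow> a * y \<le> real N"
  shows "nspline N S y = 0"
proof -
  have 0: "0 \<notin> S" using assms(3) by force
  have "divdiff (insert 0 S) (\<lambda>x. max (1 - x * y / real N) 0 ^ N)
      = divdiff (insert 0 S) (\<lambda>x. (1 + (- y / real N) * x) ^ N)"
  proof (intro divdiff_cong)
    fix x assume "x \<in> insert 0 S"
    then have "1 - x * y / real N \<ge> 0" using assms by auto
    then show "max (1 - x * y / real N) 0 ^ N = (1 + (- y / real N) * x) ^ N"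
      by (simp add: max_def mult.commute)
  qed
  also have "\<dots> = 0"
    using assms 0 by (intro divdiff_affine_power) auto
  finally show ?thesis by (simp add: nspline_def)
qed

lemma nspline_mono:
  assumes "finite S" "card S = N + 1" "\<And>a. a \<in> S \<Longrightarrow> a > 0" "N \<ge> 2"
    and "0 \<le> y" "y \<le> z"
  shows "nspline N S y \<le> nspline N S z"
proof (rule DERIV_nonneg_imp_nondecreasing[OF \<open>y \<le> z\<close>])
  fix r assume "y \<le> r" "r \<le> z"
  then have r: "r \<ge> 0" using assms by simp
  have 0: "0 \<notin> S" using assms(3) by force
  \<comment> \<open>Here \<open>N \<ge> 2\<close> matters: the truncated power is differentiable
    everywhere only because its derivative has degree n \<ge> 1.\<close>
  from assms obtain n where n: "N = Suc n" "n \<ge> 1" using that[of "N - 1"] by auto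
  define W where "W = (\<lambda>v. \<Prod>w\<in>insert 0 S - {v}. v - w)"
  define C where "C = (real N + 1) / real N * (-1) ^ Suc N * (\<Prod>b\<in>S. b)"
  have d: "((\<lambda>y. max (1 - v * y / real N) 0 ^ N) has_real_derivative
          - v * max (1 - v * r / real N) 0 ^ n) (at r)" for v
  proof -
    have "((\<lambda>y. max (1 - v * y / real N) 0 ^ Suc n) has_real_derivative
          real (Suc n) * max (1 - v * r / real N) 0 ^ n * (0 - v * 1 / real N)) (at r)"
      by (rule DERIV_chain2[OF has_real_derivative_max_power[OF n(2)]])
         (use n in \<open>auto intro!: derivative_eq_intros\<close>)
    then show ?thesis using n by (simp add: mult_ac)
  qed
  have "((\<lambda>y. C * (\<Sum>v\<in>insert 0 S. max (1 - v * y / real N) 0 ^ N / W v)) has_real_derivative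
        C * (\<Sum>v\<in>insert 0 S. - v * max (1 - v * r / real N) 0 ^ n / W v)) (at r)"
    by (intro DERIV_cmult DERIV_sum DERIV_cdivide d)
  moreover have "(\<lambda>y. C * (\<Sum>v\<in>insert 0 S. max (1 - v * y / real N) 0 ^ N / W v)) = nspline N S"
    by (simp add: fun_eq_iff nspline_def divdiff_def C_def W_def)
  \<comment> \<open>The chain rule produces the factor v, which vanishes at the knot 0 and so
    deletes this knot. What remains is a divided difference of degree n on the n + 2 elements of S,
    where the sign lemma applies.\<close>
  moreover have "(\<Sum>v\<in>insert 0 S. - v * max (1 - v * r / real N) 0 ^ n / W v)
     = - divdiff S (\<lambda>x. trunc_power n (1 - x * (r / real N)))"
  proof -
    have "divdiff (insert 0 S) (\<lambda>x. (x - 0) * max (1 - x * r / real N) 0 ^ n)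
        = divdiff (insert 0 S - {0}) (\<lambda>x. max (1 - x * r / real N) 0 ^ n)"
      using assms by (intro divdiff_mult_node) auto
    also have "\<dots> = divdiff S (\<lambda>x. trunc_power n (1 - x * (r / real N)))"
      using 0 n by (simp add: trunc_power_eq)
    finally show ?thesis
      unfolding divdiff_def[of "insert 0 S"] W_def by (simp add: sum_negf)
  qed
  ultimately have "(nspline N S has_real_derivative
        C * (- divdiff S (\<lambda>x. trunc_power n (1 - x * (r / real N))))) (at r)"
    by simp
  moreover have "C * (- divdiff S (\<lambda>x. trunc_power n (1 - x * (r / real N)))) \<ge> 0"
  proof -
    have "(-1) ^ Suc n * divdiff S (\<lambda>x. trunc_power n (1 - x * (r / real N))) \<ge> 0"
      using assms n r by (intro divdiff_trunc_power_sign) auto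
    moreover have "(real N + 1) / real N * (\<Prod>b\<in>S. b) \<ge> 0"
      using assms(3) by (intro mult_nonneg_nonneg prod_nonneg) (auto intro: less_imp_le)
    ultimately have "((real N + 1) / real N * (\<Prod>b\<in>S. b)) *
        ((-1) ^ Suc n * divdiff S (\<lambda>x. trunc_power n (1 - x * (r / real N)))) \<ge> 0"
      by (rule mult_nonneg_nonneg[rotated])
    then show ?thesis by (simp add: C_def n mult_ac)
  qed
  ultimately show "\<exists>d. (nspline N S has_real_derivative d) (at r) \<and> 0 \<le> d" by blast
qed

lemma nspline_bounds:
  assumes "finite S" "card S = N + 1" "\<And>a. a \<in> S \<Longrightarrow> a > 0" "N \<ge> 2" "0 \<le> y"
  shows "0 \<le> nspline N S y" "nspline N S y \<le> 2"
proof -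
  have "nspline N S 0 = 0" using assms by (intro nspline_small) auto
  with nspline_mono[of S N 0 y] assms show "0 \<le> nspline N S y" by simp
  have ne: "S \<noteq> {}" using assms by auto
  \<comment> \<open>A point at or beyond y where the spline has already reached its final value (N +
    1)/N.\<close>
  define m where "m = max y (real N / Min S)"
  have "a * m \<ge> real N" if "a \<in> S" for a
  proof -
    have "Min S > 0" "Min S \<le> a" using that assms ne by auto
    then have "real N \<le> a * (real N / Min S)" using assms by (simp add: field_simps mult_mono)
    also have "\<dots> \<le> a * m" using assms(3)[OF that] by (intro mult_left_mono) (auto simp: m_def)
    finally show ?thesis .
  qed
  then have "nspline N S m = (real N + 1) / real N" using assms by (intro nspline_large) auto
  also have "\<dots> \<le> 2" using assms by (simp add: field_simps)
  finally show "nspline N S y \<le> 2"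
    using nspline_mono[of S N y m] assms by (auto simp: m_def)
qed

text \<open>Monotonicity starts at N = 2, but integrability is claimed for every N \<ge> 1. For a
  fixed N, continuity together with the two constant tails is enough; the bounds depend on
  S.\<close>

lemma nspline_bounded:
  assumes "finite S" "card S = N + 1" "\<And>a. a \<in> S \<Longrightarrow> a > 0" "N \<ge> 1"
  shows "\<exists>C. \<exists>T>0. (\<forall>y\<ge>0. \<bar>nspline N S y\<bar> \<le> C) \<and> (\<forall>y. 0 \<le> y \<and> y \<le> T \<longrightarrow> nspline N S y = 0)"
proof -
  have ne: "S \<noteq> {}" using assms by auto
  define T where "T = real N / Max S"
  have Mx: "a \<le> Max S" "Max S > 0" if "a \<in> S" for a
    using assms ne that by (auto intro: Max_ge order_less_le_trans)
  then have Mx0: "Max S > 0" using ne by auto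
  have Mn: "Min S > 0" using assms ne by auto
  have 1: "T > 0" using Mx0 assms by (simp add: T_def)
  have 2: "nspline N S y = 0" if "0 \<le> y" "y \<le> T" for y
  proof (rule nspline_small[OF assms])
    fix a assume "a \<in> S"
    then have "a * y \<le> Max S * T" using Mx that assms(3) by (intro mult_mono) (auto intro: less_imp_le)
    also have "\<dots> = real N" using Mx0 by (simp add: T_def)
    finally show "a * y \<le> real N" .
  qed
  define R where "R = real N / Min S"
  have 3: "nspline N S y = (real N + 1) / real N" if "y \<ge> R" for y
  proof (rule nspline_large[OF assms])
    fix a assume a: "a \<in> S"
    have "real N = Min S * R" using Mn by (simp add: R_def)
    also have "\<dots> \<le> a * y" using a that assms Mn by (intro mult_mono) (auto simp: R_def intro: less_imp_le)
    finally show "real N \<le> a * y" .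
  qed
  have "compact (nspline N S ` {0..R})"
    by (intro compact_continuous_image continuous_on_nspline) auto
  then obtain B where B: "\<And>y. y \<in> {0..R} \<Longrightarrow> \<bar>nspline N S y\<bar> \<le> B"
    by (meson bounded_real compact_imp_bounded imageI)
  have "\<bar>nspline N S y\<bar> \<le> max B ((real N + 1) / real N)" if "y \<ge> 0" for y
    using 3[of y] B[of y] that by (cases "y \<ge> R") (auto simp: le_max_iff_disj)
  with 1 2 show ?thesis by blast
qed

section \<open>Integrals of the spline against rational kernels\<close>

lemma has_bochner_integral_FTC_greaterThan:
  fixes f :: "real \<Rightarrow> real"
  assumes [measurable]: "f \<in> borel_measurable borel"
  assumes "\<And>x. a \<le> x \<Longrightarrow> (F has_real_derivative f x) (at x)"
    and nonneg: "\<And>x. a \<le> x \<Longrightarrow> 0 \<le> f x"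
    and lim: "(F \<longlongrightarrow> T) at_top"
  shows "has_bochner_integral lborel (\<lambda>x. indicator {a<..} x * f x) (T - F a)"
proof -
  have "F a \<le> T"
  proof (rule tendsto_lowerbound[OF lim])
    have "F a \<le> F x" if "a \<le> x" for x
      using assms(2,3) that by (intro DERIV_nonneg_imp_nondecreasing[of a x F]) auto
    then show "\<forall>\<^sub>F x in at_top. F a \<le> F x"
      by (auto simp: eventually_at_top_linorder)
  qed simp
  moreover have "(\<integral>\<^sup>+x. ennreal (f x) * indicator {a ..} x \<partial>lborel) = T - F a"
    by (rule nn_integral_FTC_atLeast) (use assms in auto)
  moreover have "(\<lambda>x. ennreal (f x) * indicator {a ..} x) = (\<lambda>x. ennreal (indicator {a..} x * f x))"
    by (auto split: split_indicator)
  ultimately have "has_bochner_integral lborel (\<lambda>x. indicator {a..} x * f x) (T - F a)"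
    using nonneg
    by (intro has_bochner_integral_nn_integral) (auto intro!: AE_I2 split: split_indicator)
  then show ?thesis
    by (rule has_bochner_integral_cong_AE[THEN iffD1, rotated 3])
       (use AE_lborel_singleton[of a] in \<open>auto elim!: eventually_mono split: split_indicator\<close>)
qed

lemma has_bochner_integral_le:
  fixes f g :: "_ \<Rightarrow> real"
  assumes "has_bochner_integral M f a" "has_bochner_integral M g b" "\<And>x. f x \<le> g x"
  shows "a \<le> b"
  using assms integral_mono[of M f g] by (auto simp: has_bochner_integral_iff)

lemma tendsto_inverse_power_linear_at_top:
  assumes "p > (0::real)" "n \<ge> 1" "N \<ge> 1"
  shows "((\<lambda>y. 1 / (1 + y * p / real N) ^ n) \<longlongrightarrow> 0) at_top"
proof -
  have "filterlim (\<lambda>y. 1 + (p / real N) * y) at_top at_top"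
    using assms by (intro filterlim_tendsto_add_at_top[OF tendsto_const] filterlim_tendsto_pos_mult_at_top[OF tendsto_const])
       (auto intro: filterlim_ident)
  then have "filterlim (\<lambda>y. (1 + (p / real N) * y) ^ n) at_top at_top"
    using assms by (intro filterlim_pow_at_top) auto
  then have "((\<lambda>y. inverse ((1 + (p / real N) * y) ^ n)) \<longlongrightarrow> 0) at_top"
    by (rule tendsto_inverse_0_at_top)
  then show ?thesis by (simp add: field_simps inverse_eq_divide)
qed

text \<open>Put w = (1 - a y/N) / (1 + p y/N). Then dw/dy = - ((a + p)/N) (1 + p y/N)^(-2), so an
  exponent of exactly N + 2 in the kernel turns the integrand into - (N/(a + p)) w^N dw.\<close>

lemma DERIV_power_ratio:
  assumes "N \<ge> 1" "a \<ge> 0" "p > 0" "y \<ge> 0"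
  shows "((\<lambda>y. - (real N / ((real N + 1) * (a + p)))
             * (max (1 - a * y / real N) 0 ^ Suc N / (1 + y * p / real N) ^ Suc N))
      has_real_derivative max (1 - a * y / real N) 0 ^ N / (1 + y * p / real N) ^ (N + 2)) (at y)"
proof -
  define D where "D = 1 + y * p / real N"
  have D: "D > 0" using assms by (auto simp: D_def intro: add_pos_nonneg)
  define M where "M = max (1 - a * y / real N) 0"
  have 1: "((\<lambda>y. max (1 - a * y / real N) 0 ^ Suc N) has_real_derivative
          real (Suc N) * M ^ N * (- a / real N)) (at y)"
    unfolding M_def
    by (rule DERIV_chain2[OF has_real_derivative_max_power])
       (use assms in \<open>auto intro!: derivative_eq_intros\<close>)
  have 2: "((\<lambda>y. (1 + y * p / real N) ^ Suc N) has_real_derivative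
          real (Suc N) * D ^ N * (p / real N)) (at y)"
    unfolding D_def
    by (rule DERIV_chain2[OF DERIV_pow, THEN DERIV_cong]) (use assms in \<open>auto intro!: derivative_eq_intros\<close>)
  have 3: "((\<lambda>y. - (real N / ((real N + 1) * (a + p)))
             * (max (1 - a * y / real N) 0 ^ Suc N / (1 + y * p / real N) ^ Suc N)) has_real_derivative
      - (real N / ((real N + 1) * (a + p))) *
      ((real (Suc N) * M ^ N * (- a / real N) * D ^ Suc N
        - M ^ Suc N * (real (Suc N) * D ^ N * (p / real N))) / (D ^ Suc N * D ^ Suc N))) (at y)"
    using DERIV_cmult[OF DERIV_divide[OF 1 2], of "- (real N / ((real N + 1) * (a + p)))"] D
    unfolding D_def M_def by simp
  \<comment> \<open>Where the truncation acts both sides are 0, because N \<ge> 1. This lets the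
    remaining algebra treat the truncated factor as an affine one.\<close>
  have Meq: "M ^ N * M = M ^ N * (1 - a * y / real N)"
    using assms by (cases "1 - a * y / real N \<ge> 0") (auto simp: M_def max_def)
  have "real (Suc N) * M ^ N * (- a / real N) * D ^ Suc N
        - M ^ Suc N * (real (Suc N) * D ^ N * (p / real N))
      = - (real (Suc N) / real N * D ^ N) * (a * M ^ N * D + (M ^ N * M) * p)"
    using assms by (simp add: field_simps)
  also have "a * M ^ N * D + (M ^ N * M) * p = (a + p) * M ^ N"
    unfolding Meq D_def using assms by (simp add: field_simps)
  finally have "- (real N / ((real N + 1) * (a + p))) *
      ((real (Suc N) * M ^ N * (- a / real N) * D ^ Suc N
        - M ^ Suc N * (real (Suc N) * D ^ N * (p / real N))) / (D ^ Suc N * D ^ Suc N))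
      = M ^ N * (D ^ N / (D ^ Suc N * D ^ Suc N))"
    using assms D by (simp add: divide_simps)
  also have "D ^ N / (D ^ Suc N * D ^ Suc N) = 1 / D ^ (N + 2)"
    using D by (simp add: field_simps)
  finally show ?thesis using 3 by (simp add: D_def M_def)
qed

text \<open>Used in three ways: with c = 0 for the transform of the spline, with a = 0 and c = 1/t
  for the tail of the kernel in \<open>nspline_le\<close>, and with N = 1, a = 0 for an integrable
  majorant of all the kernels.\<close>

lemma has_bochner_integral_kernel:
  assumes "N \<ge> 1" "a \<ge> 0" "p > 0" "c \<ge> 0"
  shows "has_bochner_integral lborel
    (\<lambda>y. indicator {c<..} y * (max (1 - a * y / real N) 0 ^ N / (1 + y * p / real N) ^ (N + 2)))
    (real N / ((real N + 1) * (a + p)) * (max (1 - a * c / real N) 0 ^ Suc N / (1 + c * p / real N) ^ Suc N))"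
proof -
  let ?F = "\<lambda>y. - (real N / ((real N + 1) * (a + p)))
             * (max (1 - a * y / real N) 0 ^ Suc N / (1 + y * p / real N) ^ Suc N)"
  have "(?F \<longlongrightarrow> - (real N / ((real N + 1) * (a + p))) * 0) at_top"
  proof (rule tendsto_mult[OF tendsto_const Lim_null_comparison])
    show "((\<lambda>y. 1 / (1 + y * p / real N) ^ Suc N) \<longlongrightarrow> 0) at_top"
      using assms by (intro tendsto_inverse_power_linear_at_top) auto
    show "\<forall>\<^sub>F y in at_top. norm (max (1 - a * y / real N) 0 ^ Suc N / (1 + y * p / real N) ^ Suc N)
        \<le> 1 / (1 + y * p / real N) ^ Suc N"
    proof (rule eventually_at_top_linorderI[of 0])
      have *: "norm (u / v) \<le> 1 / v" if "0 \<le> u" "u \<le> 1" "v > 0" for u v :: real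
        using that by (simp add: divide_right_mono)
      fix y :: real assume "0 \<le> y"
      then have "max (1 - a * y / real N) 0 ^ Suc N \<le> 1" using assms by (intro power_le_one) auto
      moreover have "(1 + y * p / real N) ^ Suc N > 0"
        using assms \<open>0 \<le> y\<close> by (intro zero_less_power add_pos_nonneg) auto
      moreover have "max (1 - a * y / real N) 0 ^ Suc N \<ge> 0" by (intro zero_le_power) auto
      ultimately show "norm (max (1 - a * y / real N) 0 ^ Suc N / (1 + y * p / real N) ^ Suc N)
        \<le> 1 / (1 + y * p / real N) ^ Suc N"
        using * by blast
    qed
  qed
  then have "has_bochner_integral lborel
    (\<lambda>y. indicator {c<..} y * (max (1 - a * y / real N) 0 ^ N / (1 + y * p / real N) ^ (N + 2))) (- (real N / ((real N + 1) * (a + p))) * 0 - ?F c)"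
  proof (intro has_bochner_integral_FTC_greaterThan)
    fix y assume "c \<le> y"
    then have y: "y \<ge> 0" using assms by simp
    then show "(?F has_real_derivative max (1 - a * y / real N) 0 ^ N / (1 + y * p / real N) ^ (N + 2)) (at y)"
      using assms by (intro DERIV_power_ratio)
    show "0 \<le> max (1 - a * y / real N) 0 ^ N / (1 + y * p / real N) ^ (N + 2)"
      using assms y by (intro divide_nonneg_nonneg zero_le_power add_nonneg_nonneg) auto
  qed auto
  then show ?thesis by simp
qed

lemma has_bochner_integral_nspline:
  assumes "finite S" "card S = N + 1" "\<And>a. a \<in> S \<Longrightarrow> a > 0" "N \<ge> 1" "p > 0"
  shows "has_bochner_integral lborel
    (\<lambda>y. indicator {0<..} y * (nspline N S y / (1 + y * p / real N) ^ (N + 2)))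
    (1 / (p * (\<Prod>a\<in>S. 1 + p / a)))"
proof -
  have 0: "0 \<notin> S" using assms(3) by force
  define W where "W = (\<lambda>v. \<Prod>w\<in>insert 0 S - {v}. v - w)"
  define C where "C = (real N + 1) / real N * (-1) ^ Suc N * (\<Prod>b\<in>S. b)"
  let ?k = "\<lambda>v y. indicator {0<..} y * (max (1 - v * y / real N) 0 ^ N / (1 + y * p / real N) ^ (N + 2))"
  have "has_bochner_integral lborel (\<lambda>y. \<Sum>v\<in>insert 0 S. C / W v * ?k v y)
      (\<Sum>v\<in>insert 0 S. C / W v * (real N / ((real N + 1) * (v + p))))"
  proof (intro has_bochner_integral_sum has_bochner_integral_mult_right)
    fix v assume "v \<in> insert 0 S"
    then have "v \<ge> 0" using assms(3) by (auto intro: less_imp_le)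
    then show "has_bochner_integral lborel (?k v) (real N / ((real N + 1) * (v + p)))"
      using has_bochner_integral_kernel[of N v p 0] assms by simp
  qed
  also have "(\<lambda>y. \<Sum>v\<in>insert 0 S. C / W v * ?k v y)
     = (\<lambda>y. indicator {0<..} y * (nspline N S y / (1 + y * p / real N) ^ (N + 2)))"
    unfolding nspline_def divdiff_def W_def C_def
    by (simp only: sum_distrib_left sum_divide_distrib) (simp add: mult_ac)
  \<comment> \<open>After termwise integration the sum is a divided difference of the Cauchy kernel
    with pole - p. The pole is negative, so it avoids all knots.\<close>
  also have "(\<Sum>v\<in>insert 0 S. C / W v * (real N / ((real N + 1) * (v + p))))
     = - C * real N / (real N + 1) * divdiff (insert 0 S) (\<lambda>x. 1 / (- p - x))"
  proof -
    have "1 / (- p - x) = - (1 / (x + p))" for x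
    proof -
      have "- p - x = - (x + p)" by simp
      then show ?thesis by (simp only: divide_minus_right)
    qed
    then show ?thesis
      unfolding divdiff_def W_def
      by (simp only: sum_distrib_left) (simp add: sum_negf mult_ac)
  qed
  also have "divdiff (insert 0 S) (\<lambda>x. 1 / (- p - x)) = 1 / (\<Prod>w\<in>insert 0 S. - p - w)"
  proof (rule divdiff_Cauchy_kernel)
    show "- p \<notin> insert 0 S" using assms(3)[of "- p"] assms(5) by auto
  qed (use assms in auto)
  also have "(\<Prod>w\<in>insert 0 S. - p - w) = (\<Prod>w\<in>insert 0 S. (-1) * (p + w))"
    by (intro prod.cong) auto
  also have "\<dots> = (-1) ^ (N + 2) * (\<Prod>w\<in>insert 0 S. p + w)"
    using assms 0 by (subst prod.distrib) (simp add: card_insert_if)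
  also have "(\<Prod>w\<in>insert 0 S. p + w) = p * (\<Prod>w\<in>S. (1 + p / w) * w)"
    using assms 0 by (auto intro!: prod.cong simp: field_simps)
  also have "(\<Prod>w\<in>S. (1 + p / w) * w) = (\<Prod>w\<in>S. 1 + p / w) * (\<Prod>w\<in>S. w)"
    by (simp add: prod.distrib)
  also have "- C * real N / (real N + 1) * (1 / ((-1) ^ (N + 2) * (p * ((\<Prod>w\<in>S. 1 + p / w) * (\<Prod>w\<in>S. w)))))
     = 1 / (p * (\<Prod>a\<in>S. 1 + p / a))"
  proof -
    have Q: "(\<Prod>w\<in>S. w) \<noteq> 0" using 0 assms by simp
    have "real N + 1 \<noteq> 0" "real N \<noteq> 0" using assms by auto
    then have "- C * real N / (real N + 1) = (-1) ^ N * (\<Prod>w\<in>S. w)"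
      unfolding C_def by simp
    with Q show ?thesis by simp
  qed
  finally show ?thesis .
qed

text \<open>Beyond 1/t the spline is at least its value at 1/t, so this value times the tail
  integral of the kernel is at most the full integral. Choosing p = t turns the kernel at the
  endpoint y = 1/t into a power of 1 + 1/N, which is bounded uniformly in N.\<close>

lemma nspline_le:
  assumes "finite S" "card S = N + 1" "\<And>a. a \<in> S \<Longrightarrow> a > 0" "N \<ge> 2" "t > 0"
  shows "nspline N S (1 / t) \<le> 12 / (\<Prod>a\<in>S. 1 + t / a)"
proof -
  let ?f = "\<Prod>a\<in>S. 1 + t / a"
  have f: "?f > 0" using assms by (intro prod_pos) (auto intro!: add_pos_pos)
  have N: "real N > 0" using assms by simp
  have "has_bochner_integral lborel
     (\<lambda>y. nspline N S (1 / t) * (indicator {1/t<..} y * (max (1 - 0 * y / real N) 0 ^ N / (1 + y * t / real N) ^ (N + 2))))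
     (nspline N S (1 / t) * (real N / ((real N + 1) * (0 + t)) * (max (1 - 0 * (1/t) / real N) 0 ^ Suc N / (1 + (1/t) * t / real N) ^ Suc N)))"
    using assms by (intro has_bochner_integral_mult_right has_bochner_integral_kernel) auto
  then have *: "has_bochner_integral lborel
     (\<lambda>y. nspline N S (1 / t) * (indicator {1/t<..} y / (1 + y * t / real N) ^ (N + 2)))
     (nspline N S (1 / t) * (real N / ((real N + 1) * t * (1 + 1 / real N) ^ Suc N)))"
    using assms by (simp del: power_Suc)
  have le: "nspline N S (1 / t) * (real N / ((real N + 1) * t * (1 + 1 / real N) ^ Suc N)) \<le> 1 / (t * ?f)"
  proof (rule has_bochner_integral_le[OF *])
    show "has_bochner_integral lborel
      (\<lambda>y. indicator {0<..} y * (nspline N S y / (1 + y * t / real N) ^ (N + 2))) (1 / (t * ?f))"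
      using assms by (intro has_bochner_integral_nspline) auto
    fix y :: real
    have pos: "(1 + y * t / real N) ^ (N + 2) \<ge> 0" if "y > 0"
      using that assms by (intro zero_le_power add_nonneg_nonneg) auto
    have pt: "1 / t > 0" using assms by simp
    show "nspline N S (1 / t) * (indicator {1/t<..} y / (1 + y * t / real N) ^ (N + 2))
       \<le> indicator {0<..} y * (nspline N S y / (1 + y * t / real N) ^ (N + 2))"
    proof (cases "y > 1 / t")
      case True
      then have "nspline N S (1 / t) \<le> nspline N S y"
        using assms by (intro nspline_mono) auto
      moreover from True pt have "y > 0" by linarith
      ultimately show ?thesis using True pos by (simp add: divide_right_mono del: power_add power_Suc)
    next
      case False
      then show ?thesis using nspline_bounds(1)[of S N y] assms pos
        by (cases "y > 0") (auto simp del: power_add power_Suc)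
    qed
  qed
  have le12: "(1 + 1 / real N) ^ Suc N * ((real N + 1) / real N) \<le> 12"
  proof -
    have "(1 + 1 / real N) ^ Suc N * ((real N + 1) / real N) = (1 + 1 / real N) ^ N * ((1 + 1 / real N) * (1 + 1 / real N))"
      using N by (simp add: field_simps)
    \<comment> \<open>The origin of the 12: (1 + 1/N)^N is at most e < 3, and each of the two
      remaining factors 1 + 1/N is at most 2.\<close>
    also have "\<dots> \<le> 3 * (2 * 2)"
    proof (intro mult_mono)
      have "(1 + 1 / real N) ^ N \<le> exp 1"
        using exp_ge_one_plus_x_over_n_power_n[of N 1] assms by simp
      then show "(1 + 1 / real N) ^ N \<le> 3" using exp_le by linarith
    qed (use assms in \<open>auto simp: field_simps\<close>)
    finally show ?thesis by simp
  qed
  have "nspline N S (1 / t) \<le> ((1 + 1 / real N) ^ Suc N * ((real N + 1) / real N)) / ?f"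
  proof -
    define K where "K = (1 + 1 / real N) ^ Suc N"
    have K: "K > 0" unfolding K_def using N by (intro zero_less_power add_pos_pos) auto
    have "nspline N S (1 / t) * (real N / ((real N + 1) * t * K)) \<le> 1 / (t * ?f)"
      using le by (simp add: K_def)
    then have "nspline N S (1 / t) \<le> 1 / (t * ?f) / (real N / ((real N + 1) * t * K))"
      using N K assms by (subst pos_le_divide_eq) auto
    also have "\<dots> = (K * ((real N + 1) / real N)) / ?f"
      using N K assms f by (simp only: times_divide_eq_right divide_divide_eq_left divide_divide_eq_right) (simp add: mult_ac)
    finally show ?thesis by (simp add: K_def)
  qed
  moreover have "(1 + 1 / real N) ^ Suc N * ((real N + 1) / real N) / ?f \<le> 12 / ?f"
    using f le12 by (intro divide_right_mono) auto
  ultimately show ?thesis by linarith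
qed

subsection \<open>Convergence of monotone functions from their Laplace transforms\<close>

lemma has_bochner_integral_exp:
  assumes "p > (0::real)"
  shows "has_bochner_integral lborel (\<lambda>y. indicator {0<..} y * exp (- (p * y))) (1 / p)"
proof -
  have "filterlim (\<lambda>y. - (p * y)) at_bot at_top"
    using assms
    by (intro filterlim_compose[OF filterlim_uminus_at_bot_at_top]
          filterlim_tendsto_pos_mult_at_top[OF tendsto_const] filterlim_ident)
  then have "((\<lambda>y. - (exp (- (p * y)) / p)) \<longlongrightarrow> - (0 / p)) at_top"
    using assms by (intro tendsto_minus tendsto_divide tendsto_const filterlim_compose[OF exp_at_bot]) auto
  then have "has_bochner_integral lborel (\<lambda>y. indicator {0<..} y * exp (- (p * y))) (- (0 / p) - - (exp (- (p * 0)) / p))"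
    using assms
    by (intro has_bochner_integral_FTC_greaterThan) (auto intro!: derivative_eq_intros)
  then show ?thesis by simp
qed

lemma integrable_test_function:
  fixes E f :: "real \<Rightarrow> real"
  assumes int: "integrable lborel E" and supp: "\<And>y. y \<le> 0 \<Longrightarrow> E y = 0"
    and f: "continuous_on UNIV f"
  shows "integrable lborel (\<lambda>y. E y * f (exp (- y)))"
proof -
  have "compact (f ` {0..1})"
    by (intro compact_continuous_image continuous_on_subset[OF f]) auto
  then obtain B where B: "\<And>x. x \<in> {0..1} \<Longrightarrow> \<bar>f x\<bar> \<le> B"
    by (meson bounded_real compact_imp_bounded imageI)
  have fm: "(\<lambda>y. f (exp (- y))) \<in> borel_measurable borel"
    by (intro borel_measurable_continuous_onI continuous_on_compose2[OF f]) (auto intro!: continuous_intros)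
  show ?thesis
  proof (rule Bochner_Integration.integrable_bound)
    show "integrable lborel (\<lambda>y. B * E y)" using int by simp
    show "(\<lambda>y. E y * f (exp (- y))) \<in> borel_measurable lborel"
      using int fm by (intro borel_measurable_times) auto
    show "AE y in lborel. norm (E y * f (exp (- y))) \<le> norm (B * E y)"
    proof (intro AE_I2)
      fix y :: real
      show "norm (E y * f (exp (- y))) \<le> norm (B * E y)"
      proof (cases "y \<le> 0")
        case False
        then have "\<bar>f (exp (- y))\<bar> \<le> B" by (intro B) auto
        then have "\<bar>E y\<bar> * \<bar>f (exp (- y))\<bar> \<le> \<bar>E y\<bar> * \<bar>B\<bar>" by (intro mult_left_mono) auto
        then show ?thesis by (simp add: abs_mult mult.commute)
      qed (simp add: supp)
    qed
  qed
qed

text \<open>With x = \<open>exp (- y)\<close> the hypothesis concerns moments on [0, 1]. Weierstrass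
  approximation passes from polynomials in x to continuous functions of x, and the common bound M on
  the absolute integrals controls the error uniformly in n.\<close>

lemma integral_test_function_tendsto_0:
  fixes E :: "nat \<Rightarrow> real \<Rightarrow> real" and g :: "real \<Rightarrow> real"
  assumes int: "\<And>n. integrable lborel (E n)" and M: "\<And>n. (\<integral>y. \<bar>E n y\<bar> \<partial>lborel) \<le> M"
    and supp: "\<And>n y. y \<le> 0 \<Longrightarrow> E n y = 0"
    and conv: "\<And>k. (\<lambda>n. \<integral>y. E n y * exp (- y) ^ k \<partial>lborel) \<longlonglongrightarrow> 0"
    and g: "continuous_on UNIV g"
  shows "(\<lambda>n. \<integral>y. E n y * g (exp (- y)) \<partial>lborel) \<longlonglongrightarrow> 0"
proof -
  have intg: "integrable lborel (\<lambda>y. E n y * f (exp (- y)))"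
    if "continuous_on UNIV f" for f :: "real \<Rightarrow> real" and n
    by (intro integrable_test_function int supp that)
  have M0: "M \<ge> 0" using M[of 0] by (rule order_trans[rotated]) simp
  show "(\<lambda>n. \<integral>y. E n y * g (exp (- y)) \<partial>lborel) \<longlonglongrightarrow> 0"
  proof (rule LIMSEQ_I)
    fix e :: real assume e: "e > 0"
    \<comment> \<open>Half of e is spent on the approximation, as e' M < e/2. The 1 added to M
      covers M = 0.\<close>
    define e' where "e' = e / (2 * (M + 1))"
    have e': "e' > 0" using e M0 by (simp add: e'_def)
    obtain p where p: "real_polynomial_function p" "\<And>x. x \<in> {0..1} \<Longrightarrow> \<bar>g x - p x\<bar> < e'"
      using Stone_Weierstrass_real_polynomial_function[of "{0..1::real}" g e']
        continuous_on_subset[OF g subset_UNIV] e' by auto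
    then obtain a m where pe: "p = (\<lambda>x. \<Sum>i\<le>m. a i * x ^ i)"
      unfolding real_polynomial_function_iff_sum by blast
    have pc: "continuous_on UNIV p" unfolding pe by (intro continuous_intros)
    have "(\<lambda>n. \<Sum>i\<le>m. a i * (\<integral>y. E n y * exp (- y) ^ i \<partial>lborel)) \<longlonglongrightarrow> (\<Sum>i\<le>m. a i * 0)"
      by (intro tendsto_intros conv)
    also have "(\<lambda>n. \<Sum>i\<le>m. a i * (\<integral>y. E n y * exp (- y) ^ i \<partial>lborel)) = (\<lambda>n. \<integral>y. E n y * p (exp (- y)) \<partial>lborel)"
    proof
      fix n
      have pow_int: "integrable lborel (\<lambda>y. E n y * exp (- y) ^ i)" for i
        by (rule intg[of "\<lambda>x. x ^ i"]) (intro continuous_intros)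
      have "(\<integral>y. E n y * p (exp (- y)) \<partial>lborel) = (\<integral>y. (\<Sum>i\<le>m. a i * (E n y * exp (- y) ^ i)) \<partial>lborel)"
        by (simp add: pe sum_distrib_left mult_ac)
      also have "\<dots> = (\<Sum>i\<le>m. a i * (\<integral>y. E n y * exp (- y) ^ i \<partial>lborel))"
        using pow_int by (subst Bochner_Integration.integral_sum) auto
      finally show "(\<Sum>i\<le>m. a i * (\<integral>y. E n y * exp (- y) ^ i \<partial>lborel)) = (\<integral>y. E n y * p (exp (- y)) \<partial>lborel)" ..
    qed
    finally have "(\<lambda>n. \<integral>y. E n y * p (exp (- y)) \<partial>lborel) \<longlonglongrightarrow> 0" by simp
    then obtain n0 where n0: "\<And>n. n \<ge> n0 \<Longrightarrow> \<bar>\<integral>y. E n y * p (exp (- y)) \<partial>lborel\<bar> < e / 2"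
      using LIMSEQ_D[of "\<lambda>n. \<integral>y. E n y * p (exp (- y)) \<partial>lborel" 0 "e / 2"] e by auto
    have "\<bar>\<integral>y. E n y * g (exp (- y)) \<partial>lborel\<bar> < e" if "n \<ge> n0" for n
    proof -
      have gp: "continuous_on UNIV (\<lambda>x. g x - p x)" using g pc by (intro continuous_intros)
      have "(\<integral>y. E n y * g (exp (- y)) \<partial>lborel) - (\<integral>y. E n y * p (exp (- y)) \<partial>lborel)
          = (\<integral>y. E n y * (g (exp (- y)) - p (exp (- y))) \<partial>lborel)"
        using intg[OF g, of n] intg[OF pc, of n]
        by (simp add: right_diff_distrib)
      also have "\<bar>\<dots>\<bar> \<le> (\<integral>y. \<bar>E n y * (g (exp (- y)) - p (exp (- y)))\<bar> \<partial>lborel)"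
        by (rule integral_abs_bound)
      also have "\<dots> \<le> (\<integral>y. e' * \<bar>E n y\<bar> \<partial>lborel)"
      proof (rule integral_mono)
        show "integrable lborel (\<lambda>y. \<bar>E n y * (g (exp (- y)) - p (exp (- y)))\<bar>)"
          using intg[OF gp, of n] by (rule integrable_abs)
        show "integrable lborel (\<lambda>y. e' * \<bar>E n y\<bar>)" using int by simp
        fix y :: real
        show "\<bar>E n y * (g (exp (- y)) - p (exp (- y)))\<bar> \<le> e' * \<bar>E n y\<bar>"
        proof (cases "y \<le> 0")
          case False
          then have "\<bar>g (exp (- y)) - p (exp (- y))\<bar> \<le> e'" by (intro less_imp_le p) auto
          then show ?thesis by (simp add: abs_mult mult.commute[of e'] mult_left_mono)
        qed (simp add: supp)
      qed
      also have "\<dots> \<le> e' * M" using M[of n] e' by simp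
      also have "\<dots> < e / 2" using M0 e by (simp add: e'_def field_simps)
      finally show ?thesis using n0[OF that] by linarith
    qed
    then show "\<exists>n0. \<forall>n\<ge>n0. norm ((\<integral>y. E n y * g (exp (- y)) \<partial>lborel) - 0) < e" by auto
  qed
qed

text \<open>By monotonicity \<open>\<phi> n a\<close> is squeezed between the averages of \<open>\<phi> n\<close> over short intervals to the
  left and to the right of \<open>a\<close>, taken with weights that are functions of \<open>exp (- y)\<close>.\<close>

lemma mono_tendsto_of_laplace:
  fixes \<phi> :: "nat \<Rightarrow> real \<Rightarrow> real" and \<Phi> :: "real \<Rightarrow> real"
  assumes meas: "\<And>n. \<phi> n \<in> borel_measurable borel"
    and bound: "\<And>n y. y > 0 \<Longrightarrow> \<bar>\<phi> n y\<bar> \<le> B"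
    and mono: "\<And>n y z. 0 < y \<Longrightarrow> y \<le> z \<Longrightarrow> \<phi> n y \<le> \<phi> n z"
    and int: "integrable lborel (\<lambda>y. indicator {0<..} y * (\<Phi> y * exp (- y)))"
    and cont: "continuous_on {0<..} \<Phi>"
    and conv: "\<And>k. k \<ge> 1 \<Longrightarrow>
        (\<lambda>n. \<integral>y. indicator {0<..} y * (\<phi> n y * exp (- (real k * y))) \<partial>lborel)
           \<longlonglongrightarrow> (\<integral>y. indicator {0<..} y * (\<Phi> y * exp (- (real k * y))) \<partial>lborel)"
    and a: "a > 0"
  shows "(\<lambda>n. \<phi> n a) \<longlonglongrightarrow> \<Phi> a"
proof -
  have exp_int: "integrable lborel (\<lambda>y. indicator {0<..} y * exp (- y :: real))"
    using has_bochner_integral_exp[of 1] by (simp add: has_bochner_integral_iff)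
  have phi_int: "integrable lborel (\<lambda>y. indicator {0<..} y * (\<phi> n y * exp (- y)))" for n
  proof (rule Bochner_Integration.integrable_bound)
    show "integrable lborel (\<lambda>y. B * (indicator {0<..} y * exp (- y :: real)))" using exp_int by simp
    show "AE y in lborel. norm (indicator {0<..} y * (\<phi> n y * exp (- y))) \<le> norm (B * (indicator {0<..} y * exp (- y :: real)))"
      using bound[of _ n] by (intro AE_I2) (auto simp: abs_mult split: split_indicator intro!: mult_right_mono order_trans[OF _ abs_ge_self])
  qed (use meas[of n] in measurable)
  \<comment> \<open>The weight \<open>exp (- y)\<close> makes the bounded differences integrable
    with a common bound. It also shifts the exponents: the k-th moment of E is the difference of the
    two Laplace transforms at k + 1, so rates from 1 on are enough.\<close>
  define E where "E = (\<lambda>n y. indicator {0<..} y * ((\<phi> n y - \<Phi> y) * exp (- y)))"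
  have E_eq: "E n = (\<lambda>y. indicator {0<..} y * (\<phi> n y * exp (- y)) - indicator {0<..} y * (\<Phi> y * exp (- y)))" for n
    by (simp add: E_def fun_eq_iff algebra_simps)
  have E_int: "integrable lborel (E n)" for n
    unfolding E_eq by (intro Bochner_Integration.integrable_diff phi_int int)
  define M where "M = (\<integral>y. B * (indicator {0<..} y * exp (- y :: real)) \<partial>lborel)
      + (\<integral>y. \<bar>indicator {0<..} y * (\<Phi> y * exp (- y))\<bar> \<partial>lborel)"
  have E_M: "(\<integral>y. \<bar>E n y\<bar> \<partial>lborel) \<le> M" for n
  proof -
    have "(\<integral>y. \<bar>E n y\<bar> \<partial>lborel)
       \<le> (\<integral>y. B * (indicator {0<..} y * exp (- y :: real)) + \<bar>indicator {0<..} y * (\<Phi> y * exp (- y))\<bar> \<partial>lborel)"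
    proof (rule integral_mono)
      fix y :: real
      show "\<bar>E n y\<bar> \<le> B * (indicator {0<..} y * exp (- y)) + \<bar>indicator {0<..} y * (\<Phi> y * exp (- y))\<bar>"
      proof (cases "y > 0")
        case True
        have "\<bar>(\<phi> n y - \<Phi> y) * exp (- y)\<bar> = \<bar>\<phi> n y - \<Phi> y\<bar> * exp (- y)" by (simp add: abs_mult)
        also have "\<dots> \<le> (B + \<bar>\<Phi> y\<bar>) * exp (- y)"
          using bound[OF True, of n] by (intro mult_right_mono) auto
        finally show ?thesis using True by (simp add: E_def abs_mult algebra_simps)
      qed (simp add: E_def)
    qed (use E_int exp_int int in \<open>auto intro!: Bochner_Integration.integrable_add\<close>)
    also have "\<dots> = M"
      unfolding M_def using exp_int int by (intro Bochner_Integration.integral_add) auto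
    finally show ?thesis .
  qed
  have E_conv: "(\<lambda>n. \<integral>y. E n y * exp (- y) ^ k \<partial>lborel) \<longlonglongrightarrow> 0" for k
  proof -
    have ek: "exp (- y) * exp (- y) ^ k = exp (- (real (Suc k) * y))" for y :: real
      by (simp add: exp_of_nat_mult[symmetric] mult_exp_exp algebra_simps)
    have 1: "integrable lborel (\<lambda>y. indicator {0<..} y * (f y * exp (- (real (Suc k) * y))))"
      if "integrable lborel (\<lambda>y. indicator {0<..} y * (f y * exp (- y)))" for f
    proof (rule Bochner_Integration.integrable_bound[OF that])
      have "(\<lambda>y. indicator {0<..} y * (f y * exp (- (real (Suc k) * y))))
          = (\<lambda>y. (indicator {0<..} y * (f y * exp (- y))) * exp (- y) ^ k)"
        unfolding ek[symmetric] by (simp add: mult_ac)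
      also have "\<dots> \<in> borel_measurable lborel"
        by (rule borel_measurable_times[OF borel_measurable_integrable[OF that]]) measurable
      finally show "(\<lambda>y. indicator {0<..} y * (f y * exp (- (real (Suc k) * y)))) \<in> borel_measurable lborel" .
      have "exp (- (y * real (Suc k))) \<le> exp (- y)" if "y > 0" for y :: real
        using that by (simp add: algebra_simps)
      then show "AE y in lborel. norm (indicator {0<..} y * (f y * exp (- (real (Suc k) * y))))
           \<le> norm (indicator {0<..} y * (f y * exp (- y)))"
        by (intro AE_I2) (auto simp: abs_mult mult.commute split: split_indicator intro!: mult_left_mono)
    qed
    have "(\<integral>y. E n y * exp (- y) ^ k \<partial>lborel)
        = (\<integral>y. indicator {0<..} y * (\<phi> n y * exp (- (real (Suc k) * y))) \<partial>lborel)
        - (\<integral>y. indicator {0<..} y * (\<Phi> y * exp (- (real (Suc k) * y))) \<partial>lborel)" for n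
    proof -
      have "E n y * exp (- y) ^ k = indicator {0<..} y * (\<phi> n y * exp (- (real (Suc k) * y)))
          - indicator {0<..} y * (\<Phi> y * exp (- (real (Suc k) * y)))" for y
        unfolding E_def ek[symmetric] by (simp add: algebra_simps)
      then show ?thesis
        using 1[OF phi_int[of n]] 1[OF int] by (simp only: Bochner_Integration.integral_diff)
    qed
    moreover have "(\<lambda>n. (\<integral>y. indicator {0<..} y * (\<phi> n y * exp (- (real (Suc k) * y))) \<partial>lborel)
        - (\<integral>y. indicator {0<..} y * (\<Phi> y * exp (- (real (Suc k) * y))) \<partial>lborel)) \<longlonglongrightarrow> 0"
      using conv[of "Suc k"] by (intro LIM_zero) simp
    ultimately show ?thesis by simp
  qed
  \<comment> \<open>A continuous bump, positive exactly on (l, r) when l < r. Since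
    \<open>exp (- y)\<close> decreases in y, the endpoints are exchanged in \<open>w\<close>, which
    then lives on l < y < r.\<close>
  define g where "g = (\<lambda>l r x :: real. max 0 ((x - l) * (r - x)))"
  have g_cont: "continuous_on UNIV (g l r)" for l r
    unfolding g_def by (intro continuous_intros)
  define w where "w = (\<lambda>l r y. indicator {0<..} y * (exp (- y) * g (exp (- r)) (exp (- l)) (exp (- y))))"
  have E0: "E n y = 0" if "y \<le> 0" for n y using that by (simp add: E_def)
  have w_nonneg: "w l r y \<ge> 0" for l r y by (simp add: w_def g_def)
  have w_supp: "y \<in> {l<..<r}" if "w l r y \<noteq> 0" "l < r" for l r y
    using that by (auto simp: w_def g_def max_def zero_le_mult_iff split: if_splits)
  have w_pos: "w l r y > 0" if "y \<in> {l<..<r}" "0 \<le> l" for l r y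
    using that by (auto simp: w_def g_def less_max_iff_disj)
  have w_int: "integrable lborel (w l r)" for l r
    using integrable_test_function[OF exp_int _ g_cont] by (simp add: w_def mult.assoc)
  have Ew: "E n y * g (exp (- r)) (exp (- l)) (exp (- y)) = (\<phi> n y - \<Phi> y) * w l r y" for n y l r
    by (simp add: E_def w_def)
  have Ew_int: "integrable lborel (\<lambda>y. (\<phi> n y - \<Phi> y) * w l r y)" for n l r
    using integrable_test_function[OF E_int[of n] E0 g_cont[of "exp (- r)" "exp (- l)"]] by (simp add: Ew)
  have Ew_lim: "(\<lambda>n. \<integral>y. (\<phi> n y - \<Phi> y) * w l r y \<partial>lborel) \<longlonglongrightarrow> 0" for l r
    using integral_test_function_tendsto_0[OF E_int E_M E0 E_conv g_cont[of "exp (- r)" "exp (- l)"]]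
    by (simp add: Ew)
  have I_pos: "(\<integral>y. w l r y \<partial>lborel) > 0" if "0 \<le> l" "l < r" for l r
  proof (rule ccontr)
    assume "\<not> ?thesis"
    moreover have "(\<integral>y. w l r y \<partial>lborel) \<ge> 0" by (simp add: w_nonneg)
    ultimately have "(\<integral>y. w l r y \<partial>lborel) = 0" by simp
    then have "AE y in lborel. w l r y = 0"
      by (subst (asm) integral_nonneg_eq_0_iff_AE) (auto simp: w_int w_nonneg)
    then have "AE y in lborel. y \<notin> {l<..<r}"
      by eventually_elim (use w_pos[of _ l r] that in force)
    then have "{l<..<r} \<in> null_sets lborel" by (subst AE_iff_null_sets) auto
    then show False using that by (simp add: null_sets_def)
  qed
  show ?thesis
  proof (rule LIMSEQ_I)
    fix \<epsilon> :: real assume e: "\<epsilon> > 0"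
    have "isCont \<Phi> a" using cont a by (auto simp: continuous_on_eq_continuous_at)
    then obtain d0 where d0: "d0 > 0" "\<And>y. \<bar>y - a\<bar> < d0 \<Longrightarrow> \<bar>\<Phi> y - \<Phi> a\<bar> < \<epsilon> / 2"
      unfolding continuous_at_eps_delta dist_real_def using half_gt_zero[OF e] by blast
    \<comment> \<open>The cap at a keeps the left interval (a - d, a) inside the positive half-line,
      where \<open>\<phi> n\<close> is monotone and the weight is positive.\<close>
    define d where "d = min d0 a"
    have d: "d > 0" "d \<le> a" using d0 a by (auto simp: d_def)
    have close: "\<bar>\<Phi> y - \<Phi> a\<bar> < \<epsilon> / 2" if "y \<in> {a - d<..<a + d}" for y
      using that by (intro d0) (auto simp: d_def)
    define I1 where "I1 = (\<integral>y. w a (a + d) y \<partial>lborel)"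
    define I2 where "I2 = (\<integral>y. w (a - d) a y \<partial>lborel)"
    have I: "I1 > 0" "I2 > 0" unfolding I1_def I2_def using a d by (auto intro!: I_pos)
    have ev1: "\<forall>\<^sub>F n in sequentially. (\<integral>y. (\<phi> n y - \<Phi> y) * w a (a + d) y \<partial>lborel) < \<epsilon> / 2 * I1"
      by (rule order_tendstoD(2)[OF Ew_lim]) (use I e in simp)
    have ev2: "\<forall>\<^sub>F n in sequentially. - (\<epsilon> / 2 * I2) < (\<integral>y. (\<phi> n y - \<Phi> y) * w (a - d) a y \<partial>lborel)"
      by (rule order_tendstoD(1)[OF Ew_lim]) (use I e in simp)
    have up: "(\<phi> n a - \<Phi> a - \<epsilon> / 2) * I1 \<le> (\<integral>y. (\<phi> n y - \<Phi> y) * w a (a + d) y \<partial>lborel)" for n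
    proof -
      have "(\<phi> n a - \<Phi> a - \<epsilon> / 2) * I1 = (\<integral>y. (\<phi> n a - \<Phi> a - \<epsilon> / 2) * w a (a + d) y \<partial>lborel)"
        by (simp add: I1_def)
      also have "\<dots> \<le> (\<integral>y. (\<phi> n y - \<Phi> y) * w a (a + d) y \<partial>lborel)"
      proof (intro integral_mono Ew_int)
        fix y
        show "(\<phi> n a - \<Phi> a - \<epsilon> / 2) * w a (a + d) y \<le> (\<phi> n y - \<Phi> y) * w a (a + d) y"
        proof (cases "w a (a + d) y = 0")
          case False
          then have "y \<in> {a<..<a + d}" using w_supp[OF False] d by simp
          then have "\<phi> n a \<le> \<phi> n y" "\<bar>\<Phi> y - \<Phi> a\<bar> < \<epsilon> / 2"
            using a d close[of y] by (auto intro!: mono)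
          then show ?thesis by (intro mult_right_mono w_nonneg) linarith
        qed simp
      qed (use w_int in auto)
      finally show ?thesis .
    qed
    have lo: "(\<integral>y. (\<phi> n y - \<Phi> y) * w (a - d) a y \<partial>lborel) \<le> (\<phi> n a - \<Phi> a + \<epsilon> / 2) * I2" for n
    proof -
      have "(\<integral>y. (\<phi> n y - \<Phi> y) * w (a - d) a y \<partial>lborel) \<le> (\<integral>y. (\<phi> n a - \<Phi> a + \<epsilon> / 2) * w (a - d) a y \<partial>lborel)"
      proof (intro integral_mono Ew_int)
        fix y
        show "(\<phi> n y - \<Phi> y) * w (a - d) a y \<le> (\<phi> n a - \<Phi> a + \<epsilon> / 2) * w (a - d) a y"
        proof (cases "w (a - d) a y = 0")
          case False
          then have "y \<in> {a - d<..<a}" using w_supp[OF False] d by simp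
          then have "\<phi> n y \<le> \<phi> n a" "\<bar>\<Phi> y - \<Phi> a\<bar> < \<epsilon> / 2"
            using a d close[of y] by (auto intro!: mono)
          then show ?thesis by (intro mult_right_mono w_nonneg) linarith
        qed simp
      qed (use w_int in auto)
      then show ?thesis by (simp add: I2_def)
    qed
    have "\<forall>\<^sub>F n in sequentially. \<bar>\<phi> n a - \<Phi> a\<bar> < \<epsilon>"
      using ev1 ev2
    proof eventually_elim
      case (elim n)
      have "(\<phi> n a - \<Phi> a - \<epsilon> / 2) * I1 < \<epsilon> / 2 * I1" using up[of n] elim by linarith
      then have "\<phi> n a - \<Phi> a - \<epsilon> / 2 < \<epsilon> / 2" using I by (simp only: mult_less_cancel_right_pos)
      moreover have "- (\<epsilon> / 2) * I2 < (\<phi> n a - \<Phi> a + \<epsilon> / 2) * I2" using lo[of n] elim by linarith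
      then have "- (\<epsilon> / 2) < \<phi> n a - \<Phi> a + \<epsilon> / 2" using I by (simp only: mult_less_cancel_right_pos)
      ultimately show ?case by (auto simp: abs_less_iff)
    qed
    then show "\<exists>no. \<forall>n\<ge>no. norm (\<phi> n a - \<Phi> a) < \<epsilon>"
      by (simp add: eventually_sequentially)
  qed
qed

subsection \<open>The Laplace transform of the theta-like functions\<close>

lemma cos_i_times_of_real: "cos (\<i> * of_real x) = complex_of_real (cosh x)"
  by (simp add: cos_i_times cosh_field_def exp_of_real[symmetric] exp_minus)

lemma sin_i_times_of_real: "sin (\<i> * of_real x) = \<i> * complex_of_real (sinh x)"
  by (simp add: sin_i_times sinh_field_def exp_of_real[symmetric] exp_minus)

text \<open>The series is \<open>Digamma (1 - z) - Digamma z\<close>, because the Digamma series for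
  z and 1 - z share the same harmonic terms. Differentiating the reflection formula for
  \<open>Gamma z * Gamma (1 - z)\<close> identifies this difference with the cotangent.\<close>

lemma cot_partial_fractions:
  fixes z :: complex
  assumes z: "z \<notin> \<int>"
  shows "(\<lambda>n. 1 / (of_nat n + z) - 1 / (of_nat (Suc n) - z)) sums (of_real pi * cot (of_real pi * z))"
proof -
  have z1: "1 - z \<notin> \<int>"
  proof
    assume "1 - z \<in> \<int>"
    then have "1 - (1 - z) \<in> \<int>" by (intro Ints_diff) auto
    then show False using z by simp
  qed
  have np: "w \<notin> \<int>\<^sub>\<le>\<^sub>0" if "w \<notin> \<int>" for w :: complex
    using that nonpos_Ints_Int by blast
  have D: "(\<lambda>n. inverse (of_nat (Suc n)) - inverse (w + of_nat n)) sums (Digamma w + euler_mascheroni)"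
    if "w \<notin> \<int>" for w :: complex
    using summable_Digamma[of w] that by (cases "w = 0") (auto simp: Digamma_def sums_iff)
  have "(\<lambda>n. (inverse (of_nat (Suc n)) - inverse (1 - z + of_nat n)) - (inverse (of_nat (Suc n)) - inverse (z + of_nat n)))
      sums ((Digamma (1 - z) + euler_mascheroni) - (Digamma z + euler_mascheroni))"
    by (intro sums_diff D z z1)
  then have "(\<lambda>n. 1 / (of_nat n + z) - 1 / (of_nat (Suc n) - z)) sums (Digamma (1 - z) - Digamma z)"
    by (simp add: inverse_eq_divide algebra_simps)
  moreover have "Digamma (1 - z) - Digamma z = of_real pi * cot (of_real pi * z)"
  proof -
    have op: "open (- \<int> :: complex set)" by (simp add: closed_Ints open_Compl)
    have s0: "sin (of_real pi * w) \<noteq> 0" if "w \<notin> \<int>" for w :: complex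
      using that by (auto simp: sin_eq_0)
    have "((\<lambda>w. Gamma w * Gamma (1 - w)) has_field_derivative
        (Gamma z * Digamma z) * Gamma (1 - z) + Gamma z * (Gamma (1 - z) * Digamma (1 - z) * (- 1))) (at z)"
      using np[OF z] np[OF z1] by (auto intro!: derivative_eq_intros)
    moreover have "((\<lambda>w. of_real pi / sin (of_real pi * w)) has_field_derivative
        - (of_real pi * (cos (of_real pi * z) * of_real pi)) / (sin (of_real pi * z))\<^sup>2) (at z)"
      using s0[OF z] by (auto intro!: derivative_eq_intros simp: power2_eq_square)
    then have "((\<lambda>w. Gamma w * Gamma (1 - w)) has_field_derivative
        - (of_real pi * (cos (of_real pi * z) * of_real pi)) / (sin (of_real pi * z))\<^sup>2) (at z)"
      by (simp add: Gamma_reflection_complex)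
    ultimately have "(Gamma z * Digamma z) * Gamma (1 - z) + Gamma z * (Gamma (1 - z) * Digamma (1 - z) * (- 1))
       = - (of_real pi * (cos (of_real pi * z) * of_real pi)) / (sin (of_real pi * z))\<^sup>2"
      by (rule DERIV_unique)
    then have "(Gamma z * Gamma (1 - z)) * (Digamma (1 - z) - Digamma z)
       = of_real pi * (cos (of_real pi * z) * of_real pi) / (sin (of_real pi * z))\<^sup>2"
      by (simp add: algebra_simps)
    then have "(of_real pi / sin (of_real pi * z)) * (Digamma (1 - z) - Digamma z)
       = (of_real pi / sin (of_real pi * z)) * (of_real pi * cot (of_real pi * z))"
      unfolding Gamma_reflection_complex cot_def by (simp add: power2_eq_square)
    then show ?thesis
      using s0[OF z] by (subst (asm) mult_left_cancel) auto
  qed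
  ultimately show ?thesis by simp
qed

text \<open>The series is the difference of those for \<open>cot (\<pi> z / 2)\<close> and \<open>cot (\<pi> z)\<close>.\<close>

lemma csc_partial_fractions:
  fixes z :: complex
  assumes z: "z \<notin> \<int>" and sm: "summable (\<lambda>m. (-1) ^ m * (1 / (of_nat m + z) + 1 / (of_nat (Suc m) - z)))"
  shows "(\<lambda>m. (-1) ^ m * (1 / (of_nat m + z) + 1 / (of_nat (Suc m) - z))) sums (of_real pi / sin (of_real pi * z))"
proof -
  let ?A = "\<lambda>m. (-1) ^ m * (1 / (of_nat m + z) + 1 / (of_nat (Suc m) - z))"
  let ?g = "\<lambda>n. 1 / (of_nat n + z) - 1 / (of_nat (Suc n) - z)"
  have z2: "z / 2 \<notin> \<int>"
  proof
    assume "z / 2 \<in> \<int>"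
    then have "2 * (z / 2) \<in> \<int>" by (intro Ints_mult) auto
    then show False using z by simp
  qed
  have 1: "(\<lambda>n. 1 / (of_nat n + z / 2) - 1 / (of_nat (Suc n) - z / 2)) sums (of_real pi * cot (of_real pi * (z / 2)))"
    by (rule cot_partial_fractions[OF z2])
  have 2: "(\<lambda>n. sum ?g {n * 2..<n * 2 + 2}) sums (of_real pi * cot (of_real pi * z))"
    by (rule sums_group[OF cot_partial_fractions[OF z]]) simp
  \<comment> \<open>Grouping in pairs determines only the value. Convergence of the ungrouped series
    is the hypothesis \<open>sm\<close>, which both applications obtain from a rewritten form of the
    terms.\<close>
  have 3: "(\<lambda>n. sum ?A {n * 2..<n * 2 + 2}) sums suminf ?A"
    by (rule sums_group[OF summable_sums[OF sm]]) simp
  have pair: "sum ?A {n * 2..<n * 2 + 2} = (1 / (of_nat n + z / 2) - 1 / (of_nat (Suc n) - z / 2)) - sum ?g {n * 2..<n * 2 + 2}" for n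
  proof -
    have i: "{n * 2..<n * 2 + 2} = {2 * n, Suc (2 * n)}" by auto
    have h: "1 / (of_nat n + z / 2) = 2 * (1 / (of_nat (2 * n) + z))"
      "1 / (of_nat (Suc n) - z / 2) = 2 * (1 / (of_nat (Suc (Suc (2 * n))) - z))"
    proof -
      have "of_nat n + z / 2 = (of_nat (2 * n) + z) / 2" "of_nat (Suc n) - z / 2 = (of_nat (Suc (Suc (2 * n))) - z) / 2"
        by (simp_all add: field_simps)
      then show "1 / (of_nat n + z / 2) = 2 * (1 / (of_nat (2 * n) + z))"
        "1 / (of_nat (Suc n) - z / 2) = 2 * (1 / (of_nat (Suc (Suc (2 * n))) - z))"
        by (simp_all only:) simp_all
    qed
    show ?thesis unfolding i h by simp
  qed
  have "(\<lambda>n. sum ?A {n * 2..<n * 2 + 2}) sums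
      (of_real pi * cot (of_real pi * (z / 2)) - of_real pi * cot (of_real pi * z))"
    unfolding pair by (rule sums_diff[OF 1 2])
  with 3 have "suminf ?A = of_real pi * cot (of_real pi * (z / 2)) - of_real pi * cot (of_real pi * z)"
    by (rule sums_unique2)
  also have "\<dots> = of_real pi / sin (of_real pi * z)"
  proof -
    define w where "w = of_real pi * (z / 2)"
    have w: "of_real pi * z = 2 * w" by (simp add: w_def)
    have "sin (2 * w) \<noteq> 0" using z by (auto simp: sin_eq_0 w[symmetric])
    then have "sin w \<noteq> 0" "cos w \<noteq> 0" by (auto simp: sin_double)
    then have "cos w / sin w = (1 + cos (2 * w)) / sin (2 * w)"
      unfolding cos_double_cos sin_double by (simp add: power2_eq_square)
    then show ?thesis
      unfolding w w_def[symmetric] cot_def by (simp add: add_divide_distrib distrib_left)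
  qed
  finally show ?thesis using summable_sums[OF sm] by simp
qed

text \<open>With the exponents defined next, both theta-like functions at 1/y become 1 plus the sum
  of \<open>theta_coeff d k * exp (- theta_exponent d k * y)\<close>. The numbers -
  \<open>theta_exponent d k\<close> are the zeros in q of cosh (sqrt q) or sinh (sqrt q) / sqrt q,
  and the coefficients are the residues of 1 / (q \<open>cosh_like d q\<close>) at them.\<close>

definition theta_coeff :: "nat \<Rightarrow> nat \<Rightarrow> real" where
  "theta_coeff d k = (if d = 0 then - (4 / pi) * ((-1) ^ k / (2 * real k + 1)) else 2 * (-1) ^ Suc k)"

definition theta_exponent :: "nat \<Rightarrow> nat \<Rightarrow> real" where
  "theta_exponent d k = (if d = 0 then (pi\<^sup>2 / 4) * (2 * real k + 1)\<^sup>2 else (pi * real (Suc k))\<^sup>2)"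

definition cosh_like :: "nat \<Rightarrow> real \<Rightarrow> real" where
  "cosh_like d q = (if d = 0 then cosh (sqrt q) else sinh (sqrt q) / sqrt q)"

lemma theta_coeff_le: "\<bar>theta_coeff d k\<bar> \<le> 2"
proof -
  have "4 / pi \<le> 2" using pi_ge_two by (simp add: field_simps)
  moreover have "1 / (2 * real k + 1) \<le> 1" by simp
  ultimately have "(4 / pi) * (1 / (2 * real k + 1)) \<le> 2 * 1" by (intro mult_mono) auto
  then show ?thesis by (auto simp: theta_coeff_def abs_mult)
qed

lemma theta_exponent_ge: "theta_exponent d k \<ge> (real (Suc k))\<^sup>2"
proof -
  have "real (Suc k) \<le> pi * real (Suc k)" using pi_ge_two mult_right_mono[of 1 pi "real (Suc k)"] by simp
  then have 1: "(real (Suc k))\<^sup>2 \<le> (pi * real (Suc k))\<^sup>2" by (intro power_mono) auto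
  have "1 * (2 * real k + 1) \<le> (pi / 2) * (2 * real k + 1)" using pi_ge_two by (intro mult_right_mono) auto
  then have "real (Suc k) \<le> (pi / 2) * (2 * real k + 1)" by simp
  then have "(real (Suc k))\<^sup>2 \<le> ((pi / 2) * (2 * real k + 1))\<^sup>2" by (intro power_mono) auto
  with 1 show ?thesis by (simp add: theta_exponent_def power_mult_distrib power_divide)
qed

lemma theta_exponent_pos: "theta_exponent d k > 0"
  using theta_exponent_ge[of k d] by (rule order_less_le_trans[rotated]) simp

lemma summable_inverse_squares: "summable (\<lambda>k. 1 / (real (Suc k))\<^sup>2)"
  using inverse_power_summable[of 2, where 'a = real] summable_Suc_iff[of "\<lambda>k. inverse (real k ^ 2)"]
  by (simp add: inverse_eq_divide)

lemma summable_theta_fractions: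
  assumes "q \<ge> 0"
  shows "summable (\<lambda>k. \<bar>theta_coeff d k\<bar> / (q + theta_exponent d k))"
proof (rule summable_comparison_test[OF exI, OF allI, OF impI])
  show "summable (\<lambda>k. 2 * (1 / (real (Suc k))\<^sup>2))"
    by (intro summable_mult summable_inverse_squares)
  fix k
  have "\<bar>theta_coeff d k\<bar> / (q + theta_exponent d k) \<le> 2 / (real (Suc k))\<^sup>2"
    using theta_coeff_le[of d k] theta_exponent_ge[of k d] assms by (intro frac_le) auto
  then show "norm (\<bar>theta_coeff d k\<bar> / (q + theta_exponent d k)) \<le> 2 * (1 / (real (Suc k))\<^sup>2)"
    using theta_exponent_pos[of d k] assms by simp
qed

lemma summable_theta_fractions':
  assumes "q \<ge> 0"
  shows "summable (\<lambda>k. theta_coeff d k / (q + theta_exponent d k))"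
proof (rule summable_rabs_cancel)
  have "\<bar>theta_coeff d k / (q + theta_exponent d k)\<bar> = \<bar>theta_coeff d k\<bar> / (q + theta_exponent d k)" for k
    using theta_exponent_pos[of d k] assms by (simp add: abs_divide)
  then show "summable (\<lambda>k. \<bar>theta_coeff d k / (q + theta_exponent d k)\<bar>)"
    using summable_theta_fractions[OF assms, of d] by (simp only:)
qed

text \<open>At z = 1/2 + i x/pi with x = sqrt q, sin (pi z) = cosh x, and the two fractions in each
  term of the cosecant series are complex conjugates. Writing b/(q + b) as 1 - q/(q + b) separates a
  conditionally convergent part, the Leibniz series for pi/4, from an absolutely convergent
  one.\<close>

lemma sech_partial_fractions:
  assumes "q > 0"
  shows "1 / q + (\<Sum>k. theta_coeff 0 k / (q + theta_exponent 0 k)) = 1 / (q * cosh (sqrt q))"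
proof -
  define x where "x = sqrt q"
  have x: "x > 0" "x\<^sup>2 = q" using assms by (auto simp: x_def)
  define z where "z = 1 / 2 + \<i> * of_real (x / pi)"
  let ?b = "theta_exponent 0"
  have z: "z \<notin> \<int>"
  proof
    assume "z \<in> \<int>"
    then have "Im z = 0" by (auto elim: Ints_cases)
    then show False using x by (simp add: z_def)
  qed
  have A: "(-1) ^ m * (1 / (of_nat m + z) + 1 / (of_nat (Suc m) - z))
      = of_real (pi * (4 / pi * ((-1) ^ m / (2 * real m + 1)) + q * (theta_coeff 0 m / (q + ?b m))))" for m
  proof -
    let ?r = "real m + 1 / 2" and ?y = "x / pi"
    have e: "of_nat m + z = of_real ?r + \<i> * of_real ?y" "of_nat (Suc m) - z = of_real ?r - \<i> * of_real ?y"
      by (simp_all add: z_def)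
    have nz: "of_real ?r + \<i> * of_real ?y \<noteq> 0" "of_real ?r - \<i> * of_real ?y \<noteq> 0"
      by (auto simp: complex_eq_iff)
    have "1 / w1 + 1 / w2 = (w1 + w2) / (w1 * w2)" if "w1 \<noteq> 0" "w2 \<noteq> 0" for w1 w2 :: complex
      using that by (simp add: field_simps)
    from this[OF nz] have "1 / (of_nat m + z) + 1 / (of_nat (Suc m) - z)
       = (2 * of_real ?r) / ((of_real ?r + \<i> * of_real ?y) * (of_real ?r - \<i> * of_real ?y))"
      unfolding e by simp
    also have "(of_real ?r + \<i> * of_real ?y) * (of_real ?r - \<i> * of_real ?y) = of_real (?r\<^sup>2 + ?y\<^sup>2)"
      by (simp add: power2_eq_square algebra_simps)
    finally have 1: "1 / (of_nat m + z) + 1 / (of_nat (Suc m) - z) = of_real (2 * ?r / (?r\<^sup>2 + ?y\<^sup>2))" by simp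
    have "q + ?b m = pi\<^sup>2 * (?r\<^sup>2 + ?y\<^sup>2)"
      using x by (simp add: theta_exponent_def field_simps power2_eq_square)
    then have 2: "2 * ?r / (?r\<^sup>2 + ?y\<^sup>2) = 2 * ?r * pi\<^sup>2 / (q + ?b m)" by simp
    have bp: "?b m > 0" by (rule theta_exponent_pos)
    have 3: "2 * ?r * pi\<^sup>2 / (q + ?b m) = pi * (4 / pi * (1 / (2 * real m + 1)) - q * (4 / pi * (1 / (2 * real m + 1)) / (q + ?b m)))"
    proof -
      have "pi * (4 / pi * (1 / (2 * real m + 1)) - q * (4 / pi * (1 / (2 * real m + 1)) / (q + ?b m)))
        = 4 / (2 * real m + 1) * (1 - q / (q + ?b m))"
        by (simp only: right_diff_distrib) simp
      also have "1 - q / (q + ?b m) = ?b m / (q + ?b m)" using bp assms by (simp add: field_simps)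
      also have "4 / (2 * real m + 1) * (?b m / (q + ?b m)) = 2 * ?r * pi\<^sup>2 / (q + ?b m)"
      proof -
        have "4 / (2 * real m + 1) * ?b m = 2 * ?r * pi\<^sup>2"
          by (simp add: theta_exponent_def power2_eq_square field_simps)
        then show ?thesis by simp
      qed
      finally show ?thesis ..
    qed
    have "c * (pi * (4 / pi * (1 / R) - q * (4 / pi * (1 / R) / D)))
        = pi * (4 / pi * (c / R) + q * (- (4 / pi) * (c / R) / D))" for c R D
      by (simp add: algebra_simps)
    then have "(-1) ^ m * (2 * ?r / (?r\<^sup>2 + ?y\<^sup>2))
      = pi * (4 / pi * ((-1) ^ m / (2 * real m + 1)) + q * (theta_coeff 0 m / (q + ?b m)))"
      unfolding 2 3 theta_coeff_def by (simp only: simp_thms if_True)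
    moreover have "(-1) ^ m * complex_of_real r = of_real ((-1) ^ m * r)" for r by simp
    ultimately show ?thesis unfolding 1 by (simp only:)
  qed
  have leib: "(\<lambda>m. (-1) ^ m / (2 * real m + 1)) sums (pi / 4)"
  proof -
    have "summable (\<lambda>k. (-1) ^ k * 1 / real (k * 2 + 1) * 1 ^ (k * 2 + 1) :: real)"
      using summable_arctan_series[of 1] by simp
    then have "summable (\<lambda>k. (-1) ^ k * 1 / real (k * 2 + 1))" by simp
    then have "(\<lambda>k. (-1) ^ k * 1 / real (k * 2 + 1)) sums (pi / 4)"
      unfolding pi_series by (rule summable_sums)
    also have "(\<lambda>k. (-1) ^ k * 1 / real (k * 2 + 1)) = (\<lambda>m. (-1) ^ m / (2 * real m + 1))"
      by (intro ext) (simp add: algebra_simps)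
    finally show ?thesis .
  qed
  have frac: "summable (\<lambda>k. theta_coeff 0 k / (q + ?b k))"
    using assms by (intro summable_theta_fractions') simp
  let ?S = "\<Sum>k. theta_coeff 0 k / (q + ?b k)"
  have R: "(\<lambda>m. pi * (4 / pi * ((-1) ^ m / (2 * real m + 1)) + q * (theta_coeff 0 m / (q + ?b m))))
      sums (pi * (4 / pi * (pi / 4) + q * ?S))"
    by (intro sums_mult sums_add leib summable_sums frac)
  then have C: "(\<lambda>m. (-1) ^ m * (1 / (of_nat m + z) + 1 / (of_nat (Suc m) - z)))
      sums of_real (pi * (4 / pi * (pi / 4) + q * ?S))"
    unfolding A by (rule sums_of_real)
  then have "of_real (pi * (4 / pi * (pi / 4) + q * ?S)) = of_real pi / sin (of_real pi * z)"
    using csc_partial_fractions[OF z] by (intro sums_unique2[OF C]) (auto simp: sums_iff)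
  also have "sin (of_real pi * z) = of_real (cosh x)"
  proof -
    have "of_real pi * z = of_real (pi / 2) + \<i> * of_real x" by (simp add: z_def algebra_simps)
    then have "sin (of_real pi * z) = cos (\<i> * of_real x)" by (simp add: sin_add)
    then show ?thesis by (simp add: cos_i_times_of_real)
  qed
  finally have "of_real (pi * (4 / pi * (pi / 4) + q * ?S)) = (of_real (pi / cosh x) :: complex)" by simp
  then have "pi * (1 + q * ?S) = pi / cosh x" unfolding of_real_eq_iff by simp
  then have "1 + q * ?S = 1 / cosh x" by (simp add: divide_simps)
  then show ?thesis using assms unfolding x_def[symmetric] by (simp add: field_simps)
qed

text \<open>At z = i x/pi with x = sqrt q, sin (pi z) = i sinh x, but now the conjugate fractions
  sit in neighbouring terms of the cosecant series. Adding and subtracting (-1)^m/(m - z) regroups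
  them at the cost of the telescoping differences of \<open>h\<close>.\<close>

lemma csch_partial_fractions:
  assumes "q > 0"
  shows "1 / q + (\<Sum>k. theta_coeff 1 k / (q + theta_exponent 1 k)) = 1 / (q * (sinh (sqrt q) / sqrt q))"
proof -
  define x where "x = sqrt q"
  have x: "x > 0" "x\<^sup>2 = q" using assms by (auto simp: x_def)
  define y where "y = x / pi"
  have y: "y > 0" using x by (simp add: y_def)
  define z where "z = \<i> * complex_of_real y"
  let ?b = "theta_exponent 1"
  let ?S = "\<Sum>k. theta_coeff 1 k / (q + ?b k)"
  have z: "z \<notin> \<int>"
  proof
    assume "z \<in> \<int>"
    then have "Im z = 0" by (auto elim: Ints_cases)
    then show False using y by (simp add: z_def)
  qed
  have zz: "z * z = - of_real (y\<^sup>2)" by (simp add: z_def power2_eq_square algebra_simps)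
  have nz: "of_nat m + z \<noteq> 0" "of_nat m - z \<noteq> 0" for m
    using y by (auto simp: z_def complex_eq_iff)
  define h where "h = (\<lambda>m. (-1) ^ Suc m / (of_nat m - z))"
  let ?T = "\<lambda>m. - (2 * z) * of_real ((-1) ^ m / ((real m)\<^sup>2 + y\<^sup>2))"
  have A: "(-1) ^ m * (1 / (of_nat m + z) + 1 / (of_nat (Suc m) - z)) = ?T m + (h (Suc m) - h m)" for m
  proof -
    have "1 / (w + z) - 1 / (w - z) = - (2 * z) / (w * w - z * z)"
      if "w + z \<noteq> 0" "w - z \<noteq> 0" for w
    proof -
      have "1 / w1 - 1 / w2 = (w2 - w1) / (w1 * w2)" if "w1 \<noteq> 0" "w2 \<noteq> 0" for w1 w2 :: complex
        using that by (simp add: field_simps)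
      from this[OF that] show ?thesis by (simp add: algebra_simps)
    qed
    from this[OF nz] have "1 / (of_nat m + z) - 1 / (of_nat m - z) = - (2 * z) * of_real (1 / ((real m)\<^sup>2 + y\<^sup>2))"
      unfolding zz by (simp add: power2_eq_square)
    then have "(-1) ^ m * (1 / (of_nat m + z) - 1 / (of_nat m - z)) = (-1) ^ m * (- (2 * z) * of_real (1 / ((real m)\<^sup>2 + y\<^sup>2)))"
      by (rule arg_cong)
    also have "\<dots> = ?T m" by simp
    finally show ?thesis by (simp add: h_def algebra_simps)
  qed
  have h_lim: "h \<longlonglongrightarrow> 0"
  proof (rule Lim_null_comparison)
    show "\<forall>\<^sub>F m in sequentially. norm (h m) \<le> inverse (real m)"
    proof (rule eventually_sequentiallyI[of 1])
      fix m :: nat assume m: "1 \<le> m"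
      have "real m \<le> \<bar>Re (of_nat m - z)\<bar>" by (simp add: z_def)
      also have "\<dots> \<le> norm (of_nat m - z)" by (rule abs_Re_le_cmod)
      finally show "norm (h m) \<le> inverse (real m)"
        using m by (simp add: h_def norm_divide norm_power divide_simps)
    qed
    show "(\<lambda>m. inverse (real m)) \<longlonglongrightarrow> 0" by (rule lim_inverse_n)
  qed
  have tel: "(\<lambda>m. h (Suc m) - h m) sums (0 - h 0)"
    by (rule telescope_sums[OF h_lim])
  have frac: "summable (\<lambda>k. theta_coeff 1 k / (q + ?b k))"
    using assms by (intro summable_theta_fractions') simp
  have trm: "(-1) ^ Suc k / ((real (Suc k))\<^sup>2 + y\<^sup>2) = (pi\<^sup>2 / 2) * (theta_coeff 1 k / (q + ?b k))" for k
  proof -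
    have "q + ?b k = pi\<^sup>2 * ((real (Suc k))\<^sup>2 + y\<^sup>2)"
      using x by (simp add: theta_exponent_def y_def power_mult_distrib power_divide distrib_left del: of_nat_Suc)
    then show ?thesis by (simp add: theta_coeff_def del: of_nat_Suc)
  qed
  have "(\<lambda>k. (-1) ^ Suc k / ((real (Suc k))\<^sup>2 + y\<^sup>2)) sums ((pi\<^sup>2 / 2) * ?S)"
    unfolding trm by (intro sums_mult summable_sums frac)
  from sums_Suc[OF this] have "(\<lambda>m. (-1) ^ m / ((real m)\<^sup>2 + y\<^sup>2)) sums ((pi\<^sup>2 / 2) * ?S + 1 / y\<^sup>2)"
    by simp
  \<comment> \<open>The m = 0 fraction appears twice after the regrouping. The boundary term - h 0
    of the telescoping sum cancels one of the two copies, and the other becomes 1/q.\<close>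
  from sums_add[OF sums_mult[OF sums_of_real[OF this, where 'a = complex]] tel]
  have C: "(\<lambda>m. (-1) ^ m * (1 / (of_nat m + z) + 1 / (of_nat (Suc m) - z)))
      sums (- (2 * z) * of_real ((pi\<^sup>2 / 2) * ?S + 1 / y\<^sup>2) + (0 - h 0))"
    unfolding A .
  then have "- (2 * z) * of_real ((pi\<^sup>2 / 2) * ?S + 1 / y\<^sup>2) + (0 - h 0) = of_real pi / sin (of_real pi * z)"
    using csc_partial_fractions[OF z] by (intro sums_unique2[OF C]) (auto simp: sums_iff)
  also have "of_real pi * z = \<i> * of_real x" by (simp add: z_def y_def)
  also have "sin (\<i> * of_real x) = \<i> * of_real (sinh x)" by (rule sin_i_times_of_real)
  finally have "Im (- (2 * z) * of_real ((pi\<^sup>2 / 2) * ?S + 1 / y\<^sup>2) + (0 - h 0)) = Im (of_real pi / (\<i> * of_real (sinh x)))"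
    by (rule arg_cong)
  moreover have "Im (of_real pi / (\<i> * of_real (sinh x))) = - pi / sinh x"
    by (simp add: Im_divide power2_eq_square)
  moreover have "h 0 = 1 / z" by (simp add: h_def)
  moreover have "1 / z = - \<i> * of_real (1 / y)" using y by (simp add: z_def field_simps)
  ultimately have "- 2 * y * ((pi\<^sup>2 / 2) * ?S + 1 / y\<^sup>2) + 1 / y = - pi / sinh x"
    by (simp add: z_def)
  moreover have "- 2 * y * ((pi\<^sup>2 / 2) * s + 1 / y\<^sup>2) + 1 / y = - (y * pi\<^sup>2 * s + 1 / y)" for s
    using y by (simp add: field_simps power2_eq_square)
  ultimately have "- (y * pi\<^sup>2 * ?S + 1 / y) = - pi / sinh x" by (simp only:)
  then have "y * pi\<^sup>2 * ?S + 1 / y = pi / sinh x" by simp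
  moreover have "y * pi\<^sup>2 * ?S + 1 / y = pi * x * (?S + 1 / q)"
    using x assms by (simp add: y_def field_simps power2_eq_square)
  ultimately have "pi * (x * (?S + 1 / q)) = pi * (1 / sinh x)" by simp
  then have "x * (?S + 1 / q) = 1 / sinh x" by (subst (asm) mult_left_cancel) auto
  then have "?S + 1 / q = 1 / (x * sinh x)" using x by (simp add: field_simps)
  also have "x * sinh x = q * (sinh x / x)" using x by (simp add: x(2)[symmetric] power2_eq_square)
  finally show ?thesis by (simp add: x_def[symmetric] add.commute)
qed

lemma theta_partial_fractions:
  assumes "q > 0" "d \<in> {0, 1}"
  shows "1 / q + (\<Sum>k. theta_coeff d k / (q + theta_exponent d k)) = 1 / (q * cosh_like d q)"
  using assms sech_partial_fractions[of q] csch_partial_fractions[of q] by (auto simp: cosh_like_def)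

lemma summable_theta_exp:
  assumes "y > 0"
  shows "summable (\<lambda>k. 2 * exp (- (theta_exponent d k * y)))"
proof (rule summable_mult, rule summable_comparison_test[OF exI, OF allI, OF impI])
  show "summable (\<lambda>k. exp (- y) ^ k)" using assms by (intro summable_geometric) simp
  fix k
  have "real k \<le> (real (Suc k))\<^sup>2" by (simp add: power2_eq_square algebra_simps)
  then have "real k * y \<le> theta_exponent d k * y"
    using assms theta_exponent_ge[of k d] by (intro mult_right_mono) auto
  then show "norm (exp (- (theta_exponent d k * y))) \<le> exp (- y) ^ k"
    by (simp add: exp_of_nat_mult[symmetric])
qed

lemma summable_theta_series:
  assumes "y > 0"
  shows "summable (\<lambda>k. \<bar>theta_coeff d k * exp (- (theta_exponent d k * y))\<bar>)"
  by (rule summable_comparison_test[OF exI, OF allI, OF impI, OF _ summable_theta_exp[OF assms, of d]])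
     (use theta_coeff_le in \<open>auto simp: abs_mult intro!: mult_right_mono\<close>)

lemma Theta_inverse:
  assumes "y > 0" "d \<in> {0, 1}"
  shows "Theta d (1 / y) = 1 + (\<Sum>k. theta_coeff d k * exp (- (theta_exponent d k * y)))"
proof (cases "d = 0")
  case True
  have eq: "theta_coeff 0 k * exp (- (theta_exponent 0 k * y))
      = - (4 / pi) * ((-1) ^ k * exp (- (pi\<^sup>2 / 4) * (2 * real k + 1)\<^sup>2 / (1 / y)) / (2 * real k + 1))" for k
    by (simp add: theta_coeff_def theta_exponent_def)
  have "summable (\<lambda>k. theta_coeff 0 k * exp (- (theta_exponent 0 k * y)))"
    by (rule summable_rabs_cancel[OF summable_theta_series[OF assms(1)]])
  then have "summable (\<lambda>k. (-1) ^ k * exp (- (pi\<^sup>2 / 4) * (2 * real k + 1)\<^sup>2 / (1 / y)) / (2 * real k + 1))"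
    unfolding eq by (subst (asm) summable_cmult_iff) auto
  then show ?thesis using True unfolding True eq Theta_def by (subst suminf_mult) auto
next
  case False
  with assms have d: "d = 1" by simp
  have eq: "theta_coeff 1 k * exp (- (theta_exponent 1 k * y))
      = 2 * ((-1) ^ Suc k * exp (- (pi * real (Suc k))\<^sup>2 / (1 / y)))" for k
    by (simp add: theta_coeff_def theta_exponent_def)
  have "summable (\<lambda>k. theta_coeff 1 k * exp (- (theta_exponent 1 k * y)))"
    by (rule summable_rabs_cancel[OF summable_theta_series[OF assms(1)]])
  then have "summable (\<lambda>k. (-1) ^ Suc k * exp (- (pi * real (Suc k))\<^sup>2 / (1 / y)))"
    unfolding eq by (subst (asm) summable_cmult_iff) auto
  then show ?thesis unfolding d eq Theta_def by (subst suminf_mult) auto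
qed

lemma continuous_on_Theta_inverse:
  assumes "d \<in> {0, 1}"
  shows "continuous_on {0<..} (\<lambda>y. Theta d (1 / y))"
proof -
  have "continuous_on {0<..} (\<lambda>y. \<Sum>k. theta_coeff d k * exp (- (theta_exponent d k * y)))" (is "continuous_on _ ?f")
  proof (subst continuous_on_eq_continuous_at)
    show "\<forall>y\<in>{0<..}. isCont ?f y"
    proof
      fix y :: real assume y: "y \<in> {0<..}"
      \<comment> \<open>The majorants of the test are summable only away from 0, so each point y
        gets its own half-line.\<close>
      have "uniform_limit {y/2<..} (\<lambda>n y. \<Sum>k<n. theta_coeff d k * exp (- (theta_exponent d k * y))) ?f sequentially"
      proof (rule Weierstrass_m_test)
        show "summable (\<lambda>k. 2 * exp (- (theta_exponent d k * (y / 2))))"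
          using y by (intro summable_theta_exp) auto
        fix k x assume x: "x \<in> {y/2<..}"
        have "\<bar>theta_coeff d k\<bar> * exp (- (theta_exponent d k * x)) \<le> 2 * exp (- (theta_exponent d k * (y / 2)))"
          using x theta_exponent_pos[of d k] by (intro mult_mono theta_coeff_le) auto
        then show "norm (theta_coeff d k * exp (- (theta_exponent d k * x))) \<le> 2 * exp (- (theta_exponent d k * (y / 2)))"
          by (simp add: abs_mult)
      qed
      then have "continuous_on {y/2<..} ?f"
        by (rule uniform_limit_theorem[rotated]) (auto intro!: always_eventually continuous_intros)
      then show "isCont ?f y" using y by (subst (asm) continuous_on_eq_continuous_at) auto
    qed
  qed simp
  then have "continuous_on {0<..} (\<lambda>y. 1 + ?f y)" by (intro continuous_intros)
  then show ?thesis by (rule continuous_on_cong[THEN iffD1, rotated 2]) (use assms Theta_inverse in auto)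
qed

text \<open>Termwise integration: the constant 1 gives 1/q and each exponential gives one partial
  fraction. The growth of the exponents makes these fractions absolutely summable, which justifies
  the exchange.\<close>

lemma laplace_Theta:
  assumes "q > 0" "d \<in> {0, 1}"
  shows "has_bochner_integral lborel (\<lambda>y. indicator {0<..} y * (Theta d (1 / y) * exp (- (q * y)))) (1 / (q * cosh_like d q))"
proof -
  let ?c = "theta_coeff d" and ?b = "theta_exponent d"
  let ?f = "\<lambda>k y. ?c k * (indicator {0<..} y * exp (- ((q + ?b k) * y)))"
  have E: "has_bochner_integral lborel (\<lambda>y. indicator {0<..} y * exp (- ((q + ?b k) * y))) (1 / (q + ?b k))" for k
    using assms theta_exponent_pos by (intro has_bochner_integral_exp add_pos_pos) auto
  have f: "has_bochner_integral lborel (?f k) (?c k * (1 / (q + ?b k)))" for k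
    using E by (intro has_bochner_integral_mult_right)
  have "(\<integral>y. norm (?f k y) \<partial>lborel) = \<bar>?c k\<bar> / (q + ?b k)" for k
  proof -
    have "(\<integral>y. norm (?f k y) \<partial>lborel) = (\<integral>y. \<bar>?c k\<bar> * (indicator {0<..} y * exp (- ((q + ?b k) * y))) \<partial>lborel)"
      by (intro Bochner_Integration.integral_cong) (auto simp: abs_mult)
    also have "\<dots> = \<bar>?c k\<bar> / (q + ?b k)" using E[of k] by (simp add: has_bochner_integral_iff)
    finally show ?thesis .
  qed
  then have sm: "summable (\<lambda>k. \<integral>y. norm (?f k y) \<partial>lborel)"
    using summable_theta_fractions[of q d] assms by simp
  have ae: "AE y in lborel. summable (\<lambda>k. norm (?f k y))"
  proof (intro AE_I2)
    fix y :: real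
    show "summable (\<lambda>k. norm (?f k y))"
    proof (cases "y > 0")
      case True
      have "norm (?f k y) = exp (- (q * y)) * \<bar>?c k * exp (- (?b k * y))\<bar>" for k
        using True by (simp add: abs_mult mult_exp_exp algebra_simps)
      then show ?thesis using summable_theta_series[OF True, of d] by (simp add: summable_mult)
    qed simp
  qed
  have fi: "integrable lborel (?f k)" for k using f by (simp add: has_bochner_integral_iff)
  have "integrable lborel (\<lambda>y. \<Sum>k. ?f k y)" "(\<integral>y. (\<Sum>k. ?f k y) \<partial>lborel) = (\<Sum>k. integral\<^sup>L lborel (?f k))"
    by (rule integrable_suminf[OF fi ae sm], rule integral_suminf[OF fi ae sm])
  moreover have "integral\<^sup>L lborel (?f k) = ?c k / (q + ?b k)" for k
    using f[of k] by (simp add: has_bochner_integral_iff)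
  ultimately have "has_bochner_integral lborel (\<lambda>y. \<Sum>k. ?f k y) (\<Sum>k. ?c k / (q + ?b k))"
    by (simp add: has_bochner_integral_iff)
  from has_bochner_integral_add[OF has_bochner_integral_exp[OF assms(1)] this]
  have "has_bochner_integral lborel (\<lambda>y. indicator {0<..} y * exp (- (q * y)) + (\<Sum>k. ?f k y)) (1 / (q * cosh_like d q))"
    unfolding theta_partial_fractions[OF assms] .
  also have "(\<lambda>y. indicator {0<..} y * exp (- (q * y)) + (\<Sum>k. ?f k y))
     = (\<lambda>y. indicator {0<..} y * (Theta d (1 / y) * exp (- (q * y))))"
  proof
    fix y :: real
    show "indicator {0<..} y * exp (- (q * y)) + (\<Sum>k. ?f k y) = indicator {0<..} y * (Theta d (1 / y) * exp (- (q * y)))"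
    proof (cases "y > 0")
      case True
      have "(\<Sum>k. ?f k y) = (\<Sum>k. ?c k * exp (- (?b k * y)) * exp (- (q * y)))"
        using True by (simp add: mult_exp_exp algebra_simps)
      also have "\<dots> = (\<Sum>k. ?c k * exp (- (?b k * y))) * exp (- (q * y))"
        by (rule suminf_mult2[symmetric]) (rule summable_rabs_cancel[OF summable_theta_series[OF True]])
      finally show ?thesis using True assms by (simp add: Theta_inverse algebra_simps)
    qed simp
  qed
  finally show ?thesis .
qed

subsection \<open>The zeros of the polynomials in the class\<close>

lemma map_poly_of_real_mult:
  "map_poly of_real (p * q) = map_poly of_real p * (map_poly of_real q :: complex poly)"
  by (intro poly_eqI) (simp add: coeff_map_poly coeff_mult)

lemma map_poly_of_real_prod:
  "map_poly of_real (\<Prod>k\<in>A. p k) = (\<Prod>k\<in>A. map_poly of_real (p k) :: complex poly)"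
  by (induction A rule: infinite_finite_induct) (auto simp: map_poly_of_real_mult)

text \<open>Both sides are monic of degree 2N + d and share 2N + d distinct zeros: the N positive
  ones, their negatives and, for odd degree, 0. Their difference has lower degree, hence too many
  zeros unless it vanishes.\<close>

lemma parity_poly_factorization:
  fixes p :: "real poly"
  assumes deg: "degree p = 2 * N + d" and lead: "lead_coeff p = 1" and d: "d \<in> {0, 1}"
    and parity: "\<And>t. poly p (- t) = (-1) ^ d * poly p t"
    and x: "bij_betw x {1..N} {\<xi>. \<xi> > 0 \<and> poly p \<xi> = 0}"
  shows "p = monom 1 d * (\<Prod>k=1..N. [:- (x k)\<^sup>2, 0, 1:])"
proof -
  let ?q = "monom 1 d * (\<Prod>k=1..N. [:- (x k)\<^sup>2, 0, 1:])"
  have "degree ?q = d + degree (\<Prod>k=1..N. [:- (x k)\<^sup>2, 0, 1:])"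
    by (subst degree_mult_eq) (auto simp: degree_monom_eq)
  also have "degree (\<Prod>k=1..N. [:- (x k)\<^sup>2, 0, 1:]) = (\<Sum>k=1..N. degree [:- (x k)\<^sup>2, 0, 1:])"
    by (subst degree_prod_eq_sum_degree) auto
  also have "\<dots> = 2 * N" by simp
  finally have degq: "degree ?q = 2 * N + d" by simp
  have leadq: "lead_coeff ?q = 1"
    by (simp only: lead_coeff_mult lead_coeff_monom lead_coeff_prod) simp
  have xp: "x k > 0" "poly p (x k) = 0" if "k \<in> {1..N}" for k
    using bij_betw_apply[OF x that] by auto
  have inj: "inj_on x {1..N}" using x by (simp add: bij_betw_def)
  define Z where "Z = x ` {1..N} \<union> (\<lambda>k. - x k) ` {1..N} \<union> (if d = 1 then {0} else {})"
  have "card Z = 2 * N + d"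
  proof -
    have "card (x ` {1..N}) = N" using inj by (simp add: card_image)
    moreover have "card ((\<lambda>k. - x k) ` {1..N}) = N"
    proof (subst card_image)
      show "inj_on (\<lambda>k. - x k) {1..N}"
        using inj_onD[OF inj] by (intro inj_onI) (simp only: neg_equal_iff_equal)
    qed simp
    moreover have "x ` {1..N} \<inter> (\<lambda>k. - x k) ` {1..N} = {}"
    proof (rule equals0I)
      fix y assume "y \<in> x ` {1..N} \<inter> (\<lambda>k. - x k) ` {1..N}"
      then obtain i j where "i \<in> {1..N}" "y = x i" "j \<in> {1..N}" "y = - x j" by blast
      then show False using xp(1)[of i] xp(1)[of j] by simp
    qed
    ultimately have 2: "card (x ` {1..N} \<union> (\<lambda>k. - x k) ` {1..N}) = 2 * N"
      by (subst card_Un_disjoint) simp_all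
    have 0: "0 \<notin> x ` {1..N} \<union> (\<lambda>k. - x k) ` {1..N}"
    proof
      assume "0 \<in> x ` {1..N} \<union> (\<lambda>k. - x k) ` {1..N}"
      then obtain i where "i \<in> {1..N}" "x i = 0" by force
      then show False using xp(1)[of i] by simp
    qed
    show ?thesis
    proof (cases "d = 1")
      case True
      then have "Z = insert 0 (x ` {1..N} \<union> (\<lambda>k. - x k) ` {1..N})" by (simp add: Z_def)
      moreover have "finite (x ` {1..N} \<union> (\<lambda>k. - x k) ` {1..N})" by simp
      ultimately show ?thesis using 0 2 True by (simp only: card_insert_disjoint) simp
    next
      case False
      then have "Z = x ` {1..N} \<union> (\<lambda>k. - x k) ` {1..N}" by (simp add: Z_def)
      with 2 False d show ?thesis by simp
    qed
  qed
  have p0: "poly p z = 0" if "z \<in> Z" for z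
  proof -
    from that consider k where "k \<in> {1..N}" "z = x k" | k where "k \<in> {1..N}" "z = - x k" | "d = 1" "z = 0"
      by (auto simp: Z_def split: if_splits)
    then show ?thesis
      using xp parity[of z] by cases (auto simp: parity)
  qed
  have q0: "poly ?q z = 0" if "z \<in> Z" for z
  proof -
    have sq: "poly ?q z = 0" if "k \<in> {1..N}" "z\<^sup>2 = (x k)\<^sup>2" for k
    proof -
      have "(\<Prod>k=1..N. poly [:- (x k)\<^sup>2, 0, 1:] z) = 0"
        using that by (intro prod_zero) (auto simp: power2_eq_square)
      then show ?thesis by (simp only: poly_mult poly_prod mult_zero_right)
    qed
    from that consider k where "k \<in> {1..N}" "z = x k" | k where "k \<in> {1..N}" "z = - x k" | "d = 1" "z = 0"
      by (auto simp: Z_def split: if_splits)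
    then show ?thesis
    proof cases
      case (1 k)
      then show ?thesis by (intro sq) auto
    next
      case (2 k)
      then show ?thesis by (intro sq) auto
    next
      case 3
      then show ?thesis by (simp add: poly_monom)
    qed
  qed
  show ?thesis
  proof (rule ccontr)
    assume "p \<noteq> ?q"
    then have ne: "p - ?q \<noteq> 0" by simp
    have "degree (p - ?q) \<le> 2 * N + d" using deg degq by (intro degree_diff_le) auto
    moreover have "coeff (p - ?q) (2 * N + d) = 0" using lead leadq deg degq by simp
    ultimately have "degree (p - ?q) < 2 * N + d"
      using ne leading_coeff_neq_0[OF ne] by (cases "degree (p - ?q) = 2 * N + d") auto
    moreover have "Z \<subseteq> {z. poly (p - ?q) z = 0}" using p0 q0 by auto
    then have "card Z \<le> card {z. poly (p - ?q) z = 0}"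
      using ne by (intro card_mono poly_roots_finite)
    moreover have "card {z. poly (p - ?q) z = 0} \<le> degree (p - ?q)"
      using ne by (rule card_poly_roots_bound)
    ultimately show False using \<open>card Z = 2 * N + d\<close> by simp
  qed
qed

text \<open>The knot 0 is left out: scaling fixes it, \<open>nspline\<close> inserts it again, and
  the products 1 + q/a run over the other knots.\<close>

definition scaled_knots :: "(nat \<Rightarrow> real) \<Rightarrow> (nat \<Rightarrow> real) \<Rightarrow> (nat \<Rightarrow> nat \<Rightarrow> real) \<Rightarrow> nat \<Rightarrow> real set" where
  "scaled_knots \<beta> u x N = (*) ((\<beta> N)\<^sup>2) ` ({(u N)\<^sup>2} \<union> (\<lambda>k. (x N k)\<^sup>2) ` {1..N})"

text \<open>On the imaginary axis the normalized polynomial is z^d times the real product, and the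
  shifted cosine is z^d times \<open>cosh_like d q\<close>. Dividing the defining estimate by s^d
  leaves an error of order \<open>\<delta> N\<close>; for fixed q the restriction to the disc of
  radius \<open>\<gamma> N\<close> holds eventually.\<close>

lemma class_P_prod_tendsto:
  assumes d: "d \<in> {0, 1}" and P: "P \<in> class_P d \<beta> \<gamma> \<delta>"
    and x: "\<And>N. N \<ge> 1 \<Longrightarrow> bij_betw (x N) {1..N} {\<xi>. \<xi> > 0 \<and> poly (P N) \<xi> = 0}"
    and q: "q > 0"
  shows "(\<lambda>N. \<Prod>k=1..N. 1 + q / ((\<beta> N)\<^sup>2 * (x N k)\<^sup>2)) \<longlonglongrightarrow> cosh_like d q"
proof -
  define s where "s = sqrt q"
  have s: "s > 0" "s\<^sup>2 = q" using q by (auto simp: s_def)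
  define z where "z = \<i> * complex_of_real s"
  have cz: "cmod z = s" using s by (simp add: z_def norm_mult)
  from P obtain C where C: "\<And>N w. N \<ge> 1 \<Longrightarrow> cmod w \<le> \<gamma> N \<Longrightarrow>
        cmod (complex_of_real (\<beta> N) ^ d
                * poly (map_poly complex_of_real (P N)) (w / complex_of_real (\<beta> N))
                / complex_of_real (poly ((pderiv ^^ d) (P N)) 0)
              - cos (w - complex_of_real (real d * pi / 2)))
        \<le> C * \<delta> N * min ((cmod w)\<^sup>2) 1 * h d (cmod w)"
    unfolding class_P_def mem_Collect_eq by blast
  from P have adm: "admissible_scales \<beta> \<gamma> \<delta>" and PN: "\<And>N. N \<ge> 1 \<Longrightarrow> degree (P N) = 2 * N + d \<and> lead_coeff (P N) = 1 \<and>
             (\<forall>x. poly (P N) (- x) = (-1) ^ d * poly (P N) x)"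
    unfolding class_P_def by auto
  from adm have \<beta>: "\<And>N. N \<ge> 1 \<Longrightarrow> \<beta> N > 0" and \<gamma>: "filterlim \<gamma> at_top sequentially"
    and \<delta>: "filterlim (\<lambda>N. inverse (\<delta> N)) at_top sequentially"
    unfolding admissible_scales_def by auto
  have \<delta>0: "\<delta> \<longlonglongrightarrow> 0" using tendsto_inverse_0_at_top[OF \<delta>] by simp
  define G where "G = (\<lambda>N. \<Prod>k=1..N. 1 + q / ((\<beta> N)\<^sup>2 * (x N k)\<^sup>2))"
  have bound: "\<bar>G N - cosh_like d q\<bar> \<le> C * \<delta> N * min (s\<^sup>2) 1 * h d s / s ^ d" if N: "N \<ge> 1" "s \<le> \<gamma> N" for N
  proof -
    have xp: "x N k > 0" if "k \<in> {1..N}" for k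
      using bij_betw_apply[OF x[OF N(1)] that] by auto
    have fac: "P N = monom 1 d * (\<Prod>k=1..N. [:- (x N k)\<^sup>2, 0, 1:])"
      using PN[OF N(1)] x[OF N(1)] d by (intro parity_poly_factorization) auto
    \<comment> \<open>The value at 0 of the even factor of \<open>P N\<close>. For d = 1 it is also
      the derivative of \<open>P N\<close> at 0, by the product rule.\<close>
    define X where "X = (\<Prod>k=1..N. - (x N k)\<^sup>2)"
    have X0: "X \<noteq> 0" using xp by (force simp: X_def)
    have der: "poly ((pderiv ^^ d) (P N)) 0 = X"
      using d unfolding fac X_def
      by (auto simp: poly_prod poly_monom monom_0 pderiv_mult pderiv_monom)
    have "poly (map_poly complex_of_real (P N)) w = w ^ d * (\<Prod>k=1..N. w\<^sup>2 - of_real ((x N k)\<^sup>2))" for w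
      unfolding fac map_poly_of_real_mult map_poly_of_real_prod poly_mult poly_prod
      by (simp add: poly_monom map_poly_monom map_poly_pCons power2_eq_square)
    then have "poly (map_poly complex_of_real (P N)) (z / of_real (\<beta> N))
       = (z / of_real (\<beta> N)) ^ d * (\<Prod>k=1..N. (z / of_real (\<beta> N))\<^sup>2 - of_real ((x N k)\<^sup>2))" .
    also have "(\<Prod>k=1..N. (z / of_real (\<beta> N))\<^sup>2 - of_real ((x N k)\<^sup>2)) = of_real (G N * X)"
    proof -
      have "(z / of_real (\<beta> N))\<^sup>2 - of_real ((x N k)\<^sup>2) = of_real ((1 + q / ((\<beta> N)\<^sup>2 * (x N k)\<^sup>2)) * - (x N k)\<^sup>2)"
        if "k \<in> {1..N}" for k
      proof -
        have "z\<^sup>2 = - of_real q" using s by (simp add: z_def power_mult_distrib flip: of_real_power)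
        then have "(z / of_real (\<beta> N))\<^sup>2 - of_real ((x N k)\<^sup>2) = of_real (- q / (\<beta> N)\<^sup>2 - (x N k)\<^sup>2)"
          by (simp add: power_divide)
        also have "- q / (\<beta> N)\<^sup>2 - (x N k)\<^sup>2 = (1 + q / ((\<beta> N)\<^sup>2 * (x N k)\<^sup>2)) * - (x N k)\<^sup>2"
          using xp[OF that] \<beta>[OF N(1)] by (simp add: field_simps)
        finally show ?thesis .
      qed
      then have "(\<Prod>k=1..N. (z / of_real (\<beta> N))\<^sup>2 - of_real ((x N k)\<^sup>2))
          = (\<Prod>k=1..N. of_real ((1 + q / ((\<beta> N)\<^sup>2 * (x N k)\<^sup>2)) * - (x N k)\<^sup>2))"
        by (intro prod.cong) auto
      also have "\<dots> = of_real (G N * X)"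
        unfolding G_def X_def by (simp only: of_real_prod prod.distrib flip: of_real_prod)
      finally show ?thesis .
    qed
    finally have "complex_of_real (\<beta> N) ^ d * poly (map_poly complex_of_real (P N)) (z / complex_of_real (\<beta> N))
        / complex_of_real (poly ((pderiv ^^ d) (P N)) 0) = z ^ d * of_real (G N)"
      using X0 \<beta>[OF N(1)] unfolding der by (simp add: power_divide)
    moreover have "cos (z - complex_of_real (real d * pi / 2)) = z ^ d * of_real (cosh_like d q)"
    proof (cases "d = 0")
      case True
      then show ?thesis by (simp add: z_def s_def cosh_like_def cos_i_times_of_real)
    next
      case False
      with d have d: "d = 1" by simp
      have "cos (z - complex_of_real (pi / 2)) = sin z"
        by (simp only: cos_diff cos_of_real sin_of_real cos_pi_half sin_pi_half) simp
      also have "\<dots> = z * of_real (sinh s / s)" using s by (simp add: z_def sin_i_times_of_real)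
      finally show ?thesis by (simp add: d cosh_like_def s_def)
    qed
    ultimately have "cmod (z ^ d * of_real (G N - cosh_like d q)) \<le> C * \<delta> N * min (s\<^sup>2) 1 * h d s"
      using C[of N z] N by (simp add: cz right_diff_distrib)
    then have "s ^ d * \<bar>G N - cosh_like d q\<bar> \<le> C * \<delta> N * min (s\<^sup>2) 1 * h d s"
      by (simp only: norm_mult norm_power cz norm_of_real)
    then show ?thesis using s by (simp add: field_simps)
  qed
  have "(\<lambda>N. G N - cosh_like d q) \<longlonglongrightarrow> 0"
  proof (rule Lim_null_comparison)
    show "\<forall>\<^sub>F N in sequentially. norm (G N - cosh_like d q) \<le> C * \<delta> N * min (s\<^sup>2) 1 * h d s / s ^ d"
      using eventually_ge_at_top[of 1] filterlim_at_top[THEN iffD1, OF \<gamma>, rule_format, of s]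
      by eventually_elim (simp add: bound)
    have "(\<lambda>N. C * \<delta> N * min (s\<^sup>2) 1 * h d s / s ^ d) \<longlonglongrightarrow> C * 0 * min (s\<^sup>2) 1 * h d s / s ^ d"
      using s by (intro tendsto_intros \<delta>0) auto
    then show "(\<lambda>N. C * \<delta> N * min (s\<^sup>2) 1 * h d s / s ^ d) \<longlonglongrightarrow> 0" by simp
  qed
  then show ?thesis unfolding G_def by (rule LIM_zero_cancel)
qed

section \<open>Scaled knots and their products\<close>

context
  fixes d :: nat and P :: "nat \<Rightarrow> real poly" and x :: "nat \<Rightarrow> nat \<Rightarrow> real" and \<beta> \<gamma> \<delta> u :: "nat \<Rightarrow> real"
  assumes d: "d \<in> {0, 1}" and P: "P \<in> class_P d \<beta> \<gamma> \<delta>"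
    and x: "\<And>N. N \<ge> 1 \<Longrightarrow> bij_betw (x N) {1..N} {\<xi>. \<xi> > 0 \<and> poly (P N) \<xi> = 0}"
    and u: "\<And>N. N \<ge> 1 \<Longrightarrow> u N > 0" "\<And>N. N \<ge> 1 \<Longrightarrow> u N \<notin> x N ` {1..N}"
begin

lemma beta_pos: "N \<ge> 1 \<Longrightarrow> \<beta> N > 0"
  using P unfolding class_P_def admissible_scales_def by auto

lemma x_pos: "N \<ge> 1 \<Longrightarrow> k \<in> {1..N} \<Longrightarrow> x N k > 0"
  using bij_betw_apply[OF x] by blast

lemma knot_squares:
  assumes N: "N \<ge> 1"
  shows "inj_on (\<lambda>k. (x N k)\<^sup>2) {1..N}" "(u N)\<^sup>2 \<notin> (\<lambda>k. (x N k)\<^sup>2) ` {1..N}"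
proof -
  have inj: "inj_on (x N) {1..N}" using x[OF N] by (simp add: bij_betw_def)
  show "inj_on (\<lambda>k. (x N k)\<^sup>2) {1..N}"
  proof (rule inj_onI)
    fix k l assume kl: "k \<in> {1..N}" "l \<in> {1..N}" "(x N k)\<^sup>2 = (x N l)\<^sup>2"
    then have "x N k = x N l"
      using x_pos[OF N kl(1)] x_pos[OF N kl(2)] by (simp add: power2_eq_iff_nonneg)
    then show "k = l" using inj_onD[OF inj] kl by blast
  qed
  show "(u N)\<^sup>2 \<notin> (\<lambda>k. (x N k)\<^sup>2) ` {1..N}"
  proof
    assume "(u N)\<^sup>2 \<in> (\<lambda>k. (x N k)\<^sup>2) ` {1..N}"
    then obtain k where k: "k \<in> {1..N}" "(u N)\<^sup>2 = (x N k)\<^sup>2" by auto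
    then have "u N = x N k" using x_pos[OF N k(1)] u(1)[OF N] by (simp add: power2_eq_iff_nonneg)
    with k u(2)[OF N] show False by blast
  qed
qed

lemma knot_square_pos:
  assumes "N \<ge> 1" "b \<in> {(u N)\<^sup>2} \<union> (\<lambda>k. (x N k)\<^sup>2) ` {1..N}"
  shows "b > 0"
proof -
  from assms(2) consider "b = (u N)\<^sup>2" | k where "k \<in> {1..N}" "b = (x N k)\<^sup>2" by blast
  then show ?thesis
    by cases (use u(1)[OF assms(1)] x_pos[OF assms(1)] in \<open>simp_all only: zero_less_power\<close>)
qed

lemma prod_over_knots:
  assumes N: "N \<ge> 1"
  shows "(\<Prod>a\<in>{(u N)\<^sup>2} \<union> (\<lambda>k. (x N k)\<^sup>2) ` {1..N}. f a) = f ((u N)\<^sup>2) * (\<Prod>k=1..N. f ((x N k)\<^sup>2))"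
  using knot_squares[OF N] by (simp add: prod.reindex)

lemma scaled_knots:
  assumes N: "N \<ge> 1"
  shows "finite (scaled_knots \<beta> u x N)" "card (scaled_knots \<beta> u x N) = N + 1"
    "\<And>a. a \<in> scaled_knots \<beta> u x N \<Longrightarrow> a > 0"
proof -
  have inj: "inj_on ((*) ((\<beta> N)\<^sup>2)) A" for A using beta_pos[OF N] by (auto simp: inj_on_def)
  show "finite (scaled_knots \<beta> u x N)" by (simp add: scaled_knots_def)
  show "card (scaled_knots \<beta> u x N) = N + 1"
    unfolding scaled_knots_def card_image[OF inj] using knot_squares[OF N] by (simp add: card_image)
  show "a > 0" if "a \<in> scaled_knots \<beta> u x N" for a
  proof -
    from that obtain b where b: "a = (\<beta> N)\<^sup>2 * b" "b \<in> {(u N)\<^sup>2} \<union> (\<lambda>k. (x N k)\<^sup>2) ` {1..N}"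
      unfolding scaled_knots_def by blast
    then show ?thesis using beta_pos[OF N] knot_square_pos[OF N] by simp
  qed
qed

text \<open>The extra knot contributes the single factor 1 + q/(\<beta> u)^2. Since \<beta> u tends
  to infinity this factor tends to 1, so u leaves no trace in the limit.\<close>

lemma scaled_knots_prod_tendsto:
  assumes bu: "filterlim (\<lambda>N. \<beta> N * u N) at_top sequentially" and q: "q > 0"
  shows "(\<lambda>N. \<Prod>a\<in>scaled_knots \<beta> u x N. 1 + q / a) \<longlonglongrightarrow> cosh_like d q"
proof -
  have eq: "(\<Prod>a\<in>scaled_knots \<beta> u x N. 1 + q / a)
      = (1 + q / (\<beta> N * u N)\<^sup>2) * (\<Prod>k=1..N. 1 + q / ((\<beta> N)\<^sup>2 * (x N k)\<^sup>2))" if N: "N \<ge> 1" for N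
  proof -
    have inj: "inj_on ((*) ((\<beta> N)\<^sup>2)) A" for A using beta_pos[OF N] by (auto simp: inj_on_def)
    show ?thesis
      unfolding scaled_knots_def prod.reindex[OF inj] o_def
      by (simp only: prod_over_knots[OF N] power_mult_distrib)
  qed
  have "filterlim (\<lambda>N. (\<beta> N * u N)\<^sup>2) at_top sequentially"
    using bu by (intro filterlim_pow_at_top) auto
  then have "(\<lambda>N. q / (\<beta> N * u N)\<^sup>2) \<longlonglongrightarrow> 0"
    by (intro tendsto_divide_0[OF tendsto_const] filterlim_at_top_imp_at_infinity)
  then have "(\<lambda>N. (1 + q / (\<beta> N * u N)\<^sup>2) * (\<Prod>k=1..N. 1 + q / ((\<beta> N)\<^sup>2 * (x N k)\<^sup>2))) \<longlonglongrightarrow> (1 + 0) * cosh_like d q"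
    by (intro tendsto_intros class_P_prod_tendsto[OF d P x q])
  then show ?thesis
    by (rule Lim_transform_eventually[THEN tendsto_eq_rhs]) (auto intro!: eventually_sequentiallyI[of 1] simp: eq)
qed

lemma normalized_bspline_eq:
  assumes N: "N \<ge> 1" and t: "t > 0"
  shows "(u N)\<^sup>2 * (\<Prod>k=1..N. (x N k)\<^sup>2) / real N * assoc_bspline N (real N / (\<beta> N)\<^sup>2 * t) (knots u x N)
     = nspline N (scaled_knots \<beta> u x N) (1 / t)"
proof -
  let ?S = "{(u N)\<^sup>2} \<union> (\<lambda>k. (x N k)\<^sup>2) ` {1..N}"
  have "knots u x N = insert 0 ?S" by (simp add: knots_def)
  moreover have "(\<Prod>a\<in>?S. a) = (u N)\<^sup>2 * (\<Prod>k=1..N. (x N k)\<^sup>2)" by (rule prod_over_knots[OF N])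
  moreover have "0 \<notin> ?S"
    using knot_square_pos[OF N, of 0] by blast
  moreover have "card ?S = N + 1"
    using knot_squares[OF N] by (simp add: card_image)
  ultimately show ?thesis
    using assoc_bspline_eq[of ?S N "(\<beta> N)\<^sup>2" t] N t beta_pos[OF N] by (simp add: scaled_knots_def)
qed

end

subsection \<open>Pointwise convergence and uniform decay\<close>

lemma coeff_prod_nonneg:
  fixes p :: "'a \<Rightarrow> real poly"
  assumes "\<And>a i. a \<in> S \<Longrightarrow> coeff (p a) i \<ge> 0"
  shows "coeff (\<Prod>a\<in>S. p a) i \<ge> 0"
  using assms
proof (induction S arbitrary: i rule: infinite_finite_induct)
  case (insert a S)
  then show ?case
    by (auto simp: coeff_mult intro!: sum_nonneg mult_nonneg_nonneg)
qed (auto simp: coeff_1)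

text \<open>At T the terms of degree below M add up to at most C T^M, so those of degree at least M
  already reach T^M. Passing from T to t multiplies each of the latter by at least (t/T)^M.\<close>

lemma poly_nonneg_coeffs_ge_power:
  fixes p :: "real poly"
  assumes nn: "\<And>i. coeff p i \<ge> 0" and T: "T \<ge> 1"
    and 1: "poly p 1 \<le> C" and pT: "poly p T \<ge> (C + 1) * T ^ M" and t: "t \<ge> T"
  shows "poly p t \<ge> t ^ M"
proof -
  define n where "n = max (degree p) M"
  have p_eq: "poly p z = (\<Sum>i\<le>n. coeff p i * z ^ i)" for z
    unfolding poly_altdef by (rule sum.mono_neutral_left) (auto simp: n_def coeff_eq_0)
  have split: "(\<Sum>i\<le>n. coeff p i * z ^ i) = (\<Sum>i<M. coeff p i * z ^ i) + (\<Sum>i=M..n. coeff p i * z ^ i)" for z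
  proof -
    have "{..n} = {..<M} \<union> {M..n}" by (auto simp: n_def)
    then show ?thesis by (simp add: sum.union_disjoint ivl_disj_int)
  qed
  have "(\<Sum>i<M. coeff p i * T ^ i) \<le> (\<Sum>i<M. coeff p i * T ^ M)"
    using nn T by (intro sum_mono mult_left_mono power_increasing) auto
  also have "\<dots> = (\<Sum>i<M. coeff p i * 1 ^ i) * T ^ M" by (simp add: sum_distrib_right)
  also have "\<dots> \<le> C * T ^ M"
  proof (intro mult_right_mono)
    have "(\<Sum>i=M..n. coeff p i * 1 ^ i) \<ge> 0" using nn by (intro sum_nonneg) auto
    then show "(\<Sum>i<M. coeff p i * 1 ^ i) \<le> C" using 1 unfolding p_eq split by linarith
  qed (use T in auto)
  finally have low: "(\<Sum>i=M..n. coeff p i * T ^ i) \<ge> T ^ M"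
    using pT unfolding p_eq split by (simp add: algebra_simps)
  have t0: "t > 0" "T > 0" using T t by auto
  have "t ^ M = (t / T) ^ M * T ^ M" using t0 by (simp add: power_divide)
  also have "\<dots> \<le> (t / T) ^ M * (\<Sum>i=M..n. coeff p i * T ^ i)"
    using low t0 by (intro mult_left_mono) auto
  also have "\<dots> = (\<Sum>i=M..n. coeff p i * ((t / T) ^ M * T ^ i))"
    by (simp add: sum_distrib_left mult_ac)
  also have "\<dots> \<le> (\<Sum>i=M..n. coeff p i * ((t / T) ^ i * T ^ i))"
    using nn t t0 by (intro sum_mono mult_left_mono mult_right_mono power_increasing) auto
  also have "\<dots> = (\<Sum>i=M..n. coeff p i * t ^ i)"
    using t0 by (simp add: power_divide)
  also have "\<dots> \<le> poly p t"
  proof -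
    have "(\<Sum>i<M. coeff p i * t ^ i) \<ge> 0" using nn t0 by (intro sum_nonneg mult_nonneg_nonneg) auto
    then show ?thesis unfolding p_eq split by simp
  qed
  finally show ?thesis .
qed

text \<open>The witness is T = s^2 with s \<ge> 1, where both variants are at least sinh s / s. The
  odd exponent 2M + 1 pays for the division by s, and the factor 4 (|K| + 1) for the 2 in sinh and
  for the term exp (- s).\<close>

lemma cosh_like_superpolynomial:
  "\<exists>T\<ge>1. cosh_like d T \<ge> K * T ^ M"
proof -
  have "((\<lambda>s::real. s ^ (2 * M + 1) / exp s) \<longlongrightarrow> 0) at_top" by (rule tendsto_power_div_exp_0)
  then have "\<forall>\<^sub>F s in at_top. (s::real) ^ (2 * M + 1) / exp s < 1 / (4 * (\<bar>K\<bar> + 1))"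
    by (rule order_tendstoD) simp
  then have "\<forall>\<^sub>F s::real in at_top. s \<ge> 1 \<and> s ^ (2 * M + 1) / exp s < 1 / (4 * (\<bar>K\<bar> + 1))"
    using eventually_ge_at_top[of 1] by eventually_elim auto
  then obtain s :: real where s: "s \<ge> 1" "s ^ (2 * M + 1) / exp s < 1 / (4 * (\<bar>K\<bar> + 1))"
    by (auto dest!: eventually_happens)
  then have big: "4 * (\<bar>K\<bar> + 1) * s ^ (2 * M + 1) < exp s"
    by (simp add: field_simps)
  have K: "K * s ^ (2 * M) \<le> \<bar>K\<bar> * s ^ (2 * M)" using s by (intro mult_right_mono) auto
  have e: "exp (- s) \<le> 1" using s by simp
  have p1: "s ^ (2 * M) \<ge> 1" using s by (intro one_le_power)
  have ps: "s ^ (2 * M) \<le> s ^ (2 * M + 1)" using s by (intro power_increasing) auto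
  have "cosh_like d (s\<^sup>2) \<ge> K * s ^ (2 * M)"
  proof -
    have sinh: "sinh s / s \<ge> K * s ^ (2 * M)"
    proof -
      have "2 * (K * s ^ (2 * M)) * s \<le> 2 * (\<bar>K\<bar> * s ^ (2 * M)) * s"
        using K s by (intro mult_right_mono) auto
      also have "\<dots> \<le> 4 * (\<bar>K\<bar> + 1) * s ^ (2 * M + 1) - s ^ (2 * M + 1)"
        using s by (simp add: algebra_simps)
      also have "\<dots> \<le> exp s - exp (- s)" using big ps p1 e by linarith
      finally have "K * s ^ (2 * M) * s \<le> sinh s" by (simp add: sinh_field_def)
      then show ?thesis using s by (simp add: field_simps)
    qed
    have "sinh s / s \<le> cosh s"
    proof -
      have "sinh s \<le> cosh s" by (simp add: sinh_field_def cosh_field_def)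
      also have "cosh s * 1 \<le> cosh s * s" using s by (intro mult_left_mono) (auto simp: cosh_real_nonneg)
      finally show ?thesis using s by (simp add: field_simps)
    qed
    with sinh show ?thesis using s by (simp add: cosh_like_def)
  qed
  moreover have "(s\<^sup>2) ^ M = s ^ (2 * M)" by (simp add: power_mult)
  moreover have "s\<^sup>2 \<ge> 1" using s by simp
  ultimately show ?thesis by (intro exI[of _ "s\<^sup>2"]) simp
qed

text \<open>\<open>q \<mapsto> \<Prod>a. 1 + q / a\<close> has nonnegative coefficients, so its values at \<open>1\<close> and at a single
  large \<open>T\<close> already bound it from below by a power on all of \<open>[T, \<infinity>)\<close>.\<close>

lemma nspline_eventually_le_power:
  assumes S: "\<And>N. N \<ge> 1 \<Longrightarrow> finite (S N) \<and> card (S N) = N + 1 \<and> (\<forall>a\<in>S N. a > 0)"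
    and lim: "\<And>q. q > 0 \<Longrightarrow> (\<lambda>N. \<Prod>a\<in>S N. 1 + q / a) \<longlonglongrightarrow> cosh_like d q"
  shows "\<exists>T\<ge>1. \<forall>\<^sub>F N in sequentially. \<forall>t\<ge>T. nspline N (S N) (1 / t) \<le> 12 / t ^ M"
proof -
  \<comment> \<open>The summand 1 makes C a strict upper bound for the products at 1 from some N on.
    Likewise C + 2 instead of C + 1 in the choice of T leaves the slack T^M, so that the limit
    inequality at T passes to large N.\<close>
  define C where "C = cosh_like d 1 + 1"
  obtain T where T: "T \<ge> 1" "cosh_like d T \<ge> (C + 2) * T ^ M"
    using cosh_like_superpolynomial by blast
  have C0: "C + 1 \<ge> 0" by (simp add: C_def cosh_like_def cosh_real_nonneg)
  have "1 \<le> T ^ M" using T by (intro one_le_power)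
  moreover have "(C + 2) * T ^ M = (C + 1) * T ^ M + T ^ M" by (simp add: algebra_simps)
  ultimately have T2: "cosh_like d T > (C + 1) * T ^ M" using T by linarith
  have "\<forall>\<^sub>F N in sequentially. (\<Prod>a\<in>S N. 1 + 1 / a) < C"
    by (rule order_tendstoD(2)[OF lim]) (auto simp: C_def)
  moreover have "\<forall>\<^sub>F N in sequentially. (\<Prod>a\<in>S N. 1 + T / a) > (C + 1) * T ^ M"
    by (rule order_tendstoD(1)[OF lim T2]) (use T in auto)
  ultimately have "\<forall>\<^sub>F N in sequentially. \<forall>t\<ge>T. nspline N (S N) (1 / t) \<le> 12 / t ^ M"
    using eventually_ge_at_top[of 2]
  proof eventually_elim
    case (elim N)
    show ?case
    proof (intro allI impI)
      fix t assume t: "T \<le> t"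
      have SN: "finite (S N)" "card (S N) = N + 1" "\<And>a. a \<in> S N \<Longrightarrow> a > 0" using S[of N] elim by auto
      define p where "p = (\<Prod>a\<in>S N. [:1, 1 / a:])"
      have pe: "poly p q = (\<Prod>a\<in>S N. 1 + q / a)" for q by (simp add: p_def poly_prod)
      have pnn: "coeff p i \<ge> 0" for i
        unfolding p_def
        by (intro coeff_prod_nonneg) (use SN(3) in \<open>auto simp: coeff_pCons less_imp_le split: nat.split\<close>)
      have "poly p t \<ge> t ^ M"
        using elim t T by (intro poly_nonneg_coeffs_ge_power[OF pnn T(1), where C = C]) (auto simp: pe)
      then have "t ^ M \<le> (\<Prod>a\<in>S N. 1 + t / a)" unfolding pe .
      moreover have "t > 0" using t T by simp
      ultimately have "12 / (\<Prod>a\<in>S N. 1 + t / a) \<le> 12 / t ^ M"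
        by (intro frac_le) auto
      moreover have "nspline N (S N) (1 / t) \<le> 12 / (\<Prod>a\<in>S N. 1 + t / a)"
        by (rule nspline_le[OF SN]) (use \<open>t > 0\<close> elim in auto)
      ultimately show "nspline N (S N) (1 / t) \<le> 12 / t ^ M" by linarith
    qed
  qed
  with T(1) show ?thesis by (intro exI[of _ T] conjI)
qed

text \<open>Bounds all the kernels by one integrable function that does not depend on N. Bernoulli's
  inequality is applied with m, the integer part of (N + 2)/3: then 3m \<ge> N gives the slope 1/3,
  and 3m \<le> N + 2 keeps the power within the exponent.\<close>

lemma power_kernel_le:
  assumes "N \<ge> 1" "z \<ge> 0"
  shows "(1 + z / 3) ^ 3 \<le> (1 + z / real N) ^ (N + 2)"
proof -
  define m where "m = (N + 2) div 3"
  have m: "3 * m \<le> N + 2" "3 * m \<ge> N" by (simp_all add: m_def)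
  have "1 + z / 3 \<le> 1 + real m * (z / real N)"
  proof -
    have "real N \<le> 3 * real m" using m by linarith
    then have "z * real N \<le> z * (3 * real m)" using assms by (intro mult_left_mono)
    then show ?thesis using assms by (simp add: field_simps)
  qed
  also have "\<dots> \<le> (1 + z / real N) ^ m"
  proof (rule Bernoulli_inequality)
    have "0 \<le> z / real N" using assms by simp
    then show "- 1 \<le> z / real N" by linarith
  qed
  finally have "(1 + z / 3) ^ 3 \<le> ((1 + z / real N) ^ m) ^ 3"
    using assms by (intro power_mono) auto
  also have "\<dots> = (1 + z / real N) ^ (3 * m)" by (simp add: power_mult[symmetric] mult.commute)
  also have "\<dots> \<le> (1 + z / real N) ^ (N + 2)"
    using assms m by (intro power_increasing) auto
  finally show ?thesis .
qed

lemma nspline_tendsto_Theta: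
  assumes d: "d \<in> {0, 1}"
    and S: "\<And>N. N \<ge> 1 \<Longrightarrow> finite (S N) \<and> card (S N) = N + 1 \<and> (\<forall>a\<in>S N. a > 0)"
    and lim: "\<And>q. q > 0 \<Longrightarrow> (\<lambda>N. \<Prod>a\<in>S N. 1 + q / a) \<longlonglongrightarrow> cosh_like d q"
    and y: "y > 0"
  shows "(\<lambda>N. nspline N (S N) y) \<longlonglongrightarrow> Theta d (1 / y)"
proof -
  \<comment> \<open>The index is shifted by 2 since the Laplace argument wants monotonicity and the
    bound 2 for every index.\<close>
  define \<phi> where "\<phi> = (\<lambda>n. nspline (n + 2) (S (n + 2)))"
  have S2: "finite (S (n + 2))" "card (S (n + 2)) = (n + 2) + 1" "\<And>a. a \<in> S (n + 2) \<Longrightarrow> a > 0" for n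
    using S[of "n + 2"] by auto
  have meas: "\<phi> n \<in> borel_measurable borel" for n
    unfolding \<phi>_def by (intro borel_measurable_continuous_onI continuous_on_nspline)
  have bound: "\<bar>\<phi> n y\<bar> \<le> 2" if "y > 0" for n y
    using nspline_bounds[OF S2(1)[of n] S2(2)[of n] S2(3), where y = y] that by (simp add: \<phi>_def)
  have "(\<lambda>n. \<phi> n y) \<longlonglongrightarrow> Theta d (1 / y)"
  proof (rule mono_tendsto_of_laplace[OF meas bound])
    show "\<phi> n y \<le> \<phi> n z" if "0 < y" "y \<le> z" for n y z
      unfolding \<phi>_def using that by (intro nspline_mono S2) auto
    show "integrable lborel (\<lambda>y. indicator {0<..} y * (Theta d (1 / y) * exp (- y)))"
      using laplace_Theta[of 1 d] d by (simp add: has_bochner_integral_iff)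
    show "continuous_on {0<..} (\<lambda>y. Theta d (1 / y))"
      by (rule continuous_on_Theta_inverse[OF d])
    show "y > 0" by fact
    fix k :: nat assume "k \<ge> 1"
    define q where "q = real k"
    have q: "q > 0" using \<open>k \<ge> 1\<close> by (simp add: q_def)
    define K where "K = (\<lambda>n y. 1 / (1 + y * q / real (n + 2)) ^ (n + 2 + 2))"
    have I1: "has_bochner_integral lborel (\<lambda>y. indicator {0<..} y * (\<phi> n y * K n y)) (1 / (q * (\<Prod>a\<in>S (n + 2). 1 + q / a)))" for n
      using has_bochner_integral_nspline[OF S2(1)[of n] S2(2)[of n] S2(3) _ q] by (simp add: \<phi>_def K_def)
    have "(\<lambda>n. \<Prod>a\<in>S (n + 2). 1 + q / a) \<longlonglongrightarrow> cosh_like d q"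
      using LIMSEQ_ignore_initial_segment[OF lim[OF q], of 2] .
    moreover have "cosh_like d q > 0"
      using q by (simp add: cosh_like_def)
    ultimately have I1_lim: "(\<lambda>n. \<integral>y. indicator {0<..} y * (\<phi> n y * K n y) \<partial>lborel) \<longlonglongrightarrow> 1 / (q * cosh_like d q)"
      using q I1 by (auto simp: has_bochner_integral_iff intro!: tendsto_intros)
    have e_int: "integrable lborel (\<lambda>y. indicator {0<..} y * exp (- (q * y)))"
      using has_bochner_integral_exp[OF q] by (simp add: has_bochner_integral_iff)
    \<comment> \<open>The integral of the kernel with N = 1, a = 0 and p = q/3, whose exponent N + 2
      is 3.\<close>
    have k_int: "integrable lborel (\<lambda>y. indicator {0<..} y * (1 / (1 + y * q / 3) ^ 3))"
      using has_bochner_integral_kernel[of 1 0 "q / 3" 0] q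
      by (simp add: has_bochner_integral_iff numeral_3_eq_3)
    have K_le: "0 \<le> K n y" "K n y \<le> 1 / (1 + y * q / 3) ^ 3" if "y > 0" for n y
    proof -
      have "(1 + y * q / 3) ^ 3 > 0" using that q by (intro zero_less_power add_pos_pos) auto
      then show "0 \<le> K n y" "K n y \<le> 1 / (1 + y * q / 3) ^ 3"
        using power_kernel_le[of "n + 2" "y * q"] that q
        by (auto simp: K_def intro!: divide_left_mono mult_pos_pos zero_less_power add_pos_nonneg)
    qed
    have K_lim: "(\<lambda>n. K n y) \<longlonglongrightarrow> exp (- (q * y))" for y
    proof -
      have "(\<lambda>n. (1 + (y * q) / real n) ^ n * (1 + (y * q) / real n)\<^sup>2) \<longlonglongrightarrow> exp (y * q) * (1 + 0)\<^sup>2"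
        by (intro tendsto_intros tendsto_exp_limit_sequentially lim_const_over_n)
      then have "(\<lambda>n. 1 / ((1 + (y * q) / real n) ^ n * (1 + (y * q) / real n)\<^sup>2)) \<longlonglongrightarrow> 1 / (exp (y * q) * (1 + 0)\<^sup>2)"
        by (rule tendsto_divide[OF tendsto_const]) simp
      then have "(\<lambda>n. 1 / ((1 + (y * q) / real n) ^ (n + 2))) \<longlonglongrightarrow> 1 / exp (y * q)"
        unfolding power_add by simp
      from LIMSEQ_ignore_initial_segment[OF this, of 2]
      show ?thesis by (simp add: K_def exp_minus inverse_eq_divide mult.commute)
    qed
    \<comment> \<open>The error of replacing the rational kernel by its limit
      \<open>exp (- (q * y))\<close>. It vanishes by dominated convergence, because \<phi> is
      bounded by 2 and both kernels have integrable majorants; then the exact rational transforms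
      determine the limit of the Laplace transforms.\<close>
    let ?D = "\<lambda>n y. indicator {0<..} y * (\<phi> n y * (K n y - exp (- (q * y))))"
    let ?w = "\<lambda>y. 2 * (indicator {0<..} y * (1 / (1 + y * q / 3) ^ 3)) + 2 * (indicator {0<..} y * exp (- (q * y)))"
    have K_meas: "K n \<in> borel_measurable borel" for n unfolding K_def by measurable
    have phi_exp_int: "integrable lborel (\<lambda>y. indicator {0<..} y * (\<phi> n y * exp (- (q * y))))" for n
    proof (rule Bochner_Integration.integrable_bound)
      show "integrable lborel (\<lambda>y. 2 * (indicator {0<..} y * exp (- (q * y))))" using e_int by simp
      show "(\<lambda>y. indicator {0<..} y * (\<phi> n y * exp (- (q * y)))) \<in> borel_measurable lborel"
        using meas[of n] by measurable
      show "AE y in lborel. norm (indicator {0<..} y * (\<phi> n y * exp (- (q * y)))) \<le> norm (2 * (indicator {0<..} y * exp (- (q * y))))"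
        using bound[of _ n] by (intro AE_I2) (auto simp: abs_mult split: split_indicator intro!: mult_right_mono)
    qed
    have "(\<lambda>n. \<integral>y. ?D n y \<partial>lborel) \<longlonglongrightarrow> (\<integral>y. 0 \<partial>(lborel :: real measure))"
    proof (rule integral_dominated_convergence)
      show "(\<lambda>y. 0) \<in> borel_measurable (lborel :: real measure)" by simp
      show "?D n \<in> borel_measurable lborel" for n
        using meas[of n] K_meas[of n] by measurable
      show "integrable lborel ?w" using e_int k_int by (intro Bochner_Integration.integrable_add integrable_mult_right) auto
      show "AE y in lborel. (\<lambda>n. ?D n y) \<longlonglongrightarrow> 0"
      proof (intro AE_I2)
        fix y :: real
        show "(\<lambda>n. ?D n y) \<longlonglongrightarrow> 0"
        proof (cases "y > 0")
          case True
          have "(\<lambda>n. 2 * \<bar>K n y - exp (- (q * y))\<bar>) \<longlonglongrightarrow> 2 * \<bar>exp (- (q * y)) - exp (- (q * y))\<bar>"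
            by (intro tendsto_intros K_lim)
          then have "(\<lambda>n. 2 * \<bar>K n y - exp (- (q * y))\<bar>) \<longlonglongrightarrow> 0" by simp
          then show ?thesis
            by (rule Lim_null_comparison[rotated])
               (use bound True in \<open>auto simp: abs_mult intro!: always_eventually mult_right_mono\<close>)
        qed simp
      qed
      show "AE y in lborel. norm (?D n y) \<le> ?w y" for n
      proof (intro AE_I2)
        fix y :: real
        show "norm (?D n y) \<le> ?w y"
        proof (cases "y > 0")
          case True
          have "\<bar>\<phi> n y * (K n y - exp (- (q * y)))\<bar> \<le> 2 * \<bar>K n y - exp (- (q * y))\<bar>"
            unfolding abs_mult using bound[OF True] by (intro mult_right_mono) auto
          also have "\<dots> \<le> 2 * (1 / (1 + y * q / 3) ^ 3 + exp (- (q * y)))"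
            using K_le[OF True, of n] exp_ge_zero[of "- (q * y)"] by (intro mult_left_mono) linarith+
          finally show ?thesis using True by simp
        qed simp
      qed
    qed
    then have D_lim: "(\<lambda>n. \<integral>y. ?D n y \<partial>lborel) \<longlonglongrightarrow> 0" by simp
    have "(\<integral>y. indicator {0<..} y * (\<phi> n y * K n y) \<partial>lborel) - (\<integral>y. ?D n y \<partial>lborel)
        = (\<integral>y. indicator {0<..} y * (\<phi> n y * exp (- (q * y))) \<partial>lborel)" for n
    proof -
      have "integrable lborel (\<lambda>y. indicator {0<..} y * (\<phi> n y * K n y))"
        using I1[of n] by (simp add: has_bochner_integral_iff)
      then have "(\<integral>y. ?D n y \<partial>lborel) = (\<integral>y. indicator {0<..} y * (\<phi> n y * K n y) \<partial>lborel)
          - (\<integral>y. indicator {0<..} y * (\<phi> n y * exp (- (q * y))) \<partial>lborel)"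
        using phi_exp_int[of n] by (subst Bochner_Integration.integral_diff[symmetric]) (auto simp: right_diff_distrib)
      then show ?thesis by simp
    qed
    with tendsto_diff[OF I1_lim D_lim]
    have "(\<lambda>n. \<integral>y. indicator {0<..} y * (\<phi> n y * exp (- (q * y))) \<partial>lborel) \<longlonglongrightarrow> 1 / (q * cosh_like d q)"
      by simp
    also have "1 / (q * cosh_like d q) = (\<integral>y. indicator {0<..} y * (Theta d (1 / y) * exp (- (q * y))) \<partial>lborel)"
      using laplace_Theta[OF q d] by (simp add: has_bochner_integral_iff)
    finally show "(\<lambda>n. \<integral>y. indicator {0<..} y * (\<phi> n y * exp (- (real k * y))) \<partial>lborel)
       \<longlonglongrightarrow> (\<integral>y. indicator {0<..} y * (Theta d (1 / y) * exp (- (real k * y))) \<partial>lborel)"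
      by (simp add: q_def)
  qed
  then have "(\<lambda>n. nspline (n + 2) (S (n + 2)) y) \<longlonglongrightarrow> Theta d (1 / y)" by (simp add: \<phi>_def)
  then show ?thesis by (rule LIMSEQ_offset)
qed

section \<open>Convergence in weighted integral norm\<close>

lemma integrable_powr_near_0:
  assumes "\<sigma> > (0::real)" "T \<ge> 0"
  shows "integrable lborel (\<lambda>t. indicator {0<..T} t * t powr (\<sigma> - 1))"
proof -
  have "(\<lambda>t. t powr (\<sigma> - 1)) absolutely_integrable_on {0<..T}"
    using assms by (intro nonnegative_absolutely_integrable_1 integrable_on_powr_from_0') auto
  then have "integrable (completion lborel) (\<lambda>t. indicator {0<..T} t * t powr (\<sigma> - 1))"
    by (simp add: set_integrable_def)
  then show ?thesis by (subst (asm) integrable_completion) auto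
qed

lemma integrable_powr_at_top:
  assumes "a > (0::real)" "T > 0"
  shows "integrable lborel (\<lambda>t. indicator {T<..} t * t powr (- a - 1))"
proof -
  have "((\<lambda>t. - (t powr (- a) / a)) \<longlongrightarrow> - (0 / a)) at_top"
    using assms by (intro tendsto_minus tendsto_divide tendsto_const tendsto_neg_powr filterlim_ident) auto
  moreover have "((\<lambda>t. - (t powr (- a) / a)) has_real_derivative t powr (- a - 1)) (at t)" if "T \<le> t" for t
  proof -
    have "((\<lambda>t. - (t powr (- a) / a)) has_real_derivative - ((- a) * t powr (- a - 1) / a)) (at t)"
      using that assms by (intro DERIV_minus DERIV_cdivide has_real_derivative_powr) auto
    then show ?thesis using assms by simp
  qed
  ultimately show ?thesis
    using has_bochner_integral_FTC_greaterThan[of "\<lambda>t. t powr (- a - 1)" T "\<lambda>t. - (t powr (- a) / a)" "- (0 / a)"]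
    by (simp add: has_bochner_integral_iff)
qed

lemma borel_measurable_nspline_inverse: "(\<lambda>t. nspline N S (1 / t)) \<in> borel_measurable borel"
  by (rule measurable_compose[OF _ borel_measurable_continuous_onI[OF continuous_on_nspline]]) simp

lemma borel_measurable_Theta:
  assumes "d \<in> {0, 1}"
  shows "(\<lambda>t. indicator {0<..} t * Theta d t) \<in> borel_measurable borel"
proof -
  have "continuous_on {0<..} (\<lambda>t. Theta d (1 / (1 / t)))"
    by (rule continuous_on_compose2[OF continuous_on_Theta_inverse[OF assms], of _ "\<lambda>t. 1 / t"])
       (auto intro!: continuous_intros)
  then have "continuous_on {0<..} (\<lambda>t. Theta d t)" by simp
  then have "(\<lambda>t. indicator {0<..} t *\<^sub>R Theta d t) \<in> borel_measurable borel"
    by (intro borel_measurable_continuous_on_indicator) auto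
  then show ?thesis by simp
qed

text \<open>Dominated convergence with an envelope \<open>H\<close> that does not depend on N: the
  constant 2 up to T, where only \<sigma> > 0 is needed for integrability at 0, and a power decay
  beyond T.\<close>

lemma nspline_Theta_dominated:
  assumes d: "d \<in> {0, 1}"
    and S: "\<And>N. N \<ge> 1 \<Longrightarrow> finite (S N) \<and> card (S N) = N + 1 \<and> (\<forall>a\<in>S N. a > 0)"
    and lim: "\<And>q. q > 0 \<Longrightarrow> (\<lambda>N. \<Prod>a\<in>S N. 1 + q / a) \<longlonglongrightarrow> cosh_like d q"
    and \<sigma>: "\<sigma> > 0"
  shows "integrable lborel (\<lambda>t. indicator {0<..} t * (Theta d t * t powr (\<sigma> - 1)))"
    and "(\<lambda>N. \<integral>t. indicator {0<..} t * (\<bar>nspline N (S N) (1 / t) - Theta d t\<bar> * t powr (\<sigma> - 1)) \<partial>lborel) \<longlonglongrightarrow> 0"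
proof -
  \<comment> \<open>Any M > \<sigma> makes t powr (\<sigma> - 1) / t^M integrable at
    infinity.\<close>
  obtain M :: nat where M: "real M > \<sigma>" using reals_Archimedean2 by blast
  obtain T where T: "T \<ge> 1" "\<forall>\<^sub>F N in sequentially. \<forall>t\<ge>T. nspline N (S N) (1 / t) \<le> 12 / t ^ M"
    using nspline_eventually_le_power[OF S lim, where M = M] by auto
  define H where "H = (\<lambda>t. if t \<le> T then 2 else 12 / t ^ M :: real)"
  define w where "w = (\<lambda>t. 2 * (indicator {0<..T} t * t powr (\<sigma> - 1)) + 12 * (indicator {T<..} t * t powr (- (real M - \<sigma>) - 1)))"
  have w_int: "integrable lborel w"
    unfolding w_def using \<sigma> M T(1)
    by (intro Bochner_Integration.integrable_add integrable_mult_right integrable_powr_near_0 integrable_powr_at_top) auto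
  have w_eq: "H t * t powr (\<sigma> - 1) = w t" if "t > 0" for t
  proof (cases "t \<le> T")
    case False
    have "t powr (- (real M - \<sigma>) - 1) = t powr (\<sigma> - 1) / t ^ M"
      using that by (simp add: powr_diff[symmetric] powr_realpow[symmetric] algebra_simps)
    then show ?thesis using False that by (simp add: H_def w_def)
  qed (use that in \<open>simp add: H_def w_def\<close>)
  obtain n0 where n0: "n0 \<ge> 2" "\<And>N t. N \<ge> n0 \<Longrightarrow> t \<ge> T \<Longrightarrow> nspline N (S N) (1 / t) \<le> 12 / t ^ M"
  proof -
    from T(2) obtain n1 where "\<And>N. N \<ge> n1 \<Longrightarrow> \<forall>t\<ge>T. nspline N (S N) (1 / t) \<le> 12 / t ^ M"
      unfolding eventually_sequentially by blast
    then show thesis using that[of "max n1 2"] by simp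
  qed
  have phi: "0 \<le> nspline N (S N) (1 / t)" "nspline N (S N) (1 / t) \<le> H t" if "N \<ge> n0" "t > 0" for N t
  proof -
    have "finite (S N)" "card (S N) = N + 1" "\<And>a. a \<in> S N \<Longrightarrow> a > 0" using S[of N] that n0(1) by auto
    note b = nspline_bounds[OF this]
    show "0 \<le> nspline N (S N) (1 / t)" using b(1) that n0(1) by simp
    show "nspline N (S N) (1 / t) \<le> H t"
      using b(2)[of "1 / t"] n0(2)[of N t] that n0(1) by (auto simp: H_def)
  qed
  have conv: "(\<lambda>N. nspline N (S N) (1 / t)) \<longlonglongrightarrow> Theta d t" if "t > 0" for t
    using nspline_tendsto_Theta[OF d S lim, of "1 / t"] that by simp
  \<comment> \<open>The nonnegativity and the decay of \<open>Theta\<close> are inherited from the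
    splines as their pointwise limit, rather than estimated from the alternating series.\<close>
  have Th: "0 \<le> Theta d t" "Theta d t \<le> H t" if "t > 0" for t
  proof -
    show "0 \<le> Theta d t"
      by (rule tendsto_lowerbound[OF conv[OF that]]) (use phi(1) that in \<open>auto intro!: eventually_sequentiallyI[of n0]\<close>)
    show "Theta d t \<le> H t"
      by (rule tendsto_upperbound[OF conv[OF that]]) (use phi(2) that in \<open>auto intro!: eventually_sequentiallyI[of n0]\<close>)
  qed
  have diff_le: "\<bar>nspline N (S N) (1 / t) - Theta d t\<bar> \<le> H t" if "N \<ge> n0" "t > 0" for N t
    using phi[OF that] Th[OF that(2)] by (simp add: abs_le_iff)
  note Th_meas = borel_measurable_Theta[OF d]
  note ns_meas = borel_measurable_nspline_inverse
  have D_meas: "(\<lambda>t. indicator {0<..} t * (\<bar>nspline N (S N) (1 / t) - Theta d t\<bar> * t powr (\<sigma> - 1))) \<in> borel_measurable borel" for N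
  proof -
    have "(\<lambda>t. \<bar>indicator {0<..} t * nspline N (S N) (1 / t) - indicator {0<..} t * Theta d t\<bar> * t powr (\<sigma> - 1)) \<in> borel_measurable borel"
      using ns_meas[of N "S N"] Th_meas by measurable
    also have "(\<lambda>t. \<bar>indicator {0<..} t * nspline N (S N) (1 / t) - indicator {0<..} t * Theta d t\<bar> * t powr (\<sigma> - 1))
        = (\<lambda>t. indicator {0<..} t * (\<bar>nspline N (S N) (1 / t) - Theta d t\<bar> * t powr (\<sigma> - 1)))"
      by (auto split: split_indicator)
    finally show ?thesis .
  qed
  have G_meas: "(\<lambda>t. indicator {0<..} t * (Theta d t * t powr (\<sigma> - 1))) \<in> borel_measurable borel"
  proof -
    have "(\<lambda>t. (indicator {0<..} t * Theta d t) * t powr (\<sigma> - 1)) \<in> borel_measurable borel"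
      using Th_meas by measurable
    then show ?thesis by (simp add: mult.assoc)
  qed
  show "integrable lborel (\<lambda>t. indicator {0<..} t * (Theta d t * t powr (\<sigma> - 1)))"
  proof (rule Bochner_Integration.integrable_bound[OF w_int])
    show "AE t in lborel. norm (indicator {0<..} t * (Theta d t * t powr (\<sigma> - 1))) \<le> norm (w t)"
    proof (intro AE_I2)
      fix t :: real
      show "norm (indicator {0<..} t * (Theta d t * t powr (\<sigma> - 1))) \<le> norm (w t)"
      proof (cases "t > 0")
        case True
        then have "norm (indicator {0<..} t * (Theta d t * t powr (\<sigma> - 1))) = Theta d t * t powr (\<sigma> - 1)"
          using Th(1) by (simp add: abs_mult)
        also have "\<dots> \<le> w t" unfolding w_eq[OF True, symmetric] using Th(2)[OF True] by (intro mult_right_mono) auto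
        finally show ?thesis by simp
      qed simp
    qed
  qed (use G_meas in simp)
  have D_bound: "norm (indicator {0<..} t * (\<bar>nspline N (S N) (1 / t) - Theta d t\<bar> * t powr (\<sigma> - 1))) \<le> w t"
    if "N \<ge> n0" for N t
  proof (cases "t > 0")
    case True
    then have "norm (indicator {0<..} t * (\<bar>nspline N (S N) (1 / t) - Theta d t\<bar> * t powr (\<sigma> - 1)))
        = \<bar>nspline N (S N) (1 / t) - Theta d t\<bar> * t powr (\<sigma> - 1)"
      by (simp add: abs_mult)
    also have "\<dots> \<le> w t"
      unfolding w_eq[OF True, symmetric] using diff_le[OF that True] by (intro mult_right_mono) auto
    finally show ?thesis .
  next
    case False
    then show ?thesis by (auto simp: w_def)
  qed
  have "(\<lambda>N. \<integral>t. indicator {0<..} t * (\<bar>nspline (N + n0) (S (N + n0)) (1 / t) - Theta d t\<bar> * t powr (\<sigma> - 1)) \<partial>lborel)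
     \<longlonglongrightarrow> (\<integral>t. 0 \<partial>(lborel :: real measure))"
  proof (rule integral_dominated_convergence[OF _ _ w_int])
    show "AE t in lborel. (\<lambda>N. indicator {0<..} t * (\<bar>nspline (N + n0) (S (N + n0)) (1 / t) - Theta d t\<bar> * t powr (\<sigma> - 1))) \<longlonglongrightarrow> 0"
    proof (intro AE_I2)
      fix t :: real
      show "(\<lambda>N. indicator {0<..} t * (\<bar>nspline (N + n0) (S (N + n0)) (1 / t) - Theta d t\<bar> * t powr (\<sigma> - 1))) \<longlonglongrightarrow> 0"
      proof (cases "t > 0")
        case True
        have "(\<lambda>N. \<bar>nspline (N + n0) (S (N + n0)) (1 / t) - Theta d t\<bar> * t powr (\<sigma> - 1)) \<longlonglongrightarrow> \<bar>Theta d t - Theta d t\<bar> * t powr (\<sigma> - 1)"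
          by (intro tendsto_mult tendsto_rabs tendsto_diff tendsto_const LIMSEQ_ignore_initial_segment[OF conv[OF True]])
        then show ?thesis using True by simp
      qed simp
    qed
    show "AE t in lborel. norm (indicator {0<..} t * (\<bar>nspline (N + n0) (S (N + n0)) (1 / t) - Theta d t\<bar> * t powr (\<sigma> - 1))) \<le> w t" for N
      by (intro AE_I2 D_bound) simp
    show "(\<lambda>t. indicator {0<..} t * (\<bar>nspline (N + n0) (S (N + n0)) (1 / t) - Theta d t\<bar> * t powr (\<sigma> - 1))) \<in> borel_measurable lborel" for N
      using D_meas[of "N + n0"] by simp
  qed simp
  then have "(\<lambda>N. \<integral>t. indicator {0<..} t * (\<bar>nspline (N + n0) (S (N + n0)) (1 / t) - Theta d t\<bar> * t powr (\<sigma> - 1)) \<partial>lborel) \<longlonglongrightarrow> 0"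
    by simp
  then show "(\<lambda>N. \<integral>t. indicator {0<..} t * (\<bar>nspline N (S N) (1 / t) - Theta d t\<bar> * t powr (\<sigma> - 1)) \<partial>lborel) \<longlonglongrightarrow> 0"
    by (rule LIMSEQ_offset)
qed

text \<open>For fixed N the spline vanishes for t > 1/T and is bounded, so only the singularity of
  the weight at 0 is left, and \<sigma> > 0 makes it integrable.\<close>

lemma nspline_powr_integrable:
  assumes S: "finite S" "card S = N + 1" "\<And>a. a \<in> S \<Longrightarrow> a > 0" "N \<ge> 1" and \<sigma>: "\<sigma> > 0"
  shows "integrable lborel (\<lambda>t. indicator {0<..} t * (nspline N S (1 / t) * t powr (\<sigma> - 1)))"
proof -
  obtain C T where C: "T > 0" "\<And>y. y \<ge> 0 \<Longrightarrow> \<bar>nspline N S y\<bar> \<le> C"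
    "\<And>y. 0 \<le> y \<Longrightarrow> y \<le> T \<Longrightarrow> nspline N S y = 0"
    using nspline_bounded[OF S] by blast
  show ?thesis
  proof (rule Bochner_Integration.integrable_bound)
    show "integrable lborel (\<lambda>t. C * (indicator {0<..1/T} t * t powr (\<sigma> - 1)))"
      using \<sigma> C(1) by (intro integrable_mult_right integrable_powr_near_0) auto
    show "(\<lambda>t. indicator {0<..} t * (nspline N S (1 / t) * t powr (\<sigma> - 1))) \<in> borel_measurable lborel"
      using borel_measurable_nspline_inverse[of N S] by measurable
    show "AE t in lborel. norm (indicator {0<..} t * (nspline N S (1 / t) * t powr (\<sigma> - 1)))
        \<le> norm (C * (indicator {0<..1/T} t * t powr (\<sigma> - 1)))"
    proof (intro AE_I2)
      fix t :: real
      show "norm (indicator {0<..} t * (nspline N S (1 / t) * t powr (\<sigma> - 1)))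
        \<le> norm (C * (indicator {0<..1/T} t * t powr (\<sigma> - 1)))"
      proof (cases "t > 0")
        case True
        show ?thesis
        proof (cases "t \<le> 1 / T")
          case le: True
          have "\<bar>nspline N S (1 / t)\<bar> \<le> \<bar>C\<bar>" using C(2)[of "1 / t"] True by simp
          then show ?thesis using True le by (simp add: abs_mult mult_right_mono)
        next
          case False
          then have "1 / t \<le> T" using True C(1) by (simp add: field_simps)
          then show ?thesis using C(3)[of "1 / t"] True by simp
        qed
      qed simp
    qed
  qed
qed

section \<open>Complex exponents and the theorem\<close>

lemma complex_powr_set_integral:
  fixes a :: "real \<Rightarrow> real"
  assumes meas: "(\<lambda>t. indicator {0<..} t * a t) \<in> borel_measurable borel"
    and int: "integrable lborel (\<lambda>t. indicator {0<..} t * (a t * t powr Re w))"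
  shows "set_integrable lborel {0<..} (\<lambda>t. complex_of_real (a t) * complex_of_real t powr w)"
    and "cmod (LINT t:{0<..}|lborel. complex_of_real (a t) * complex_of_real t powr w)
       \<le> (\<integral>t. indicator {0<..} t * (\<bar>a t\<bar> * t powr Re w) \<partial>lborel)"
proof -
  let ?f = "\<lambda>t. indicator {0<..} t *\<^sub>R (complex_of_real (a t) * complex_of_real t powr w)"
  have norm_f: "norm (?f t) = indicator {0<..} t * (\<bar>a t\<bar> * t powr Re w)" for t
    by (cases "t > 0") (simp_all add: norm_mult norm_powr_real_powr)
  \<comment> \<open>Measurability is read off from exp (w ln t). The indicator hides t \<le> 0,
    where the complex power and this formula need not agree.\<close>
  have "?f = (\<lambda>t. complex_of_real (indicator {0<..} t * a t) * exp (w * complex_of_real (ln t)))"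
  proof
    fix t :: real
    show "?f t = complex_of_real (indicator {0<..} t * a t) * exp (w * complex_of_real (ln t))"
      by (cases "t > 0") (simp_all add: powr_def Ln_of_real)
  qed
  also have "\<dots> \<in> borel_measurable lborel"
  proof (rule borel_measurable_times)
    show "(\<lambda>t. complex_of_real (indicator {0<..} t * a t)) \<in> borel_measurable lborel"
      using measurable_compose[OF meas borel_measurable_of_real] by simp
    show "(\<lambda>t. exp (w * complex_of_real (ln t))) \<in> borel_measurable lborel"
      by measurable
  qed
  finally have f_meas: "?f \<in> borel_measurable lborel" .
  show "set_integrable lborel {0<..} (\<lambda>t. complex_of_real (a t) * complex_of_real t powr w)"
    unfolding set_integrable_def
  proof (rule Bochner_Integration.integrable_bound[OF int f_meas])
    show "AE t in lborel. norm (?f t) \<le> norm (indicator {0<..} t * (a t * t powr Re w))"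
      unfolding norm_f by (intro AE_I2) (simp add: abs_mult)
  qed
  have "cmod (\<integral>t. ?f t \<partial>lborel) \<le> (\<integral>t. norm (?f t) \<partial>lborel)"
    by (rule integral_norm_bound)
  then show "cmod (LINT t:{0<..}|lborel. complex_of_real (a t) * complex_of_real t powr w)
       \<le> (\<integral>t. indicator {0<..} t * (\<bar>a t\<bar> * t powr Re w) \<partial>lborel)"
    unfolding set_lebesgue_integral_def norm_f .
qed

theorem theorem6p1:
  fixes d :: nat
    and \<beta> \<gamma> \<delta> u :: "nat \<Rightarrow> real"
    and P :: "nat \<Rightarrow> real poly"
    and x :: "nat \<Rightarrow> nat \<Rightarrow> real"
  assumes "d \<in> {0, 1}"
    and "P \<in> class_P d \<beta> \<gamma> \<delta>"
    and "\<And>N. N \<ge> 1 \<Longrightarrow> bij_betw (x N) {1..N} {\<xi>. \<xi> > 0 \<and> poly (P N) \<xi> = 0}"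
    and "\<And>N. N \<ge> 1 \<Longrightarrow> u N > 0"
    and "\<And>N. N \<ge> 1 \<Longrightarrow> u N \<notin> x N ` {1..N}"
    and "filterlim (\<lambda>N. \<beta> N * u N) at_top sequentially"
  defines "f \<equiv> (\<lambda>N (s::complex) t.
      complex_of_real (assoc_bspline N (real N / (\<beta> N)\<^sup>2 * t) (knots u x N))
        * complex_of_real t powr ((s - of_nat d) / 2 - 1))"
    and "g \<equiv> (\<lambda>(s::complex) t.
      complex_of_real (Theta d t) * complex_of_real t powr ((s - of_nat d) / 2 - 1))"
  defines "F \<equiv> (\<lambda>N s. complex_of_real ((u N)\<^sup>2 * (\<Prod>k=1..N. (x N k)\<^sup>2) / real N)
        * (LINT t:{0<..}|lborel. f N s t))"
    and "G \<equiv> (\<lambda>s. LINT t:{0<..}|lborel. g s t)"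
  shows "(\<forall>s. Re s > real d \<longrightarrow>
            (\<forall>N\<ge>1. set_integrable lborel {0<..} (f N s)) \<and>
            set_integrable lborel {0<..} (g s) \<and>
            (\<lambda>N. F N s) \<longlonglongrightarrow> G s) \<and>
         (\<forall>r > real d. \<forall>K. compact K \<and> K \<subseteq> {s. Re s = r} \<longrightarrow>
            uniform_limit K F G sequentially)"
proof -
  define S where "S = scaled_knots \<beta> u x"
  define A where "A = (\<lambda>N. (u N)\<^sup>2 * (\<Prod>k=1..N. (x N k)\<^sup>2) / real N)"
  define \<psi> where "\<psi> = (\<lambda>N t. nspline N (S N) (1 / t))"
  define E where "E = (\<lambda>r N. \<integral>t. indicator {0<..} t * (\<bar>\<psi> N t - Theta d t\<bar> * t powr ((r - real d) / 2 - 1)) \<partial>lborel)"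
  have knots: "finite (S N)" "card (S N) = N + 1" if "N \<ge> 1" for N
    unfolding S_def by (rule scaled_knots[OF assms(1,2)]; (erule assms(3-5) | fact that))+
  have knots_pos: "a > 0" if "N \<ge> 1" "a \<in> S N" for N a
    by (rule scaled_knots(3)[OF assms(1,2)]; (erule assms(3-5) | fact that[unfolded S_def]))
  have S: "finite (S N) \<and> card (S N) = N + 1 \<and> (\<forall>a\<in>S N. a > 0)" if "N \<ge> 1" for N
    using knots[OF that] knots_pos[OF that] by blast
  have lim: "(\<lambda>N. \<Prod>a\<in>S N. 1 + q / a) \<longlonglongrightarrow> cosh_like d q" if "q > 0" for q
    unfolding S_def
    by (rule scaled_knots_prod_tendsto[OF assms(1,2)]; (erule assms(3-5) | fact assms(6) that))
  have A_pos: "A N \<noteq> 0" if "N \<ge> 1" for N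
  proof -
    have "x N k \<noteq> 0" if "k \<in> {1..N}" for k
      using bij_betw_apply[OF assms(3)[OF \<open>N \<ge> 1\<close>] that] by auto
    then show ?thesis using assms(4)[OF that] that by (simp add: A_def)
  qed
  have Af: "of_real (A N) * f N s t = of_real (\<psi> N t) * of_real t powr ((s - of_nat d) / 2 - 1)"
    if "N \<ge> 1" "t > 0" for N s t
  proof -
    have "A N * assoc_bspline N (real N / (\<beta> N)\<^sup>2 * t) (knots u x N) = \<psi> N t"
      unfolding A_def \<psi>_def S_def 
      by (rule normalized_bspline_eq[OF assms(1,2)]; (erule assms(3-5) | fact that))
    then show ?thesis
      unfolding f_def by (simp only: mult.assoc[symmetric] of_real_mult[symmetric])
  qed
  have dom1: "integrable lborel (\<lambda>t. indicator {0<..} t * (Theta d t * t powr Re ((s - of_nat d) / 2 - 1)))"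
    if "Re s > real d" for s
    using nspline_Theta_dominated(1)[OF assms(1) S lim, of "(Re s - real d) / 2"] that by simp
  have dom2: "integrable lborel (\<lambda>t. indicator {0<..} t * (\<psi> N t * t powr Re ((s - of_nat d) / 2 - 1)))"
    if "Re s > real d" "N \<ge> 1" for s N
    using nspline_powr_integrable[OF knots[OF that(2)] knots_pos[OF that(2)] that(2), of "(Re s - real d) / 2"] that by (simp add: \<psi>_def)
  have \<psi>_meas: "(\<lambda>t. indicator {0<..} t * \<psi> N t) \<in> borel_measurable borel" for N
    unfolding \<psi>_def using borel_measurable_nspline_inverse[of N "S N"] by measurable
  note \<Theta>_meas = borel_measurable_Theta[OF assms(1)]
  have g_int: "set_integrable lborel {0<..} (g s)" if "Re s > real d" for s
    unfolding g_def by (rule complex_powr_set_integral(1)[OF \<Theta>_meas dom1[OF that]])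
  have \<psi>_int: "set_integrable lborel {0<..} (\<lambda>t. of_real (\<psi> N t) * of_real t powr ((s - of_nat d) / 2 - 1))"
    if "Re s > real d" "N \<ge> 1" for s N
    by (rule complex_powr_set_integral(1)[OF \<psi>_meas dom2[OF that]])
  have f_int: "set_integrable lborel {0<..} (f N s)" if "Re s > real d" "N \<ge> 1" for s N
  proof -
    \<comment> \<open>The estimates concern the normalized spline, that is \<open>A N\<close> times
      the given integrand. Since \<open>A N\<close> is nonzero, integrability can be divided
      back.\<close>
    have "set_integrable lborel {0<..} (\<lambda>t. inverse (complex_of_real (A N)) * (of_real (\<psi> N t) * of_real t powr ((s - of_nat d) / 2 - 1)))"
      using \<psi>_int[OF that] by (rule set_integrable_mult_right)
    also have "?this \<longleftrightarrow> set_integrable lborel {0<..} (f N s)"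
    proof (rule set_integrable_cong)
      fix t :: real assume "t \<in> {0<..}"
      then have "of_real (\<psi> N t) * of_real t powr ((s - of_nat d) / 2 - 1) = of_real (A N) * f N s t"
        using Af[OF that(2), of t s] by simp
      then show "inverse (complex_of_real (A N)) * (of_real (\<psi> N t) * of_real t powr ((s - of_nat d) / 2 - 1)) = f N s t"
        using A_pos[OF that(2)] by simp
    qed auto
    finally show ?thesis .
  qed
  have F_eq: "F N s = (LINT t:{0<..}|lborel. of_real (\<psi> N t) * of_real t powr ((s - of_nat d) / 2 - 1))"
    if "N \<ge> 1" for N s
  proof -
    have "F N s = (LINT t:{0<..}|lborel. of_real (A N) * f N s t)"
      unfolding F_def A_def by (rule set_integral_mult_right[symmetric])
    also have "\<dots> = (LINT t:{0<..}|lborel. of_real (\<psi> N t) * of_real t powr ((s - of_nat d) / 2 - 1))"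
      by (rule set_lebesgue_integral_cong) (use Af[OF that] in auto)
    finally show ?thesis .
  qed
  have key: "cmod (F N s - G s) \<le> E r N" if "Re s = r" "r > real d" "N \<ge> 1" for N s r
  proof -
    have s: "Re s > real d" using that by simp
    let ?w = "(s - of_nat d) / 2 - 1"
    have "F N s - G s = (LINT t:{0<..}|lborel. of_real (\<psi> N t) * of_real t powr ?w - g s t)"
      unfolding F_eq[OF that(3)] G_def
      by (rule set_integral_diff(2)[OF \<psi>_int[OF s that(3)] g_int[OF s], symmetric])
    also have "\<dots> = (LINT t:{0<..}|lborel. of_real (\<psi> N t - Theta d t) * of_real t powr ?w)"
      unfolding g_def by (simp add: left_diff_distrib)
    also have "cmod \<dots> \<le> (\<integral>t. indicator {0<..} t * (\<bar>\<psi> N t - Theta d t\<bar> * t powr Re ?w) \<partial>lborel)"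
    proof (rule complex_powr_set_integral(2))
      have "(\<lambda>t. indicator {0<..} t * \<psi> N t - indicator {0<..} t * Theta d t) \<in> borel_measurable borel"
        using \<psi>_meas[of N] \<Theta>_meas by measurable
      then show "(\<lambda>t. indicator {0<..} t * (\<psi> N t - Theta d t)) \<in> borel_measurable borel"
        by (simp add: right_diff_distrib)
      have "integrable lborel (\<lambda>t. indicator {0<..} t * (\<psi> N t * t powr Re ?w) - indicator {0<..} t * (Theta d t * t powr Re ?w))"
        by (intro Bochner_Integration.integrable_diff dom1 dom2 s that(3))
      then show "integrable lborel (\<lambda>t. indicator {0<..} t * ((\<psi> N t - Theta d t) * t powr Re ?w))"
        by (simp add: right_diff_distrib left_diff_distrib)
    qed
    also have "\<dots> = E r N" unfolding E_def using that(1) by simp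
    finally show ?thesis .
  qed
  have E_lim: "E r \<longlonglongrightarrow> 0" if "r > real d" for r
    unfolding E_def \<psi>_def
    using nspline_Theta_dominated(2)[OF assms(1) S lim, of "(r - real d) / 2"] that by simp
  have unif: "uniform_limit {s. Re s = r} F G sequentially" if "r > real d" for r
  proof (rule uniform_limitI)
    fix e :: real assume "e > 0"
    have "\<forall>\<^sub>F N in sequentially. E r N < e"
      by (rule order_tendstoD(2)[OF E_lim[OF that] \<open>e > 0\<close>])
    then show "\<forall>\<^sub>F N in sequentially. \<forall>s\<in>{s. Re s = r}. dist (F N s) (G s) < e"
      using eventually_ge_at_top[of 1]
    proof eventually_elim
      case (elim N)
      show ?case
      proof
        fix s assume "s \<in> {s. Re s = r}"
        then have "cmod (F N s - G s) \<le> E r N" using that elim by (intro key) auto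
        then show "dist (F N s) (G s) < e" using elim by (simp add: dist_norm)
      qed
    qed
  qed
  show ?thesis
  proof (intro conjI allI impI)
    fix s assume s: "Re s > real d"
    show "set_integrable lborel {0<..} (f N s)" if "N \<ge> 1" for N by (rule f_int[OF s that])
    show "set_integrable lborel {0<..} (g s)" by (rule g_int[OF s])
    show "(\<lambda>N. F N s) \<longlonglongrightarrow> G s"
      by (rule tendsto_uniform_limitI[OF unif[OF s]]) simp
  next
    fix r K assume "r > real d" "compact K \<and> K \<subseteq> {s. Re s = r}"
    then show "uniform_limit K F G sequentially"
      by (intro uniform_limit_on_subset[OF unif]) auto
  qed
qed

end
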